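(* Suppose that $\mathbf{g}$ is a Lorentzian metric on $M$ for which the isometric embedding system $\mathcal{I}$ into Minkowski space $\mathbb{R}^{1,2}$ is Darboux integrable; let $K$ be its Gauss curvature, $\varepsilon=\operatorname{sgn}K$ and $q=|K|^{-3/4}$. Then $\mathbf{g}$ admits a Killing field $V$, namely $V=q_1e_2-q_2e_1$, and: - If $V$ is spacelike, then there exist local coordinates $(s,t)$ on $M$ with respect to which the metric can be written in the form $$\mathbf{g}=ds^2-q'(s)^2\,dt^2,$$ where $q=q(s)$ is a strictly monotone solution of the ODE $q''=3\varepsilon q^{-1/3}$. - If $V$ is timelike, then there exist local coordinates $(s,t)$ on $M$ with respect to which the metric can be written in the form $$\mathbf{g}=q'(s)^2\,dt^2-ds^2,$$ where $q=q(s)$ is a strictly monotone solution of the ODE $q''=-3\varepsilon q^{-1/3}$. In either case, in these coordinates the Killing field is given by $V=\dfrac{\partial}{\partial t}$.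
   Context: $M$ is a Lorentzian surface whose Gauss curvature $K$ is strictly positive ($\varepsilon=1$, elliptic case) or strictly negative ($\varepsilon=-1$, hyperbolic case). $\mathcal{F}_M$ is its orthonormal frame bundle (frames $(e_1,e_2)$ with $\langle e_1,e_1\rangle=1$, $\langle e_2,e_2\rangle=-1$, $\langle e_1,e_2\rangle=0$), with canonical dual forms $\eta^1,\eta^2$ (so $\mathbf{g}=(\eta^1)^2-(\eta^2)^2$) and connection form $\eta^1_2=\eta^2_1$ satisfying $$d\eta^1=-\eta^1_2\wedge\eta^2,\quad d\eta^2=-\eta^2_1\wedge\eta^1,\quad d\eta^1_2=-K\,\eta^1\wedge\eta^2,$$ which fixes the sign convention for $K$. The functions $q_1,q_2$ are defined by $dq=q_1\eta^1+q_2\eta^2$; the vector field $V=q_1e_2-q_2e_1$ is computed in a local orthonormal framing $(e_1,e_2)$ of $M$ (it depends on the framing at most up to sign, according to orientation). A vector $X$ is spacelike if $\langle X,X\rangle<0$ and timelike if $\langle X,X\rangle>0$. $\mathbb{R}^{1,2}$ is $\mathbb{R}^3$ with inner product of signature $(1,2)$. $\mathcal{F}_{\mathbb{R}^{1,2}}$ is the bundle of orthonormal frames $(e_1,e_2,e_3)$ with $\langle e_1,e_1\rangle=1$, $\langle e_2,e_2\rangle=\langle e_3,e_3\rangle=-1$, $\langle e_a,e_b\rangle=0$ for $a\ne b$; with basepoint map $\rho$, its canonical and connection forms are defined by $d\rho=e_i\omega^i$, $de_i=e_j\omega^j_i$. Isometric embedding system: $\mathcal{I}$ is the Pfaffian exterior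 differential system on $\mathcal{F}_M\times\mathcal{F}_{\mathbb{R}^{1,2}}$ generated by $$\theta_0=\omega^3,\quad \theta_1=\omega^1-\eta^1,\quad \theta_2=\omega^2-\eta^2,\quad \theta_3=\omega^1_2-\eta^1_2 .$$ Darboux integrability. Put $k=\sqrt{|K|}$. If $K<0$, the singular systems are $V_\pm=\operatorname{span}\{\theta_0,\theta_1,\theta_2,\theta_3,\omega^3_1\mp k\eta^2,\omega^3_2\pm k\eta^1\}$; if $K>0$, they are the complex subbundle $W=\operatorname{span}_{\mathbb{C}}\{\theta_0,\theta_1,\theta_2,\theta_3,\omega^3_1-\mathrm{i}k\eta^2,\omega^3_2+\mathrm{i}k\eta^1\}$ of the complexified cotangent bundle and its conjugate $\overline{W}$. $\mathcal{I}$ is Darboux integrable if, locally, each of the two singular systems contains a (real, respectively complex) Frobenius subbundle of rank at least $2$ that intersects the span of $\theta_0,\theta_1,\theta_2,\theta_3$ only in $0$. *)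

theory Defs
  imports "HOL-Analysis.Analysis"
begin

section \<open>Smooth maps and differential forms on open sets of normed spaces\<close>

text \<open>For open \<open>S\<close> in a finite-dimensional space this is the class $C^k$, phrased by iterated
  directional derivatives.\<close>

primrec Ck_on ::
  "nat \<Rightarrow> 'a::real_normed_vector set \<Rightarrow> ('a \<Rightarrow> 'b::real_normed_vector) \<Rightarrow> bool" where
  "Ck_on 0 S f = continuous_on S f"
| "Ck_on (Suc k) S f =
     (f differentiable_on S \<and> (\<forall>v. Ck_on k S (\<lambda>x. frechet_derivative f (at x) v)))"

definition smooth_on ::
  "'a::real_normed_vector set \<Rightarrow> ('a \<Rightarrow> 'b::real_normed_vector) \<Rightarrow> bool" where
  "smooth_on S f \<longleftrightarrow> (\<forall>k. Ck_on k S f)"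

text \<open>A 1-form is a map \<open>point \<Rightarrow> tangent vector \<Rightarrow> scalar\<close>. The scalars \<open>'k\<close> are the real or the
  complex numbers; a complex 1-form is a section of the complexified cotangent bundle, i.e. a
  real-linear complex-valued function on real tangent vectors.\<close>

definition smooth_form ::
  "'e::real_normed_vector set \<Rightarrow> ('e \<Rightarrow> 'e \<Rightarrow> 'k::real_normed_field) \<Rightarrow> bool" where
  "smooth_form B \<alpha> \<longleftrightarrow> (\<forall>x\<in>B. linear (\<alpha> x)) \<and> (\<forall>v. smooth_on B (\<lambda>x. \<alpha> x v))"

definition ext_deriv ::
  "('e::real_normed_vector \<Rightarrow> 'e \<Rightarrow> 'k::real_normed_field) \<Rightarrow> 'e \<Rightarrow> 'e \<Rightarrow> 'e \<Rightarrow> 'k" where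
  "ext_deriv \<alpha> x X Y =
     frechet_derivative (\<lambda>y. \<alpha> y Y) (at x) X - frechet_derivative (\<lambda>y. \<alpha> y X) (at x) Y"

definition wedge :: "('e \<Rightarrow> 'k::real_normed_field) \<Rightarrow> ('e \<Rightarrow> 'k) \<Rightarrow> 'e \<Rightarrow> 'e \<Rightarrow> 'k" where
  "wedge a b X Y = a X * b Y - a Y * b X"

text \<open>The frame bundles below are embedded submanifolds \<open>N\<close> of a normed space. For these the
  velocities at \<open>0\<close> of curves lying in \<open>N\<close> form the tangent space. Forms on \<open>N\<close> are restrictions
  of forms on open sets of the ambient space, so that all identities between forms on \<open>N\<close>, also
  those between exterior derivatives, are tested on vectors tangent to \<open>N\<close> only.\<close>

definition tangent_vectors :: "'e::real_normed_vector set \<Rightarrow> 'e \<Rightarrow> 'e set" where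
  "tangent_vectors N p =
     {v. \<exists>\<gamma>. \<gamma> 0 = p \<and> (\<forall>\<^sub>F t in nhds (0::real). \<gamma> t \<in> N) \<and> (\<gamma> has_vector_derivative v) (at 0)}"

definition covector_span ::
  "'e set \<Rightarrow> ('e \<Rightarrow> 'k::real_normed_field) list \<Rightarrow> ('e \<Rightarrow> 'k) set" where
  "covector_span T as = {b. \<exists>c. \<forall>X\<in>T. b X = (\<Sum>i<length as. c i * (as ! i) X)}"

definition covector_indep ::
  "'e set \<Rightarrow> ('e \<Rightarrow> 'k::real_normed_field) list \<Rightarrow> bool" where
  "covector_indep T as \<longleftrightarrow>
     (\<forall>c. (\<forall>X\<in>T. (\<Sum>i<length as. c i * (as ! i) X) = 0) \<longrightarrow> (\<forall>i<length as. c i = 0))"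

abbreviation forms_at :: "('e \<Rightarrow> 'e \<Rightarrow> 'k) list \<Rightarrow> 'e \<Rightarrow> ('e \<Rightarrow> 'k) list" where
  "forms_at F x \<equiv> map (\<lambda>\<alpha>. \<alpha> x) F"

text \<open>\<open>F\<close> is a frame over \<open>N \<inter> B\<close> of a subbundle of the cotangent bundle of \<open>N\<close>, and the
  subbundle is Frobenius: $d\alpha \equiv 0$ modulo \<open>F\<close> for each \<open>\<alpha>\<close> in \<open>F\<close>.\<close>

definition frobenius_frame ::
  "'e::real_normed_vector set \<Rightarrow> 'e set \<Rightarrow> ('e \<Rightarrow> 'e \<Rightarrow> 'k::real_normed_field) list \<Rightarrow> bool" where
  "frobenius_frame N B F \<longleftrightarrow>
     (\<forall>\<alpha>\<in>set F. smooth_form B \<alpha>) \<and>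
     (\<forall>x\<in>N \<inter> B.
        covector_indep (tangent_vectors N x) (forms_at F x) \<and>
        (\<forall>\<alpha>\<in>set F. \<exists>\<beta>. (\<forall>j<length F. linear (\<beta> j)) \<and>
           (\<forall>X\<in>tangent_vectors N x. \<forall>Y\<in>tangent_vectors N x.
              ext_deriv \<alpha> x X Y = (\<Sum>j<length F. wedge (\<beta> j) ((F ! j) x) X Y))))"

text \<open>Near \<open>y\<close>, the bundle spanned by \<open>S\<close> contains a Frobenius subbundle of rank at least 2 that
  meets the bundle spanned by \<open>I\<close> only in 0.\<close>

definition has_transverse_frobenius ::
  "'e::real_normed_vector set \<Rightarrow> ('e \<Rightarrow> 'e \<Rightarrow> 'k::real_normed_field) list
     \<Rightarrow> ('e \<Rightarrow> 'e \<Rightarrow> 'k) list \<Rightarrow> 'e \<Rightarrow> bool" where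
  "has_transverse_frobenius N I S y \<longleftrightarrow>
     (\<exists>B F. open B \<and> y \<in> B \<and> 2 \<le> length F \<and> frobenius_frame N B F \<and>
        (\<forall>x\<in>N \<inter> B. let T = tangent_vectors N x in
           covector_span T (forms_at F x) \<subseteq> covector_span T (forms_at S x) \<and>
           (\<forall>a \<in> covector_span T (forms_at F x) \<inter> covector_span T (forms_at I x).
              \<forall>X\<in>T. a X = 0)))"


section \<open>Lorentzian surfaces\<close>

text \<open>A chart is a pair of its domain and its coordinate map.\<close>

type_synonym 'm chart = "'m set \<times> ('m \<Rightarrow> real^2)"

abbreviation chart_dom :: "'m chart \<Rightarrow> 'm set" where "chart_dom c \<equiv> fst c"
abbreviation coord :: "'m chart \<Rightarrow> 'm \<Rightarrow> real^2" where "coord c \<equiv> snd c"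
abbreviation chart_img :: "'m chart \<Rightarrow> (real^2) set" where "chart_img c \<equiv> coord c ` chart_dom c"
abbreviation pt :: "'m chart \<Rightarrow> real^2 \<Rightarrow> 'm" where "pt c \<equiv> inv_into (chart_dom c) (coord c)"

definition is_chart :: "'m::topological_space chart \<Rightarrow> bool" where
  "is_chart c \<longleftrightarrow>
     open (chart_dom c) \<and> open (chart_img c) \<and> homeomorphism (chart_dom c) (chart_img c) (coord c) (pt c)"

definition compatible :: "'m chart \<Rightarrow> 'm chart \<Rightarrow> bool" where
  "compatible c d \<longleftrightarrow>
     smooth_on (coord c ` (chart_dom c \<inter> chart_dom d)) (coord d \<circ> pt c) \<and>
     smooth_on (coord d ` (chart_dom c \<inter> chart_dom d)) (coord c \<circ> pt d)"

text \<open>The atlas of a smooth surface is maximal, so the local coordinate systems on the surface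
  are exactly the members of its atlas.\<close>

definition smooth_surface :: "'m::topological_space set \<Rightarrow> 'm chart set \<Rightarrow> bool" where
  "smooth_surface M A \<longleftrightarrow>
     (\<Union>c\<in>A. chart_dom c) = M \<and>
     (\<forall>c\<in>A. is_chart c) \<and>
     (\<forall>c\<in>A. \<forall>d\<in>A. compatible c d) \<and>
     (\<forall>c. is_chart c \<and> chart_dom c \<subseteq> M \<and> (\<forall>d\<in>A. compatible c d) \<longrightarrow> c \<in> A)"

text \<open>Differential at the coordinate point \<open>x\<close> of the coordinate change from \<open>c\<close> to \<open>d\<close>.\<close>

definition chart_change :: "'m chart \<Rightarrow> 'm chart \<Rightarrow> real^2 \<Rightarrow> real^2 \<Rightarrow> real^2" where
  "chart_change c d x = frechet_derivative (coord d \<circ> pt c) (at x)"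

text \<open>Tensor fields are given classically, by their components in every chart of the atlas,
  as functions of the coordinates, subject to the transformation law.\<close>

type_synonym 'm metric = "'m chart \<Rightarrow> real^2 \<Rightarrow> real^2 \<Rightarrow> real^2 \<Rightarrow> real"
type_synonym 'm vfield = "'m chart \<Rightarrow> real^2 \<Rightarrow> real^2"

definition vector_field_on :: "'m chart set \<Rightarrow> 'm set \<Rightarrow> 'm vfield \<Rightarrow> bool" where
  "vector_field_on A W V \<longleftrightarrow>
     (\<forall>c\<in>A. smooth_on (coord c ` (chart_dom c \<inter> W)) (V c)) \<and>
     (\<forall>c\<in>A. \<forall>d\<in>A. \<forall>p\<in>chart_dom c \<inter> chart_dom d \<inter> W.
        V d (coord d p) = chart_change c d (coord c p) (V c (coord c p)))"

definition lorentzian_metric :: "'m chart set \<Rightarrow> 'm metric \<Rightarrow> bool" where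
  "lorentzian_metric A g \<longleftrightarrow>
     (\<forall>c\<in>A. \<forall>u v. smooth_on (chart_img c) (\<lambda>x. g c x u v)) \<and>
     (\<forall>c\<in>A. \<forall>x\<in>chart_img c.
        bilinear (g c x) \<and> (\<forall>u v. g c x u v = g c x v u) \<and>
        (\<exists>u v. g c x u u = 1 \<and> g c x v v = -1 \<and> g c x u v = 0)) \<and>
     (\<forall>c\<in>A. \<forall>d\<in>A. \<forall>p\<in>chart_dom c \<inter> chart_dom d. \<forall>u v.
        g c (coord c p) u v =
          g d (coord d p) (chart_change c d (coord c p) u) (chart_change c d (coord c p) v))"

definition orthonormal_framing ::
  "'m chart set \<Rightarrow> 'm metric \<Rightarrow> 'm set \<Rightarrow> 'm vfield \<Rightarrow> 'm vfield \<Rightarrow> bool" where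
  "orthonormal_framing A g W E1 E2 \<longleftrightarrow>
     vector_field_on A W E1 \<and> vector_field_on A W E2 \<and>
     (\<forall>c\<in>A. \<forall>x\<in>coord c ` (chart_dom c \<inter> W).
        g c x (E1 c x) (E1 c x) = 1 \<and> g c x (E2 c x) (E2 c x) = -1 \<and>
        g c x (E1 c x) (E2 c x) = 0)"

definition lie_derivative_metric ::
  "'m metric \<Rightarrow> 'm vfield \<Rightarrow> 'm chart \<Rightarrow> real^2 \<Rightarrow> real^2 \<Rightarrow> real^2 \<Rightarrow> real" where
  "lie_derivative_metric g V c x u v =
     frechet_derivative (\<lambda>y. g c y u v) (at x) (V c x)
     + g c x (frechet_derivative (V c) (at x) u) v
     + g c x u (frechet_derivative (V c) (at x) v)"

definition killing_field_on ::
  "'m chart set \<Rightarrow> 'm metric \<Rightarrow> 'm set \<Rightarrow> 'm vfield \<Rightarrow> bool" where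
  "killing_field_on A g W V \<longleftrightarrow>
     vector_field_on A W V \<and>
     (\<forall>c\<in>A. \<forall>x\<in>coord c ` (chart_dom c \<inter> W). \<forall>u v. lie_derivative_metric g V c x u v = 0)"

text \<open>The norm of \<open>V\<close> at \<open>p\<close> does not depend on the chart. Signature convention: timelike vectors
  have positive norm.\<close>

definition timelike_at :: "'m chart set \<Rightarrow> 'm metric \<Rightarrow> 'm vfield \<Rightarrow> 'm \<Rightarrow> bool" where
  "timelike_at A g V p \<longleftrightarrow>
     (\<exists>c\<in>A. p \<in> chart_dom c \<and> g c (coord c p) (V c (coord c p)) (V c (coord c p)) > 0)"

definition spacelike_at :: "'m chart set \<Rightarrow> 'm metric \<Rightarrow> 'm vfield \<Rightarrow> 'm \<Rightarrow> bool" where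
  "spacelike_at A g V p \<longleftrightarrow>
     (\<exists>c\<in>A. p \<in> chart_dom c \<and> g c (coord c p) (V c (coord c p)) (V c (coord c p)) < 0)"

text \<open>The coefficients in $dq = q_1\eta^1 + q_2\eta^2$ are $q_i = dq(e_i)$; the field is
  $q_1 e_2 - q_2 e_1$.\<close>

definition framed_deriv :: "('m \<Rightarrow> real) \<Rightarrow> 'm vfield \<Rightarrow> 'm chart \<Rightarrow> real^2 \<Rightarrow> real" where
  "framed_deriv q E c x = frechet_derivative (q \<circ> pt c) (at x) (E c x)"

definition skew_gradient :: "('m \<Rightarrow> real) \<Rightarrow> 'm vfield \<Rightarrow> 'm vfield \<Rightarrow> 'm vfield" where
  "skew_gradient q E1 E2 c x =
     framed_deriv q E1 c x *\<^sub>R E2 c x - framed_deriv q E2 c x *\<^sub>R E1 c x"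


section \<open>The orthonormal frame bundle of the surface\<close>

text \<open>Over the domain of a chart, a frame is a triple \<open>(x, e1, e2)\<close> of the coordinates of its
  basepoint and the components of the two frame vectors; \<open>h\<close> is the metric in that chart.\<close>

type_synonym frame2 = "(real^2) \<times> (real^2) \<times> (real^2)"

definition frame_bundle ::
  "(real^2) set \<Rightarrow> (real^2 \<Rightarrow> real^2 \<Rightarrow> real^2 \<Rightarrow> real) \<Rightarrow> frame2 set" where
  "frame_bundle D h =
     {(x, e1, e2). x \<in> D \<and> h x e1 e1 = 1 \<and> h x e2 e2 = -1 \<and> h x e1 e2 = 0}"

text \<open>The canonical forms are the coefficients in $dx = e_1\eta^1 + e_2\eta^2$.\<close>

fun eta1 :: "(real^2 \<Rightarrow> real^2 \<Rightarrow> real^2 \<Rightarrow> real) \<Rightarrow> frame2 \<Rightarrow> frame2 \<Rightarrow> real" where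
  "eta1 h (x, e1, e2) (dx, de1, de2) = h x dx e1"

fun eta2 :: "(real^2 \<Rightarrow> real^2 \<Rightarrow> real^2 \<Rightarrow> real) \<Rightarrow> frame2 \<Rightarrow> frame2 \<Rightarrow> real" where
  "eta2 h (x, e1, e2) (dx, de1, de2) = - h x dx e2"

lemma surface_frame_expansion:
  fixes h :: "real^2 \<Rightarrow> real^2 \<Rightarrow> real"
  assumes h: "bilinear h" and "h e1 e1 = 1" "h e2 e2 = -1" "h e1 e2 = 0" "h e2 e1 = 0"
  shows "v = h v e1 *\<^sub>R e1 - h v e2 *\<^sub>R e2"
proof -
  have lin: "h (a *\<^sub>R x + b *\<^sub>R y) z = a * h x z + b * h y z" for a b x y z
    using h by (simp add: bilinear_ladd bilinear_lmul)
  have z: "h 0 z = 0" for z using h by (simp add: bilinear_lzero)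
  have ne: "e1 \<noteq> e2" using assms by auto
  have ind: "independent {e1, e2}"
  proof (rule independent_if_scalars_zero)
    fix f x assume "(\<Sum>x\<in>{e1,e2}. f x *\<^sub>R x) = 0" and x: "x \<in> {e1, e2}"
    then have *: "f e1 *\<^sub>R e1 + f e2 *\<^sub>R e2 = 0" using ne by simp
    have "f e1 = 0" "f e2 = 0"
      using lin[of "f e1" e1 "f e2" e2 e1, unfolded * z] lin[of "f e1" e1 "f e2" e2 e2, unfolded * z]
        assms by simp_all
    then show "f x = 0" using x by auto
  qed simp
  have "v \<in> span {e1, e2}"
    using card_ge_dim_independent[of "{e1, e2}" UNIV] ind ne by auto
  then obtain a b where v: "v = a *\<^sub>R e1 + b *\<^sub>R e2"
    by (auto simp: span_breakdown_eq) (metis add.commute diff_eq_eq)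
  show ?thesis using lin[of a e1 b e2 e1] lin[of a e1 b e2 e2] assms by (simp add: v)
qed

lemma canonical_form_expansion:
  assumes "(x, e1, e2) \<in> frame_bundle D h" "bilinear (h x)" "\<And>u v. h x u v = h x v u"
  shows "dx = eta1 h (x, e1, e2) (dx, de1, de2) *\<^sub>R e1 + eta2 h (x, e1, e2) (dx, de1, de2) *\<^sub>R e2"
  using surface_frame_expansion[of "h x" e1 e2 dx] assms by (auto simp: frame_bundle_def)

text \<open>The structure equations determine the restriction of the connection form
  $\eta^1_2 = \eta^2_1$ to the frame bundle, and the Gauss curvature \<open>K\<close>, uniquely.\<close>

type_synonym 'm connection = "'m chart \<Rightarrow> frame2 \<Rightarrow> frame2 \<Rightarrow> real"

definition structure_equations ::
  "'m chart set \<Rightarrow> 'm metric \<Rightarrow> 'm connection \<Rightarrow> ('m \<Rightarrow> real) \<Rightarrow> bool" where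
  "structure_equations A g eta12 K \<longleftrightarrow>
     (\<forall>c\<in>A. smooth_form {y. fst y \<in> chart_img c} (eta12 c) \<and>
       (\<forall>y\<in>frame_bundle (chart_img c) (g c).
        \<forall>X\<in>tangent_vectors (frame_bundle (chart_img c) (g c)) y.
        \<forall>Y\<in>tangent_vectors (frame_bundle (chart_img c) (g c)) y.
          ext_deriv (eta1 (g c)) y X Y = - wedge (eta12 c y) (eta2 (g c) y) X Y \<and>
          ext_deriv (eta2 (g c)) y X Y = - wedge (eta12 c y) (eta1 (g c) y) X Y \<and>
          ext_deriv (eta12 c) y X Y =
            - K (pt c (fst y)) * wedge (eta1 (g c) y) (eta2 (g c) y) X Y))"


section \<open>The orthonormal frame bundle of Minkowski space\<close>

definition mink :: "real^3 \<Rightarrow> real^3 \<Rightarrow> real" where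
  "mink u v = u$1 * v$1 - u$2 * v$2 - u$3 * v$3"

type_synonym frame3 = "(real^3) \<times> (real^3) \<times> (real^3) \<times> (real^3)"

definition mink_frame :: "real^3 \<Rightarrow> real^3 \<Rightarrow> real^3 \<Rightarrow> bool" where
  "mink_frame e1 e2 e3 \<longleftrightarrow>
     mink e1 e1 = 1 \<and> mink e2 e2 = -1 \<and> mink e3 e3 = -1 \<and>
     mink e1 e2 = 0 \<and> mink e1 e3 = 0 \<and> mink e2 e3 = 0"

definition mink_frame_bundle :: "frame3 set" where
  "mink_frame_bundle = {(p, e1, e2, e3). mink_frame e1 e2 e3}"

text \<open>The forms defined by $d\rho = e_i\omega^i$ and $de_i = e_j\omega^j_i$ are obtained by taking
  inner products with the frame vectors; \<open>omega_ji\<close> is $\omega^j_i$.\<close>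

fun omega_1 :: "frame3 \<Rightarrow> frame3 \<Rightarrow> real" where
  "omega_1 (p, e1, e2, e3) (dp, de1, de2, de3) = mink dp e1"

fun omega_2 :: "frame3 \<Rightarrow> frame3 \<Rightarrow> real" where
  "omega_2 (p, e1, e2, e3) (dp, de1, de2, de3) = - mink dp e2"

fun omega_3 :: "frame3 \<Rightarrow> frame3 \<Rightarrow> real" where
  "omega_3 (p, e1, e2, e3) (dp, de1, de2, de3) = - mink dp e3"

fun omega_12 :: "frame3 \<Rightarrow> frame3 \<Rightarrow> real" where
  "omega_12 (p, e1, e2, e3) (dp, de1, de2, de3) = mink de2 e1"

fun omega_31 :: "frame3 \<Rightarrow> frame3 \<Rightarrow> real" where
  "omega_31 (p, e1, e2, e3) (dp, de1, de2, de3) = - mink de1 e3"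

fun omega_32 :: "frame3 \<Rightarrow> frame3 \<Rightarrow> real" where
  "omega_32 (p, e1, e2, e3) (dp, de1, de2, de3) = - mink de2 e3"

lemma mink_frame_expansion:
  assumes "mink_frame e1 e2 e3"
  shows "v = mink v e1 *\<^sub>R e1 - mink v e2 *\<^sub>R e2 - mink v e3 *\<^sub>R e3"
proof -
  define P :: "real^3^3" where "P = transpose (vector [e1, e2, e3])"
  define L :: "real^3^3" where "L = vector [vector [e1$1, -e1$2, -e1$3],
    vector [-e2$1, e2$2, e2$3], vector [-e3$1, e3$2, e3$3]]"
  have "L ** P = mat 1"
    using assms
    by (simp add: P_def L_def mink_frame_def mink_def matrix_matrix_mult_def mat_def vec_eq_iff
        forall_3 sum_3 vector_3 transpose_def algebra_simps)
  then have "P ** L = mat 1"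
    by (simp add: matrix_left_right_inverse)
  then have "P *v (L *v v) = v"
    by (simp add: matrix_vector_mul_assoc)
  then show ?thesis
    by (simp add: P_def L_def mink_def matrix_vector_mult_def vec_eq_iff
        forall_3 sum_3 vector_3 transpose_def algebra_simps)
qed

lemma mink_form_expansion:
  fixes dp de1 de2 de3 :: "real^3"
  assumes "(p, e1, e2, e3) \<in> mink_frame_bundle"
  defines "y \<equiv> (p, e1, e2, e3)" and "X \<equiv> (dp, de1, de2, de3)"
  shows "dp = omega_1 y X *\<^sub>R e1 + omega_2 y X *\<^sub>R e2 + omega_3 y X *\<^sub>R e3"
    and "de1 = mink de1 e1 *\<^sub>R e1 - mink de1 e2 *\<^sub>R e2 + omega_31 y X *\<^sub>R e3"
    and "de2 = omega_12 y X *\<^sub>R e1 - mink de2 e2 *\<^sub>R e2 + omega_32 y X *\<^sub>R e3"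
  using mink_frame_expansion[of e1 e2 e3 dp] mink_frame_expansion[of e1 e2 e3 de1]
    mink_frame_expansion[of e1 e2 e3 de2] assms(1)
  by (auto simp: mink_frame_bundle_def y_def X_def)


section \<open>The isometric embedding system and its Darboux integrability\<close>

definition theta_forms ::
  "(real^2 \<Rightarrow> real^2 \<Rightarrow> real^2 \<Rightarrow> real) \<Rightarrow> (frame2 \<Rightarrow> frame2 \<Rightarrow> real)
     \<Rightarrow> (frame2 \<times> frame3 \<Rightarrow> frame2 \<times> frame3 \<Rightarrow> real) list" where
  "theta_forms h eta12 =
     [\<lambda>y X. omega_3 (snd y) (snd X),
      \<lambda>y X. omega_1 (snd y) (snd X) - eta1 h (fst y) (fst X),
      \<lambda>y X. omega_2 (snd y) (snd X) - eta2 h (fst y) (fst X),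
      \<lambda>y X. omega_12 (snd y) (snd X) - eta12 (fst y) (fst X)]"

definition scalar_ext :: "('e \<Rightarrow> 'e \<Rightarrow> real) \<Rightarrow> 'e \<Rightarrow> 'e \<Rightarrow> 'k::real_normed_field" where
  "scalar_ext \<alpha> y X = of_real (\<alpha> y X)"

text \<open>The singular systems, with \<open>k\<close> a function of the basepoint coordinates: $V_\pm$ for the real
  scalars $\lambda = \pm 1$, and $W$, $\overline{W}$ for the complex scalars
  $\lambda = \pm\mathrm{i}$.\<close>

definition singular_system ::
  "(real^2 \<Rightarrow> real^2 \<Rightarrow> real^2 \<Rightarrow> real) \<Rightarrow> (frame2 \<Rightarrow> frame2 \<Rightarrow> real) \<Rightarrow> (real^2 \<Rightarrow> real)
     \<Rightarrow> 'k \<Rightarrow> (frame2 \<times> frame3 \<Rightarrow> frame2 \<times> frame3 \<Rightarrow> 'k::real_normed_field) list" where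
  "singular_system h eta12 k lam =
     map scalar_ext (theta_forms h eta12) @
     [\<lambda>y X. of_real (omega_31 (snd y) (snd X))
        - lam * of_real (k (fst (fst y)) * eta2 h (fst y) (fst X)),
      \<lambda>y X. of_real (omega_32 (snd y) (snd X))
        + lam * of_real (k (fst (fst y)) * eta1 h (fst y) (fst X))]"

definition singular_system_darboux ::
  "'m metric \<Rightarrow> 'm connection \<Rightarrow> ('m \<Rightarrow> real) \<Rightarrow> 'm chart
     \<Rightarrow> 'k::real_normed_field \<Rightarrow> frame2 \<times> frame3 \<Rightarrow> bool" where
  "singular_system_darboux g eta12 K c lam y \<longleftrightarrow>
     has_transverse_frobenius (frame_bundle (chart_img c) (g c) \<times> mink_frame_bundle)
       (map scalar_ext (theta_forms (g c) (eta12 c)))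
       (singular_system (g c) (eta12 c) (\<lambda>x. sqrt \<bar>K (pt c x)\<bar>) lam) y"

definition darboux_integrable ::
  "'m chart set \<Rightarrow> 'm metric \<Rightarrow> 'm connection \<Rightarrow> ('m \<Rightarrow> real) \<Rightarrow> bool" where
  "darboux_integrable A g eta12 K \<longleftrightarrow>
     (\<forall>c\<in>A. \<forall>y\<in>frame_bundle (chart_img c) (g c) \<times> mink_frame_bundle.
        (K (pt c (fst (fst y))) < 0 \<longrightarrow>
           singular_system_darboux g eta12 K c (1::real) y \<and>
           singular_system_darboux g eta12 K c (-1::real) y) \<and>
        (K (pt c (fst (fst y))) > 0 \<longrightarrow>
           singular_system_darboux g eta12 K c \<i> y \<and>
           singular_system_darboux g eta12 K c (- \<i>) y))"


section \<open>Strictly monotone solutions of autonomous second-order equations\<close>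

definition strictly_monotone_solution ::
  "real set \<Rightarrow> (real \<Rightarrow> real) \<Rightarrow> (real \<Rightarrow> real) \<Rightarrow> bool" where
  "strictly_monotone_solution J F Q \<longleftrightarrow>
     (strict_mono_on J Q \<or> strict_antimono_on J Q) \<and>
     (\<forall>s\<in>J. (Q has_real_derivative deriv Q s) (at s) \<and>
            (deriv Q has_real_derivative F (Q s)) (at s))"

end

theory Submission
  imports Defs
begin

text \<open>Over a section of the surface frame bundle, a singular system annihilates two explicit vector
  fields $X_1, X_2$. A Frobenius subbundle of it therefore annihilates all their iterated
  brackets. With $k = \sqrt{|K|}$ and $m_i$ the frame derivatives of $\frac12\ln k$, brackets of
  length at most three give $Z_0, Z_1, Z_2$, and rank at least 2 together with transversality forces all longer
  brackets into one further direction. This is a system of polynomial equations in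
  $m_i$ and the second covariant derivatives of $\frac12\ln k$, at each point separately, with the only solution
  $m_{ij} = 3 m_i m_j - K g_{ij}$. In terms of $q = k^{-3/2}$ the Hessian of $q$ is $3 q K$ times the metric.
  Hence the rotated gradient $V$ is Killing, and both $dq/|\nabla q|$ and the form that is 1 on $V$ and
  0 on the gradient are closed; their potentials are the coordinates $s$ and $t$, and the ODE for $q(s)$
  is the Hessian equation in the gradient direction.\<close>

subsection \<open>Smooth maps\<close>

text \<open>In the elliptic case the annihilated fields are complex and are not tangent vectors.
  Brackets are therefore computed on coefficients over a fixed real frame with known structure
  functions: the surface framing together with the invariant frame of the Minkowski frame bundle.
  Over a section the coefficients depend on the surface point only, so they are differentiated only
  along e1 and e2. Transversality makes the \<open>omega_31\<close> and \<open>omega_32\<close>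
  coefficients of two forms of the subbundle an invertible matrix. Normalising it, and using
  \<open>X1\<close>, \<open>X2\<close>, \<open>Z0\<close>, \<open>Z1\<close>, \<open>Z2\<close>,
  leaves only the two coefficients of \<open>omega_12\<close> unknown. Brackets of the Z fields with
  each other contain no derivatives. Those with \<open>X1\<close> and \<open>X2\<close> contain
  third derivatives of ln k, but the same one occurs in two equations and is eliminated. The
  exponent in q = k^(-3/2) is forced: dq = -3 q m, so the Hessian of q is q (9 m_i m_j - 3 m_ij),
  and exactly for this power the quadratic terms cancel.\<close>

abbreviation FD :: "('a::real_normed_vector \<Rightarrow> 'b::real_normed_vector) \<Rightarrow> 'a \<Rightarrow> 'a \<Rightarrow> 'b" where
  "FD f x \<equiv> frechet_derivative f (at x)"

lemma has_frechet_derivative: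
  "f differentiable (at x) \<Longrightarrow> (f has_derivative FD f x) (at x)"
  using frechet_derivative_works by blast

lemma frechet_derivative_eqI:
  "(f has_derivative f') (at x) \<Longrightarrow> FD f x = f'"
  using frechet_derivative_at by metis

lemma Ck_on_SucD:
  assumes "open S" "Ck_on (Suc k) S f" "x \<in> S"
  shows "f differentiable (at x)" "Ck_on k S (\<lambda>x. FD f x v)"
  using assms by (auto simp: differentiable_on_eq_differentiable_at)

lemma Ck_on_cong:
  assumes "open S" "\<And>x. x \<in> S \<Longrightarrow> f x = g x"
  shows "Ck_on k S f = Ck_on k S g"
  using assms
proof (induction k arbitrary: f g)
  case 0
  then show ?case by (simp cong: continuous_on_cong)
next
  case (Suc k)
  have *: "(f differentiable (at x)) = (g differentiable (at x))
      \<and> (f differentiable (at x) \<longrightarrow> FD f x = FD g x)"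
    if x: "x \<in> S" for x
  proof -
    have "(f has_derivative d) (at x) = (g has_derivative d) (at x)" for d
      using Suc.prems x
      by (metis (no_types, lifting) has_derivative_transform_within_open)
    then show ?thesis by (auto simp: differentiable_def frechet_derivative_def)
  qed
  show ?case
  proof (cases "\<forall>x\<in>S. f differentiable (at x)")
    case True
    then have "Ck_on k S (\<lambda>x. FD f x v)
        = Ck_on k S (\<lambda>x. FD g x v)" for v
      using * by (intro Suc.IH Suc.prems) auto
    then show ?thesis using True * Suc.prems
      by (auto simp: differentiable_on_eq_differentiable_at)
  next
    case False
    then show ?thesis using * Suc.prems
      by (auto simp: differentiable_on_eq_differentiable_at)
  qed
qed

text \<open>\<open>Ck_on\<close> recurses through \<open>frechet_derivative\<close>, which is a
  choice operator. Uniqueness of derivatives lets any explicit derivative take its place, so that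
  the closure properties follow by induction from the usual differentiation rules.\<close>

lemma Ck_on_SucI:
  assumes S: "open S" and f: "\<And>x. x \<in> S \<Longrightarrow> (f has_derivative f' x) (at x)"
    and f': "\<And>v. Ck_on k S (\<lambda>x. f' x v)"
  shows "Ck_on (Suc k) S f"
proof -
  have "Ck_on k S (\<lambda>x. FD f x v)" for v
    using f'[of v] frechet_derivative_eqI[OF f]
    by (subst Ck_on_cong[OF S, where g = "\<lambda>x. f' x v"]) auto
  then show ?thesis
    using f S by (auto simp: differentiable_on_eq_differentiable_at differentiable_def)
qed

lemma Ck_on_Suc_has_derivative:
  assumes "open S" "Ck_on (Suc k) S f" "x \<in> S"
  shows "(f has_derivative FD f x) (at x)"
  using Ck_on_SucD(1)[OF assms] by (rule has_frechet_derivative)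

lemma Ck_on_Suc_imp: "Ck_on (Suc k) S f \<Longrightarrow> Ck_on k S f"
proof (induction k arbitrary: f)
  case 0
  then show ?case by (simp add: differentiable_imp_continuous_on)
next
  case (Suc k)
  then show ?case by (metis Ck_on.simps(2))
qed

lemma Ck_on_subset: "Ck_on k S f \<Longrightarrow> T \<subseteq> S \<Longrightarrow> Ck_on k T f"
  by (induction k arbitrary: f) (auto intro: continuous_on_subset differentiable_on_subset)

lemma Ck_on_const: "open S \<Longrightarrow> Ck_on k S (\<lambda>x. c)"
  by (induction k arbitrary: c) auto

lemma Ck_on_bounded_linear:
  assumes S: "open S" and h: "bounded_linear h" and f: "Ck_on k S f"
  shows "Ck_on k S (\<lambda>x. h (f x))"
  using f
proof (induction k arbitrary: f)
  case 0
  then show ?case using bounded_linear.continuous_on[OF h] by auto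
next
  case (Suc k)
  show ?case
    by (rule Ck_on_SucI[OF S bounded_linear.has_derivative[OF h Ck_on_Suc_has_derivative[OF S Suc.prems]]])
      (use Suc in auto)
qed

lemma Ck_on_add:
  assumes S: "open S" and f: "Ck_on k S f" and g: "Ck_on k S g"
  shows "Ck_on k S (\<lambda>x. f x + g x)"
  using f g
proof (induction k arbitrary: f g)
  case 0
  then show ?case by (auto intro: continuous_intros)
next
  case (Suc k)
  show ?case
    by (rule Ck_on_SucI[OF S has_derivative_add[OF Ck_on_Suc_has_derivative[OF S Suc.prems(1)]
        Ck_on_Suc_has_derivative[OF S Suc.prems(2)]]]) (use Suc in auto)
qed

lemma Ck_on_bilinear:
  assumes S: "open S" and h: "bounded_bilinear h" and f: "Ck_on k S f" and g: "Ck_on k S g"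
  shows "Ck_on k S (\<lambda>x. h (f x) (g x))"
  using f g
proof (induction k arbitrary: f g)
  case 0
  then show ?case using bounded_bilinear.continuous_on[OF h] by auto
next
  case (Suc k)
  have "Ck_on k S (\<lambda>x. h (f x) (FD g x v) + h (FD f x v) (g x))"
    for v
    by (intro Ck_on_add[OF S] Suc.IH Ck_on_Suc_imp[OF Suc.prems(1)] Ck_on_Suc_imp[OF Suc.prems(2)])
       (use Suc.prems in auto)
  then show ?case
    by (intro Ck_on_SucI[OF S bounded_bilinear.FDERIV[OF h Ck_on_Suc_has_derivative[OF S Suc.prems(1)]
        Ck_on_Suc_has_derivative[OF S Suc.prems(2)]]])
qed

lemma Ck_on_sum:
  assumes S: "open S" and f: "\<And>i. i \<in> I \<Longrightarrow> Ck_on k S (f i)"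
  shows "Ck_on k S (\<lambda>x. \<Sum>i\<in>I. f i x)"
  using f
  by (induction I rule: infinite_finite_induct) (auto intro: Ck_on_const[OF S] Ck_on_add[OF S])

lemma linear_sum_Basis:
  fixes h :: "'a::euclidean_space \<Rightarrow> 'b::real_vector"
  assumes "linear h"
  shows "h w = (\<Sum>b\<in>Basis. (w \<bullet> b) *\<^sub>R h b)"
proof -
  interpret linear h by fact
  have "h w = h (\<Sum>b\<in>Basis. (w \<bullet> b) *\<^sub>R b)" by (simp add: euclidean_representation)
  then show ?thesis by (simp add: sum scaleR)
qed

text \<open>The chain rule applies Df at g x to a vector that varies with x, while
  \<open>Ck_on\<close> controls Df on fixed vectors only. Expanding the vector in
  \<open>Basis\<close> bridges this, whence the Euclidean domain of \<open>f\<close>.\<close>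

lemma Ck_on_compose:
  fixes f :: "'b::euclidean_space \<Rightarrow> 'c::real_normed_vector"
  assumes S: "open S" and T: "open T" and g: "Ck_on k S g" and f: "Ck_on k T f"
    and gST: "\<And>x. x \<in> S \<Longrightarrow> g x \<in> T"
  shows "Ck_on k S (\<lambda>x. f (g x))"
  using f g
proof (induction k arbitrary: f)
  case 0
  then show ?case using gST by (auto intro!: continuous_on_compose2[of T f S g])
next
  case (Suc k)
  let ?D = "\<lambda>x. FD f (g x)"
  have D: "((\<lambda>x. f (g x)) has_derivative (\<lambda>v. ?D x (FD g x v))) (at x)"
    if "x \<in> S" for x
    using diff_chain_at[OF Ck_on_Suc_has_derivative[OF S Suc.prems(2) that]
      Ck_on_Suc_has_derivative[OF T Suc.prems(1) gST[OF that]]] by (simp add: o_def)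
  have "Ck_on k S (\<lambda>x. \<Sum>b\<in>Basis. (FD g x v \<bullet> b) *\<^sub>R ?D x b)" for v
  proof (intro Ck_on_sum[OF S] Ck_on_bilinear[OF S bounded_bilinear_scaleR])
    fix b :: 'b
    show "Ck_on k S (\<lambda>x. ?D x b)"
      by (intro Suc.IH Ck_on_Suc_imp[OF Suc.prems(2)]) (use Suc.prems(1) in auto)
    show "Ck_on k S (\<lambda>x. FD g x v \<bullet> b)"
      by (intro Ck_on_bounded_linear[OF S, of "\<lambda>u. u \<bullet> b"] bounded_linear_inner_left)
        (use Suc.prems(2) in auto)
  qed
  then have "Ck_on k S (\<lambda>x. ?D x (FD g x v))" for v
    using Ck_on_SucD(1)[OF T Suc.prems(1) gST]
    by (subst Ck_on_cong[OF S, where g = "\<lambda>x. \<Sum>b\<in>Basis. (FD g x v \<bullet> b) *\<^sub>R ?D x b"])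
      (auto intro: linear_sum_Basis linear_frechet_derivative)
  then show ?case using D by (intro Ck_on_SucI[OF S]) auto
qed

lemma Ck_on_inverse:
  fixes f :: "'a::real_normed_vector \<Rightarrow> 'b::real_normed_field"
  assumes S: "open S" and f: "Ck_on k S f" and nz: "\<And>x. x \<in> S \<Longrightarrow> f x \<noteq> 0"
  shows "Ck_on k S (\<lambda>x. inverse (f x))"
  using f
proof (induction k)
  case 0
  then show ?case using nz by (auto intro: continuous_intros)
next
  case (Suc k)
  have "((\<lambda>x. inverse (f x)) has_derivative
      (\<lambda>v. - (inverse (f x) * FD f x v * inverse (f x)))) (at x)" if "x \<in> S" for x
    using Deriv.has_derivative_inverse[OF nz[OF that] Ck_on_Suc_has_derivative[OF S Suc.prems that]] .
  moreover have "Ck_on k S (\<lambda>x. - (inverse (f x) * FD f x v * inverse (f x)))" for v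
    using Suc.IH[OF Ck_on_Suc_imp[OF Suc.prems]] Suc.prems
    by (intro Ck_on_bounded_linear[OF S, of uminus] Ck_on_bilinear[OF S bounded_bilinear_mult])
      (auto intro: bounded_linear_minus bounded_linear_ident)
  ultimately show ?case by (rule Ck_on_SucI[OF S])
qed

lemma Ck_on_powr:
  fixes f :: "'a::real_normed_vector \<Rightarrow> real"
  assumes S: "open S" and f: "Ck_on k S f" and pos: "\<And>x. x \<in> S \<Longrightarrow> f x > 0"
  shows "Ck_on k S (\<lambda>x. f x powr a)"
  using f
proof (induction k arbitrary: a)
  case 0
  then show ?case by (auto intro!: continuous_intros dest: pos)
next
  case (Suc k)
  have "((\<lambda>x. f x powr a) has_derivative
      (\<lambda>v. (a * f x powr (a - 1)) * FD f x v)) (at x)" if "x \<in> S" for x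
    using has_derivative_powr[OF Ck_on_Suc_has_derivative[OF S Suc.prems that]
      has_derivative_const[of a] pos[OF that]] pos[OF that]
    by (auto simp: powr_diff field_simps elim!: has_derivative_eq_rhs)
  moreover have "Ck_on k S (\<lambda>x. (a * f x powr (a - 1)) * FD f x v)" for v
    using Suc.IH[OF Ck_on_Suc_imp[OF Suc.prems]] Suc.prems
    by (intro Ck_on_bilinear[OF S bounded_bilinear_mult] Ck_on_const[OF S]) auto
  ultimately show ?case by (rule Ck_on_SucI[OF S])
qed

lemma Ck_on_ln:
  fixes f :: "'a::real_normed_vector \<Rightarrow> real"
  assumes S: "open S" and f: "Ck_on k S f" and pos: "\<And>x. x \<in> S \<Longrightarrow> f x > 0"
  shows "Ck_on k S (\<lambda>x. ln (f x))"
proof (cases k)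
  case 0
  then show ?thesis using f by (auto intro!: continuous_intros dest: pos)
next
  case (Suc n)
  note f' = f[unfolded Suc]
  have "((\<lambda>x. ln (f x)) has_derivative
      (\<lambda>v. inverse (f x) * FD f x v)) (at x)" if "x \<in> S" for x
    using has_derivative_ln[OF pos[OF that] Ck_on_Suc_has_derivative[OF S f' that]]
    by (auto simp: mult.commute elim!: has_derivative_eq_rhs)
  moreover have "Ck_on n S (\<lambda>x. inverse (f x) * FD f x v)" for v
    using f' by (intro Ck_on_bilinear[OF S bounded_bilinear_mult] Ck_on_inverse[OF S]
      Ck_on_Suc_imp[OF f']) (auto dest: pos)
  ultimately show ?thesis unfolding Suc by (rule Ck_on_SucI[OF S])
qed

section \<open>Closure properties of smooth maps\<close>

lemma smooth_on_cong:
  "open S \<Longrightarrow> (\<And>x. x \<in> S \<Longrightarrow> f x = g x) \<Longrightarrow> smooth_on S f = smooth_on S g"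
  unfolding smooth_on_def by (metis Ck_on_cong)

lemma smooth_on_subset: "smooth_on S f \<Longrightarrow> T \<subseteq> S \<Longrightarrow> smooth_on T f"
  unfolding smooth_on_def by (metis Ck_on_subset)

lemma smooth_on_continuous_on: "smooth_on S f \<Longrightarrow> continuous_on S f"
  unfolding smooth_on_def by (metis Ck_on.simps(1))

lemma smooth_on_differentiable:
  assumes "smooth_on S f" "open S" "x \<in> S"
  shows "f differentiable (at x)"
  using assms Ck_on_SucD(1) unfolding smooth_on_def by metis

lemma smooth_on_has_derivative:
  assumes "smooth_on S f" "open S" "x \<in> S"
  shows "(f has_derivative FD f x) (at x)"
  using smooth_on_differentiable[OF assms] by (rule has_frechet_derivative)

lemma smooth_on_frechet_derivative:
  "smooth_on S f \<Longrightarrow> smooth_on S (\<lambda>x. FD f x v)"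
  unfolding smooth_on_def by (metis Ck_on.simps(2))

lemma smooth_on_const: "open S \<Longrightarrow> smooth_on S (\<lambda>x. c)"
  unfolding smooth_on_def by (metis Ck_on_const)

lemma smooth_on_ident: "open S \<Longrightarrow> smooth_on S (\<lambda>x. x)"
  unfolding smooth_on_def
proof
  fix k assume S: "open S" show "Ck_on k S (\<lambda>x. x)"
    by (cases k) (auto intro!: Ck_on_SucI[OF S has_derivative_ident] Ck_on_const[OF S]
      simp del: Ck_on.simps(2))
qed

lemma smooth_on_bounded_linear:
  "smooth_on S f \<Longrightarrow> open S \<Longrightarrow> bounded_linear h \<Longrightarrow> smooth_on S (\<lambda>x. h (f x))"
  unfolding smooth_on_def by (metis Ck_on_bounded_linear)

lemma smooth_on_bilinear:
  "bounded_bilinear h \<Longrightarrow> open S \<Longrightarrow> smooth_on S f \<Longrightarrow> smooth_on S g \<Longrightarrow> smooth_on S (\<lambda>x. h (f x) (g x))"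
  unfolding smooth_on_def by (metis Ck_on_bilinear)

lemma smooth_on_add:
  "open S \<Longrightarrow> smooth_on S f \<Longrightarrow> smooth_on S g \<Longrightarrow> smooth_on S (\<lambda>x. f x + g x)"
  unfolding smooth_on_def by (metis Ck_on_add)

lemma smooth_on_minus:
  "open S \<Longrightarrow> smooth_on S f \<Longrightarrow> smooth_on S (\<lambda>x. - f x)"
  by (rule smooth_on_bounded_linear[of S f uminus]) (auto intro: bounded_linear_minus bounded_linear_ident)

lemma smooth_on_diff:
  "open S \<Longrightarrow> smooth_on S f \<Longrightarrow> smooth_on S g \<Longrightarrow> smooth_on S (\<lambda>x. f x - g x)"
  using smooth_on_add[of S f "\<lambda>x. - g x"] smooth_on_minus[of S g] by simp

lemma smooth_on_mult:
  fixes f :: "'a::real_normed_vector \<Rightarrow> 'b::real_normed_algebra"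
  shows "open S \<Longrightarrow> smooth_on S f \<Longrightarrow> smooth_on S g \<Longrightarrow> smooth_on S (\<lambda>x. f x * g x)"
  by (rule smooth_on_bilinear[OF bounded_bilinear_mult])

lemma smooth_on_scaleR:
  "open S \<Longrightarrow> smooth_on S f \<Longrightarrow> smooth_on S g \<Longrightarrow> smooth_on S (\<lambda>x. f x *\<^sub>R g x)"
  by (rule smooth_on_bilinear[OF bounded_bilinear_scaleR])

lemma smooth_on_sum:
  "open S \<Longrightarrow> (\<And>i. i \<in> I \<Longrightarrow> smooth_on S (f i)) \<Longrightarrow> smooth_on S (\<lambda>x. \<Sum>i\<in>I. f i x)"
  unfolding smooth_on_def by (auto intro: Ck_on_sum)

lemma smooth_on_inverse:
  fixes f :: "'a::real_normed_vector \<Rightarrow> 'b::real_normed_field"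
  shows "open S \<Longrightarrow> smooth_on S f \<Longrightarrow> (\<And>x. x \<in> S \<Longrightarrow> f x \<noteq> 0) \<Longrightarrow> smooth_on S (\<lambda>x. inverse (f x))"
  unfolding smooth_on_def by (auto intro: Ck_on_inverse)

lemma smooth_on_divide:
  fixes f :: "'a::real_normed_vector \<Rightarrow> 'b::real_normed_field"
  shows "open S \<Longrightarrow> smooth_on S f \<Longrightarrow> smooth_on S g \<Longrightarrow> (\<And>x. x \<in> S \<Longrightarrow> g x \<noteq> 0) \<Longrightarrow>
    smooth_on S (\<lambda>x. f x / g x)"
  using smooth_on_mult[of S f "\<lambda>x. inverse (g x)"] smooth_on_inverse[of S g]
  by (simp add: divide_inverse)

lemma smooth_on_powr:
  fixes f :: "'a::real_normed_vector \<Rightarrow> real"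
  shows "open S \<Longrightarrow> smooth_on S f \<Longrightarrow> (\<And>x. x \<in> S \<Longrightarrow> f x > 0) \<Longrightarrow> smooth_on S (\<lambda>x. f x powr a)"
  unfolding smooth_on_def by (auto intro: Ck_on_powr)

lemma smooth_on_ln:
  fixes f :: "'a::real_normed_vector \<Rightarrow> real"
  shows "open S \<Longrightarrow> smooth_on S f \<Longrightarrow> (\<And>x. x \<in> S \<Longrightarrow> f x > 0) \<Longrightarrow> smooth_on S (\<lambda>x. ln (f x))"
  unfolding smooth_on_def by (auto intro: Ck_on_ln)

lemma smooth_on_compose:
  fixes f :: "'b::euclidean_space \<Rightarrow> 'c::real_normed_vector"
  assumes "open S" "open T" "smooth_on S g" "smooth_on T f" "\<And>x. x \<in> S \<Longrightarrow> g x \<in> T"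
  shows "smooth_on S (\<lambda>x. f (g x))"
  using assms unfolding smooth_on_def by (auto intro: Ck_on_compose[OF assms(1,2)])

lemma smooth_on_Pair:
  assumes S: "open S" and "smooth_on S f" "smooth_on S g"
  shows "smooth_on S (\<lambda>x. (f x, g x))"
proof -
  have "smooth_on S (\<lambda>x. (f x, 0) + (0, g x))"
    using assms
    by (intro smooth_on_add smooth_on_bounded_linear[of S f "\<lambda>u. (u, 0)"]
        smooth_on_bounded_linear[of S g "\<lambda>u. (0, u)"])
      (auto intro!: bounded_linear_Pair bounded_linear_ident bounded_linear_zero)
  then show ?thesis by simp
qed

text \<open>Smoothness of a form is a condition on constant vectors; this is the passage to its
  values on vector fields.\<close>

lemma smooth_on_linear_apply:
  fixes h :: "'a::real_normed_vector \<Rightarrow> 'b::euclidean_space \<Rightarrow> 'c::real_normed_vector"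
  assumes S: "open S" and h: "\<And>x. x \<in> S \<Longrightarrow> linear (h x)" and hs: "\<And>v. smooth_on S (\<lambda>x. h x v)"
    and w: "smooth_on S w"
  shows "smooth_on S (\<lambda>x. h x (w x))"
proof -
  have "smooth_on S (\<lambda>x. \<Sum>b\<in>Basis. (w x \<bullet> b) *\<^sub>R h x b)"
    using hs w S by (intro smooth_on_sum smooth_on_scaleR smooth_on_bounded_linear[of S w "\<lambda>u. u \<bullet> b" for b]
      bounded_linear_inner_left)
  then show ?thesis
    by (subst smooth_on_cong[OF S, of _ "\<lambda>x. \<Sum>b\<in>Basis. (w x \<bullet> b) *\<^sub>R h x b"])
      (auto intro: linear_sum_Basis h)
qed

subsection \<open>Exterior derivatives along maps\<close>

lemma mvt_at_zero:
  fixes f :: "real \<Rightarrow> real"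
  assumes "0 < t" "\<And>s. 0 \<le> s \<Longrightarrow> s \<le> t \<Longrightarrow> (f has_derivative f' s) (at s)"
  obtains s where "0 < s" "s < t" "f t - f 0 = f' s t"
proof -
  have "\<exists>s\<in>{0<..<t}. f t - f 0 = f' s (t - 0)"
  proof (rule mvt_simple[OF assms(1)])
    show "(f has_derivative f' s) (at s within {0..t})" if "0 \<le> s" "s \<le> t" for s
      using assms(2)[OF that] by (rule has_derivative_at_withinI)
  qed
  then show ?thesis using that by auto
qed

text \<open>The second difference of f over the parallelogram with sides t u and t v is symmetric in
  u and v. Two mean value theorems write it as t^2 times a second derivative at a nearby point, in
  either order, and continuity as t shrinks identifies the two.\<close>

lemma second_derivative_symmetric_real:
  fixes f :: "'a::real_normed_vector \<Rightarrow> real"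
  assumes S: "open S" and f: "Ck_on 2 S f" and x: "x \<in> S"
  shows "FD (\<lambda>y. FD f y v) x u
       = FD (\<lambda>y. FD f y u) x v"
proof -
  define D where "D w y = FD f y w" for w y
  define H where "H w z y = FD (D w) y z" for w z y
  have f2: "Ck_on (Suc (Suc 0)) S f" using f by (simp add: numeral_2_eq_2 del: Ck_on.simps)
  have Df: "(f has_derivative (\<lambda>w. D w y)) (at y)" if "y \<in> S" for y
    using Ck_on_Suc_has_derivative[OF S f2 that] by (simp add: D_def)
  have DD: "(D w has_derivative (\<lambda>z. H w z y)) (at y)" if "y \<in> S" for y w
    using Ck_on_Suc_has_derivative[OF S Ck_on_SucD(2)[OF S f2 that, of w] that]
    by (simp add: D_def[abs_def] H_def[abs_def])
  have Hc: "isCont (H w z) y" if "y \<in> S" for y w z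
  proof -
    have "continuous_on S (H w z)"
      using Ck_on_SucD(2)[OF S Ck_on_SucD(2)[OF S f2 that, of w] that, of z]
      by (simp add: D_def[abs_def] H_def[abs_def])
    then show ?thesis using S that continuous_on_eq_continuous_at by blast
  qed
  obtain r where r: "r > 0" "ball x r \<subseteq> S" by (rule openE[OF S x])
  have key: "\<exists>p. dist p x \<le> t * (norm u + norm v) \<and>
      f (x + t *\<^sub>R u + t *\<^sub>R v) - f (x + t *\<^sub>R u) - f (x + t *\<^sub>R v) + f x = t * t * H u v p"
    if t: "t > 0" "t * (norm u + norm v) < r" for t u v
  proof -
    have inS: "x + s *\<^sub>R u + s' *\<^sub>R v \<in> S \<and> dist (x + s *\<^sub>R u + s' *\<^sub>R v) x \<le> t * (norm u + norm v)"
      if "0 \<le> s" "s \<le> t" "0 \<le> s'" "s' \<le> t" for s s'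
    proof -
      have "norm (s *\<^sub>R u + s' *\<^sub>R v) \<le> s * norm u + s' * norm v"
        using that norm_triangle_ineq[of "s *\<^sub>R u" "s' *\<^sub>R v"] by simp
      also have "\<dots> \<le> t * (norm u + norm v)"
        using that by (simp add: distrib_left add_mono mult_right_mono)
      finally show ?thesis using t r by (auto simp: dist_norm norm_minus_commute subset_iff add.assoc)
    qed
    define \<phi> where "\<phi> s = f (x + s *\<^sub>R u + t *\<^sub>R v) - f (x + s *\<^sub>R u)" for s
    have d\<phi>: "(\<phi> has_derivative (\<lambda>h. h * (D u (x + s *\<^sub>R u + t *\<^sub>R v) - D u (x + s *\<^sub>R u)))) (at s)"
      if "0 \<le> s" "s \<le> t" for s
    proof -
      have lin: "D (h *\<^sub>R u) y = h * D u y" if "y \<in> S" for h y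
        using linear_cmul[OF bounded_linear.linear[OF has_derivative_bounded_linear[OF Df[OF that]]]]
        by simp
      have i1: "x + s *\<^sub>R u + t *\<^sub>R v \<in> S" and i2: "x + s *\<^sub>R u \<in> S"
        using inS[of s t] inS[of s 0] that t by auto
      have g1: "((\<lambda>s. x + s *\<^sub>R u + t *\<^sub>R v) has_derivative (\<lambda>h. h *\<^sub>R u)) (at s)"
        and g2: "((\<lambda>s. x + s *\<^sub>R u) has_derivative (\<lambda>h. h *\<^sub>R u)) (at s)"
        by (auto intro!: derivative_eq_intros)
      have "(\<phi> has_derivative (\<lambda>h. D (h *\<^sub>R u) (x + s *\<^sub>R u + t *\<^sub>R v) - D (h *\<^sub>R u) (x + s *\<^sub>R u))) (at s)"
        using has_derivative_diff[OF diff_chain_at[OF g1 Df[OF i1]] diff_chain_at[OF g2 Df[OF i2]]]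
        by (simp add: \<phi>_def[abs_def] o_def)
      then show ?thesis by (simp only: lin[OF i1] lin[OF i2] right_diff_distrib)
    qed
    obtain s where s: "0 < s" "s < t"
      and s1: "\<phi> t - \<phi> 0 = t * (D u (x + s *\<^sub>R u + t *\<^sub>R v) - D u (x + s *\<^sub>R u))"
      using mvt_at_zero[OF t(1) d\<phi>] .
    have d2: "((\<lambda>s'. D u (x + s *\<^sub>R u + s' *\<^sub>R v)) has_derivative (\<lambda>h. h * H u v (x + s *\<^sub>R u + s' *\<^sub>R v))) (at s')"
      if "0 \<le> s'" "s' \<le> t" for s'
    proof -
      have i1: "x + s *\<^sub>R u + s' *\<^sub>R v \<in> S" using inS[of s s'] that s by auto
      have g1: "((\<lambda>s'. x + s *\<^sub>R u + s' *\<^sub>R v) has_derivative (\<lambda>h. h *\<^sub>R v)) (at s')"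
        by (auto intro!: derivative_eq_intros)
      have "H u (h *\<^sub>R v) y = h * H u v y" if "y \<in> S" for h y
        using linear_cmul[OF bounded_linear.linear[OF has_derivative_bounded_linear[OF DD[OF that]]]]
        by simp
      then show ?thesis using diff_chain_at[OF g1 DD[OF i1, of u]] i1 by (simp add: o_def)
    qed
    obtain s' where s': "0 < s'" "s' < t"
      and s2: "D u (x + s *\<^sub>R u + t *\<^sub>R v) - D u (x + s *\<^sub>R u) = t * H u v (x + s *\<^sub>R u + s' *\<^sub>R v)"
      by (rule mvt_at_zero[OF t(1) d2]) auto
    have "f (x + t *\<^sub>R u + t *\<^sub>R v) - f (x + t *\<^sub>R u) - f (x + t *\<^sub>R v) + f x
        = t * t * H u v (x + s *\<^sub>R u + s' *\<^sub>R v)"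
      using s1 s2 by (simp add: \<phi>_def)
    then show ?thesis using inS[of s s'] s s' by (intro exI[of _ "x + s *\<^sub>R u + s' *\<^sub>R v"]) auto
  qed
  have "H v u x = H u v x"
  proof (rule ccontr)
    assume ne: "H v u x \<noteq> H u v x"
    define e where "e = \<bar>H v u x - H u v x\<bar> / 2"
    have e: "e > 0" using ne by (simp add: e_def)
    obtain d1 where d1: "d1 > 0" "\<And>p. dist p x < d1 \<Longrightarrow> dist (H u v p) (H u v x) < e"
      using Hc[OF x, of u v] e unfolding continuous_at_eps_delta by blast
    obtain d2 where d2: "d2 > 0" "\<And>p. dist p x < d2 \<Longrightarrow> dist (H v u p) (H v u x) < e"
      using Hc[OF x, of v u] e unfolding continuous_at_eps_delta by blast
    define d where "d = min r (min d1 d2)"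
    \<comment> \<open>Small enough that the parallelogram stays within distance d of x; the added 1
      covers u = v = 0.\<close>
    define t where "t = d / (2 * (norm u + norm v + 1))"
    have d: "d > 0" using r d1 d2 by (simp add: d_def)
    have nn: "0 \<le> norm u + norm v" by simp
    then have pos: "norm u + norm v + 1 > 0" by linarith
    have t: "t > 0" using d pos by (simp add: t_def)
    have "t * (norm u + norm v) < t * (2 * (norm u + norm v + 1))"
      using t nn by (simp add: add_nonneg_pos distrib_left)
    also have "\<dots> = d" using pos by (simp add: t_def)
    finally have td: "t * (norm u + norm v) < d" .
    have tr: "t * (norm u + norm v) < r" "t * (norm v + norm u) < r"
      using td by (simp_all add: d_def add.commute)
    obtain p where p: "dist p x \<le> t * (norm u + norm v)"
      "f (x + t *\<^sub>R u + t *\<^sub>R v) - f (x + t *\<^sub>R u) - f (x + t *\<^sub>R v) + f x = t * t * H u v p"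
      using key[OF t tr(1)] by blast
    obtain p' where p': "dist p' x \<le> t * (norm v + norm u)"
      "f (x + t *\<^sub>R v + t *\<^sub>R u) - f (x + t *\<^sub>R v) - f (x + t *\<^sub>R u) + f x = t * t * H v u p'"
      using key[OF t tr(2)] by blast
    have dd: "dist p x < d" "dist p' x < d"
      using p(1) p'(1) td by (simp_all add: add.commute)
    have sw: "x + t *\<^sub>R v + t *\<^sub>R u = x + t *\<^sub>R u + t *\<^sub>R v" by simp
    have "t * t * H u v p = t * t * H v u p'"
      using p(2) p'(2) unfolding sw by linarith
    then have "H u v p = H v u p'" using t by simp
    moreover have "dist (H u v p) (H u v x) < e" "dist (H v u p') (H v u x) < e"
      using dd d1(2) d2(2) by (simp_all add: d_def)
    ultimately show False unfolding e_def dist_real_def by (simp add: abs_if split: if_splits)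
  qed
  then show ?thesis by (simp add: H_def D_def[abs_def])
qed

lemma second_derivative_symmetric:
  fixes f :: "'a::real_normed_vector \<Rightarrow> 'b::euclidean_space"
  assumes S: "open S" and f: "smooth_on S f" and x: "x \<in> S"
  shows "FD (\<lambda>y. FD f y v) x u
       = FD (\<lambda>y. FD f y u) x v"
proof (rule euclidean_eqI)
  fix b :: 'b assume "b \<in> Basis"
  define fb where "fb y = f y \<bullet> b" for y
  have fbs: "Ck_on 2 S fb"
    using smooth_on_bounded_linear[OF f S bounded_linear_inner_left, of b]
    unfolding smooth_on_def fb_def[abs_def] by (rule spec)
  have 1: "FD fb y w = FD f y w \<bullet> b" if "y \<in> S" for y w
    unfolding fb_def[abs_def]
    by (rule fun_cong[OF frechet_derivative_eqI[OF bounded_linear.has_derivative[OF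
      bounded_linear_inner_left smooth_on_has_derivative[OF f S that]]]])
  have 2: "FD (\<lambda>y. FD fb y w) x z
     = FD (\<lambda>y. FD f y w) x z \<bullet> b" for w z
  proof -
    have "((\<lambda>y. FD f y w \<bullet> b) has_derivative
        (\<lambda>z. FD (\<lambda>y. FD f y w) x z \<bullet> b)) (at x)"
      by (rule bounded_linear.has_derivative[OF bounded_linear_inner_left
          smooth_on_has_derivative[OF smooth_on_frechet_derivative[OF f] S x]])
    then have "((\<lambda>y. FD fb y w) has_derivative
        (\<lambda>z. FD (\<lambda>y. FD f y w) x z \<bullet> b)) (at x)"
      by (rule has_derivative_transform_within_open[OF _ S x]) (simp add: 1)
    from frechet_derivative_eqI[OF this] show ?thesis by (rule fun_cong)
  qed
  show "FD (\<lambda>y. FD f y v) x u \<bullet> b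
       = FD (\<lambda>y. FD f y u) x v \<bullet> b"
    using second_derivative_symmetric_real[OF S fbs x, of v u] unfolding 2 .
qed

lemma has_derivative_linear_apply:
  fixes \<alpha> :: "'e::real_normed_vector \<Rightarrow> 'v::euclidean_space \<Rightarrow> 'k::real_normed_vector"
  assumes B: "open B" "x \<in> B" and lin: "\<And>y. y \<in> B \<Longrightarrow> linear (\<alpha> y)"
    and \<alpha>: "\<And>v. (\<lambda>y. \<alpha> y v) differentiable (at x)" and w: "(w has_derivative dw) (at x)"
  shows "((\<lambda>y. \<alpha> y (w y)) has_derivative
    (\<lambda>u. FD (\<lambda>y. \<alpha> y (w x)) x u + \<alpha> x (dw u))) (at x)"
proof -
  let ?D = "\<lambda>v u. FD (\<lambda>y. \<alpha> y v) x u"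
  have D: "((\<lambda>y. \<alpha> y v) has_derivative ?D v) (at x)" for v
    using has_frechet_derivative[OF \<alpha>] .
  have gen: "((\<lambda>y. \<alpha> y (w y)) has_derivative
     (\<lambda>u. (\<Sum>b\<in>Basis. (w x \<bullet> b) *\<^sub>R ?D b u + (dw u \<bullet> b) *\<^sub>R \<alpha> x b))) (at x)"
    if w: "(w has_derivative dw) (at x)" for w dw
  proof (rule has_derivative_transform_within_open[OF _ B])
    show "((\<lambda>y. \<Sum>b\<in>Basis. (w y \<bullet> b) *\<^sub>R \<alpha> y b) has_derivative
      (\<lambda>u. (\<Sum>b\<in>Basis. (w x \<bullet> b) *\<^sub>R ?D b u + (dw u \<bullet> b) *\<^sub>R \<alpha> x b))) (at x)"
      by (intro has_derivative_sum has_derivative_scaleR D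
          bounded_linear.has_derivative[OF bounded_linear_inner_left w])
  qed (use linear_sum_Basis[OF lin] in auto)
  have "?D (w x) = (\<lambda>u. (\<Sum>b\<in>Basis. (w x \<bullet> b) *\<^sub>R ?D b u + (0 \<bullet> b) *\<^sub>R \<alpha> x b))"
    using frechet_derivative_eqI[OF gen[OF has_derivative_const[of "w x"]]] by simp
  then have "(\<lambda>u. (\<Sum>b\<in>Basis. (w x \<bullet> b) *\<^sub>R ?D b u + (dw u \<bullet> b) *\<^sub>R \<alpha> x b))
    = (\<lambda>u. ?D (w x) u + \<alpha> x (dw u))"
    using linear_sum_Basis[OF lin[OF B(2)], symmetric] by (simp add: sum.distrib fun_eq_iff)
  then show ?thesis using gen[OF w] by simp
qed

lemma has_derivative_form_along:
  fixes \<alpha> :: "'e::real_normed_vector \<Rightarrow> 'v::euclidean_space \<Rightarrow> 'k::real_normed_vector"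
  assumes B: "open B" "\<sigma> x \<in> B" and lin: "\<And>y. y \<in> B \<Longrightarrow> linear (\<alpha> y)"
    and \<alpha>: "\<And>v. (\<lambda>y. \<alpha> y v) differentiable (at (\<sigma> x))"
    and D: "open D" "x \<in> D" and \<sigma>: "continuous_on D \<sigma>" "(\<sigma> has_derivative d\<sigma>) (at x)"
    and w: "(w has_derivative dw) (at x)"
  shows "((\<lambda>y. \<alpha> (\<sigma> y) (w y)) has_derivative
    (\<lambda>u. FD (\<lambda>y. \<alpha> y (w x)) (\<sigma> x) (d\<sigma> u) + \<alpha> (\<sigma> x) (dw u))) (at x)"
proof -
  have *: "((\<lambda>y. \<alpha> (\<sigma> y) v) has_derivative
      (\<lambda>u. FD (\<lambda>y. \<alpha> y v) (\<sigma> x) (d\<sigma> u))) (at x)" for v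
    using diff_chain_at[OF \<sigma>(2) has_frechet_derivative[OF \<alpha>]] by (simp add: o_def)
  have "((\<lambda>y. \<alpha> (\<sigma> y) (w y)) has_derivative
    (\<lambda>u. FD (\<lambda>y. \<alpha> (\<sigma> y) (w x)) x u + \<alpha> (\<sigma> x) (dw u))) (at x)"
  proof (rule has_derivative_linear_apply[OF _ _ _ _ w])
    show "open (D \<inter> \<sigma> -` B)" by (rule continuous_open_preimage[OF \<sigma>(1) D(1) B(1)])
    show "x \<in> D \<inter> \<sigma> -` B" using D B by simp
    show "linear (\<alpha> (\<sigma> y))" if "y \<in> D \<inter> \<sigma> -` B" for y using lin that by simp
    show "(\<lambda>y. \<alpha> (\<sigma> y) v) differentiable (at x)" for v
      using * unfolding differentiable_def by blast
  qed
  then show ?thesis by (simp only: frechet_derivative_eqI[OF *])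
qed

text \<open>Cartan's formula for the pullback of the form by the map, where
  \<open>db (a x) - da (b x)\<close> is the bracket of the fields \<open>a\<close> and
  \<open>b\<close>. The second derivatives of the map cancel by symmetry.\<close>

lemma ext_deriv_along_map:
  fixes \<alpha> :: "'e::euclidean_space \<Rightarrow> 'e \<Rightarrow> 'k::real_normed_field"
    and \<sigma> :: "'d::euclidean_space \<Rightarrow> 'e"
  assumes B: "open B" "\<sigma> x \<in> B" and lin: "\<And>y. y \<in> B \<Longrightarrow> linear (\<alpha> y)"
    and \<alpha>: "\<And>v. (\<lambda>y. \<alpha> y v) differentiable (at (\<sigma> x))"
    and D: "open D" "x \<in> D" and \<sigma>: "smooth_on D \<sigma>"
    and a: "(a has_derivative da) (at x)" and b: "(b has_derivative db) (at x)"
  shows "(\<lambda>y. \<alpha> (\<sigma> y) (FD \<sigma> y (b y))) differentiable (at x)"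
    and "FD (\<lambda>y. \<alpha> (\<sigma> y) (FD \<sigma> y (b y))) x (a x)
     - FD (\<lambda>y. \<alpha> (\<sigma> y) (FD \<sigma> y (a y))) x (b x)
     = ext_deriv \<alpha> (\<sigma> x) (FD \<sigma> x (a x)) (FD \<sigma> x (b x))
       + \<alpha> (\<sigma> x) (FD \<sigma> x (db (a x) - da (b x)))"
proof -
  let ?s = "FD \<sigma> x"
  have "((\<lambda>y. FD \<sigma> y (c y)) has_derivative
    (\<lambda>u. FD (\<lambda>y. FD \<sigma> y (c x)) x u + ?s (dc u))) (at x)"
    if "(c has_derivative dc) (at x)" for c dc
  proof (rule has_derivative_linear_apply[OF D _ _ that])
    show "linear (FD \<sigma> y)" if "y \<in> D" for y
      by (rule linear_frechet_derivative[OF smooth_on_differentiable[OF \<sigma> D(1) that]])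
    show "(\<lambda>y. FD \<sigma> y v) differentiable (at x)" for v
      by (rule smooth_on_differentiable[OF smooth_on_frechet_derivative[OF \<sigma>] D])
  qed
  note dw = this
  have main: "((\<lambda>y. \<alpha> (\<sigma> y) (FD \<sigma> y (c y))) has_derivative
    (\<lambda>u. FD (\<lambda>y. \<alpha> y (?s (c x))) (\<sigma> x) (?s u)
       + \<alpha> (\<sigma> x) (FD (\<lambda>y. FD \<sigma> y (c x)) x u + ?s (dc u)))) (at x)"
    if "(c has_derivative dc) (at x)" for c dc
    using has_derivative_form_along[OF B lin \<alpha> D smooth_on_continuous_on[OF \<sigma>]
        smooth_on_has_derivative[OF \<sigma> D] dw[OF that]] .
  show "(\<lambda>y. \<alpha> (\<sigma> y) (FD \<sigma> y (b y))) differentiable (at x)"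
    using main[OF b] unfolding differentiable_def by blast
  have sl: "linear ?s" using linear_frechet_derivative[OF smooth_on_differentiable[OF \<sigma> D]] .
  show "FD (\<lambda>y. \<alpha> (\<sigma> y) (FD \<sigma> y (b y))) x (a x)
     - FD (\<lambda>y. \<alpha> (\<sigma> y) (FD \<sigma> y (a y))) x (b x)
     = ext_deriv \<alpha> (\<sigma> x) (?s (a x)) (?s (b x)) + \<alpha> (\<sigma> x) (?s (db (a x) - da (b x)))"
    unfolding frechet_derivative_eqI[OF main[OF a]] frechet_derivative_eqI[OF main[OF b]] ext_deriv_def
    unfolding linear_add[OF lin[OF B(2)]] linear_diff[OF lin[OF B(2)]] linear_diff[OF sl]
      second_derivative_symmetric[OF D(1) \<sigma> D(2), of "a x" "b x"]
    by (simp only: algebra_simps)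
qed

subsection \<open>Brackets of vector fields annihilated by a Frobenius system\<close>

lemma curve_eventually_in:
  fixes \<gamma> :: "real \<Rightarrow> 'z::real_normed_vector"
  assumes "(\<gamma> has_vector_derivative v) (at 0)" "open U" "\<gamma> 0 \<in> U"
  shows "\<forall>\<^sub>F t in nhds 0. \<gamma> t \<in> U"
proof -
  have "(\<gamma> \<longlongrightarrow> \<gamma> 0) (nhds 0)"
    using has_vector_derivative_continuous[OF assms(1)]
    by (simp add: isCont_def tendsto_at_iff_tendsto_nhds)
  then show ?thesis using assms(2,3) by (rule topological_tendstoD)
qed

lemma tangent_vectors_image:
  assumes v: "v \<in> tangent_vectors M z" and \<sigma>: "(\<sigma> has_derivative d\<sigma>) (at z)"
    and U: "open U" "z \<in> U" and MN: "\<And>y. y \<in> M \<Longrightarrow> y \<in> U \<Longrightarrow> \<sigma> y \<in> N"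
  shows "d\<sigma> v \<in> tangent_vectors N (\<sigma> z)"
proof -
  obtain \<gamma> where \<gamma>: "\<gamma> 0 = z" "\<forall>\<^sub>F t in nhds (0::real). \<gamma> t \<in> M" "(\<gamma> has_vector_derivative v) (at 0)"
    using v by (auto simp: tangent_vectors_def)
  have U0: "\<gamma> 0 \<in> U" using \<gamma>(1) U(2) by simp
  have "\<forall>\<^sub>F t in nhds 0. \<sigma> (\<gamma> t) \<in> N"
    using \<gamma>(2) curve_eventually_in[OF \<gamma>(3) U(1) U0] by eventually_elim (rule MN)
  moreover have "((\<lambda>t. \<sigma> (\<gamma> t)) has_vector_derivative d\<sigma> v) (at 0)"
  proof -
    have "((\<lambda>t. \<sigma> (\<gamma> t)) has_derivative (\<lambda>h. d\<sigma> (h *\<^sub>R v))) (at 0)"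
      using diff_chain_at[OF \<gamma>(3)[unfolded has_vector_derivative_def], of \<sigma> d\<sigma>] \<sigma> \<gamma>(1)
      by (simp add: o_def)
    then show ?thesis
      using linear_cmul[OF has_derivative_linear[OF \<sigma>]] by (simp add: has_vector_derivative_def)
  qed
  ultimately show ?thesis using \<gamma>(1) unfolding tangent_vectors_def
    by (intro CollectI exI[of _ "\<lambda>t. \<sigma> (\<gamma> t)"]) simp
qed

text \<open>Along a curve in \<open>M\<close> the composite is constantly 0. Identities that hold
  only on the embedded bundle, such as annihilation by forms, can thus be differentiated in tangent
  directions.\<close>

lemma derivative_tangent_eq_0:
  fixes f :: "'z::real_normed_vector \<Rightarrow> 'b::real_normed_vector"
  assumes v: "v \<in> tangent_vectors M z" and f: "(f has_derivative df) (at z)"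
    and U: "open U" "z \<in> U" and 0: "\<And>y. y \<in> M \<Longrightarrow> y \<in> U \<Longrightarrow> f y = 0"
  shows "df v = 0"
proof -
  have "df v \<in> tangent_vectors {0} (f z)"
    by (rule tangent_vectors_image[OF v f U]) (simp add: 0)
  then obtain \<gamma> where \<gamma>: "\<forall>\<^sub>F t in nhds (0::real). \<gamma> t = (0::'b)" "(\<gamma> has_vector_derivative df v) (at 0)"
    by (auto simp: tangent_vectors_def)
  obtain W where W: "open W" "0 \<in> W" "\<And>t. t \<in> W \<Longrightarrow> \<gamma> t = 0"
    using \<gamma>(1) unfolding eventually_nhds by blast
  have "((\<lambda>t. 0) has_vector_derivative df v) (at 0)"
    by (rule has_vector_derivative_transform_within_open[OF \<gamma>(2) W(1,2)]) (rule W(3))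
  then show ?thesis
    using vector_derivative_at has_vector_derivative_const vector_derivative_unique_at by blast
qed

text \<open>For fields Y and Y' annihilated by \<open>F\<close>, Cartan's formula leaves
  psi([Y, Y']) = - d psi (Y, Y'), and d psi is in the ideal generated by \<open>F\<close>. Complex
  coefficients do not define tangent vectors, so the fields are coefficient families over the real
  frame \<open>E\<close>, and the long sum is the coefficient of [Y, Y'] at
  \<open>E l\<close>.\<close>

lemma frobenius_bracket:
  fixes \<sigma> :: "'z::euclidean_space \<Rightarrow> 'e::euclidean_space"
    and F :: "('e \<Rightarrow> 'e \<Rightarrow> 'k::real_normed_field) list"
    and E :: "'i::finite \<Rightarrow> 'z \<Rightarrow> 'z" and Y Y' :: "'i \<Rightarrow> 'z \<Rightarrow> 'k"
  defines "p \<equiv> \<lambda>\<psi> i z. \<psi> (\<sigma> z) (FD \<sigma> z (E i z))"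
  assumes B: "open B" and frob: "frobenius_frame N B F"
    and U: "open U" and \<sigma>: "smooth_on U \<sigma>" and UB: "\<And>z. z \<in> U \<Longrightarrow> \<sigma> z \<in> B"
    and MN: "\<And>z. z \<in> M \<Longrightarrow> z \<in> U \<Longrightarrow> \<sigma> z \<in> N"
    and curve: "\<And>i z. z \<in> M \<Longrightarrow> z \<in> U \<Longrightarrow> E i z \<in> tangent_vectors M z"
    and E: "\<And>i z. z \<in> M \<Longrightarrow> z \<in> U \<Longrightarrow> (E i has_derivative dE i z) (at z)"
    and c: "\<And>i j z. z \<in> M \<Longrightarrow> z \<in> U \<Longrightarrow>
      dE j z (E i z) - dE i z (E j z) = (\<Sum>l\<in>UNIV. c i j l z *\<^sub>R E l z)"
    and Y: "\<And>i z. z \<in> M \<Longrightarrow> z \<in> U \<Longrightarrow> (Y i has_derivative dY i z) (at z)"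
    and Y': "\<And>i z. z \<in> M \<Longrightarrow> z \<in> U \<Longrightarrow> (Y' i has_derivative dY' i z) (at z)"
    and kill: "\<And>\<psi> z. \<psi> \<in> set F \<Longrightarrow> z \<in> M \<Longrightarrow> z \<in> U \<Longrightarrow> (\<Sum>i\<in>UNIV. Y i z * p \<psi> i z) = 0"
    and kill': "\<And>\<psi> z. \<psi> \<in> set F \<Longrightarrow> z \<in> M \<Longrightarrow> z \<in> U \<Longrightarrow> (\<Sum>i\<in>UNIV. Y' i z * p \<psi> i z) = 0"
    and \<psi>: "\<psi> \<in> set F" and z: "z \<in> M" "z \<in> U"
  shows "(\<Sum>l\<in>UNIV. ((\<Sum>i\<in>UNIV. Y i z * dY' l z (E i z) - Y' i z * dY l z (E i z))
      + (\<Sum>i\<in>UNIV. \<Sum>j\<in>UNIV. Y i z * Y' j z * of_real (c i j l z))) * p \<psi> l z) = 0"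
proof -
  define Eh where "Eh i = FD \<sigma> z (E i z)" for i
  have form: "smooth_form B \<psi>" using frob \<psi> by (auto simp: frobenius_frame_def)
  have lin: "linear (\<psi> y)" if "y \<in> B" for y using form that by (auto simp: smooth_form_def)
  have diff: "(\<lambda>y. \<psi> y v) differentiable (at y)" if "y \<in> B" for y v
    using form that smooth_on_differentiable[OF _ B] unfolding smooth_form_def by blast
  have dp: "p \<psi> j differentiable (at z)" for j
    unfolding p_def
    by (rule ext_deriv_along_map(1)[OF B UB[OF z(2)] lin diff[OF UB[OF z(2)]] U z(2) \<sigma> E[OF z] E[OF z, of j]])
  define dp where "dp j = FD (p \<psi> j) z" for j
  have pd: "(p \<psi> j has_derivative dp j) (at z)" for j
    unfolding dp_def using dp by (rule has_frechet_derivative)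
  have linz: "linear (\<lambda>v. \<psi> (\<sigma> z) (FD \<sigma> z v))"
    using linear_compose[OF linear_frechet_derivative[OF smooth_on_differentiable[OF \<sigma> U z(2)]]
      lin[OF UB[OF z(2)]]] by (simp add: o_def)
  have curl: "dp j (E i z) - dp i (E j z) = ext_deriv \<psi> (\<sigma> z) (Eh i) (Eh j)
      + (\<Sum>l\<in>UNIV. of_real (c i j l z) * p \<psi> l z)" for i j
  proof -
    have "dp j (E i z) - dp i (E j z) = ext_deriv \<psi> (\<sigma> z) (Eh i) (Eh j)
      + \<psi> (\<sigma> z) (FD \<sigma> z (dE j z (E i z) - dE i z (E j z)))"
      unfolding dp_def p_def Eh_def
      by (rule ext_deriv_along_map(2)[OF B UB[OF z(2)] lin diff[OF UB[OF z(2)]] U z(2) \<sigma> E[OF z] E[OF z]])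
    also have "\<psi> (\<sigma> z) (FD \<sigma> z (dE j z (E i z) - dE i z (E j z)))
        = (\<Sum>l\<in>UNIV. of_real (c i j l z) * p \<psi> l z)"
      unfolding c[OF z] linear_sum[OF linz] linear_cmul[OF linz] p_def
      by (simp add: scaleR_conv_of_real)
    finally show ?thesis .
  qed
  have tang: "Eh i \<in> tangent_vectors N (\<sigma> z)" for i
    unfolding Eh_def
    by (rule tangent_vectors_image[OF curve[OF z] smooth_on_has_derivative[OF \<sigma> U z(2)] U z(2)])
      (rule MN)
  have zN: "\<sigma> z \<in> N \<inter> B" using MN z UB by blast
  obtain \<beta> where \<beta>: "\<And>X X'. X \<in> tangent_vectors N (\<sigma> z) \<Longrightarrow> X' \<in> tangent_vectors N (\<sigma> z) \<Longrightarrow>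
      ext_deriv \<psi> (\<sigma> z) X X' = (\<Sum>m<length F. wedge (\<beta> m) ((F ! m) (\<sigma> z)) X X')"
    using frob zN \<psi> unfolding frobenius_frame_def by meson
  have q: "p (F ! m) i z = (F ! m) (\<sigma> z) (Eh i)" for m i by (simp add: p_def Eh_def)
  \<comment> \<open>Each term of the wedge products contains a form of \<open>F\<close> contracted
    with \<open>Y\<close> or with \<open>Y'\<close>.\<close>
  have flat: "(\<Sum>i\<in>UNIV. \<Sum>j\<in>UNIV. Y i z * Y' j z * ext_deriv \<psi> (\<sigma> z) (Eh i) (Eh j)) = 0"
  proof -
    have "(\<Sum>i\<in>UNIV. \<Sum>j\<in>UNIV. Y i z * Y' j z * ext_deriv \<psi> (\<sigma> z) (Eh i) (Eh j))
      = (\<Sum>i\<in>UNIV. \<Sum>j\<in>UNIV. \<Sum>m<length F. Y i z * \<beta> m (Eh i) * (Y' j z * p (F ! m) j z)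
            - (Y i z * p (F ! m) i z) * (Y' j z * \<beta> m (Eh j)))"
      by (simp add: \<beta>[OF tang tang] wedge_def q sum_distrib_left algebra_simps)
    also have "\<dots> = (\<Sum>m<length F. (\<Sum>i\<in>UNIV. Y i z * \<beta> m (Eh i)) * (\<Sum>j\<in>UNIV. Y' j z * p (F ! m) j z)
            - (\<Sum>i\<in>UNIV. Y i z * p (F ! m) i z) * (\<Sum>j\<in>UNIV. Y' j z * \<beta> m (Eh j)))"
      by (simp add: sum_product sum_subtractf sum.swap[where B = "{..<length F}"])
    also have "\<dots> = 0"
      using kill[OF nth_mem z] kill'[OF nth_mem z] by (intro sum.neutral) simp
    finally show ?thesis .
  qed
  \<comment> \<open>The Leibniz rule for the annihilation identity, in the direction of a frame
    field, which is tangent to \<open>M\<close>.\<close>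
  have dkill: "(\<Sum>j\<in>UNIV. Z j z * dp j (E i z) + dZ j z (E i z) * p \<psi> j z) = 0"
    if Z: "\<And>i. (Z i has_derivative dZ i z) (at z)"
      and killZ: "\<And>z. z \<in> M \<Longrightarrow> z \<in> U \<Longrightarrow> (\<Sum>i\<in>UNIV. Z i z * p \<psi> i z) = 0"
    for Z :: "'i \<Rightarrow> 'z \<Rightarrow> 'k" and dZ i
  proof (rule derivative_tangent_eq_0[OF curve[OF z] _ U z(2) killZ])
    show "((\<lambda>z. \<Sum>i\<in>UNIV. Z i z * p \<psi> i z) has_derivative
      (\<lambda>v. \<Sum>j\<in>UNIV. Z j z * dp j v + dZ j z v * p \<psi> j z)) (at z)"
      by (intro has_derivative_sum has_derivative_mult Z pd)
  qed
  let ?S = "\<lambda>Z Z' dZ'. \<Sum>i\<in>UNIV. \<Sum>j\<in>UNIV. Z i z * Z' j z * dp j (E i z) + Z i z * dZ' j z (E i z) * p \<psi> j z"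
  have S: "?S Z Z' dZ' = 0"
    if Z': "\<And>i. (Z' i has_derivative dZ' i z) (at z)"
      and killZ: "\<And>z. z \<in> M \<Longrightarrow> z \<in> U \<Longrightarrow> (\<Sum>i\<in>UNIV. Z' i z * p \<psi> i z) = 0"
    for Z Z' :: "'i \<Rightarrow> 'z \<Rightarrow> 'k" and dZ'
  proof -
    have "?S Z Z' dZ' = (\<Sum>i\<in>UNIV. Z i z * (\<Sum>j\<in>UNIV. Z' j z * dp j (E i z) + dZ' j z (E i z) * p \<psi> j z))"
      by (simp add: sum_distrib_left algebra_simps)
    then show ?thesis using dkill[where Z = Z' and dZ = dZ', OF that] by simp
  qed
  have "(\<Sum>l\<in>UNIV. ((\<Sum>i\<in>UNIV. Y i z * dY' l z (E i z) - Y' i z * dY l z (E i z))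
      + (\<Sum>i\<in>UNIV. \<Sum>j\<in>UNIV. Y i z * Y' j z * of_real (c i j l z))) * p \<psi> l z)
    = (\<Sum>i\<in>UNIV. \<Sum>l\<in>UNIV. Y i z * dY' l z (E i z) * p \<psi> l z)
      - (\<Sum>i\<in>UNIV. \<Sum>l\<in>UNIV. Y' i z * dY l z (E i z) * p \<psi> l z)
      + (\<Sum>i\<in>UNIV. \<Sum>j\<in>UNIV. Y i z * Y' j z * (\<Sum>l\<in>UNIV. of_real (c i j l z) * p \<psi> l z))"
  proof -
    have 1: "(\<Sum>l\<in>UNIV. (\<Sum>i\<in>UNIV. f i l) * p \<psi> l z) = (\<Sum>i\<in>UNIV. \<Sum>l\<in>UNIV. f i l * p \<psi> l z)"
      for f :: "'i \<Rightarrow> 'i \<Rightarrow> 'k"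
      unfolding sum_distrib_right by (rule sum.swap)
    have 2: "(\<Sum>l\<in>UNIV. (\<Sum>i\<in>UNIV. \<Sum>j\<in>UNIV. f i j l) * p \<psi> l z)
       = (\<Sum>i\<in>UNIV. \<Sum>j\<in>UNIV. \<Sum>l\<in>UNIV. f i j l * p \<psi> l z)"
      for f :: "'i \<Rightarrow> 'i \<Rightarrow> 'i \<Rightarrow> 'k"
      unfolding 1 by (intro sum.cong refl 1)
    show ?thesis
      by (simp add: distrib_right left_diff_distrib sum.distrib sum_subtractf 1 2 sum_distrib_left mult.assoc)
  qed
  \<comment> \<open>\<open>curl\<close> trades the structure functions for derivatives of the values
    \<open>p\<close>, and \<open>flat\<close> removes the exterior derivative. What remains is a
    difference of two differentiated annihilation identities.\<close>
  also have "(\<Sum>i\<in>UNIV. \<Sum>j\<in>UNIV. Y i z * Y' j z * (\<Sum>l\<in>UNIV. of_real (c i j l z) * p \<psi> l z))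
    = (\<Sum>i\<in>UNIV. \<Sum>j\<in>UNIV. Y i z * Y' j z * (dp j (E i z) - dp i (E j z)))"
    using flat by (simp add: curl distrib_left sum.distrib)
  also have "(\<Sum>i\<in>UNIV. \<Sum>l\<in>UNIV. Y i z * dY' l z (E i z) * p \<psi> l z)
      - (\<Sum>i\<in>UNIV. \<Sum>l\<in>UNIV. Y' i z * dY l z (E i z) * p \<psi> l z)
      + (\<Sum>i\<in>UNIV. \<Sum>j\<in>UNIV. Y i z * Y' j z * (dp j (E i z) - dp i (E j z)))
      = ?S Y Y' dY' - ?S Y' Y dY"
  proof -
    have "(\<Sum>i\<in>UNIV. \<Sum>j\<in>UNIV. Y i z * Y' j z * dp i (E j z))
        = (\<Sum>i\<in>UNIV. \<Sum>j\<in>UNIV. Y' i z * Y j z * dp j (E i z))"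
      by (subst sum.swap) (simp add: mult.commute)
    then show ?thesis by (simp add: sum.distrib sum_subtractf right_diff_distrib)
  qed
  also have "\<dots> = 0"
    using S[where Z = Y and Z' = Y' and dZ' = dY', OF Y'[OF z] kill'[OF \<psi>]]
      S[where Z = Y' and Z' = Y and dZ' = dY, OF Y[OF z] kill[OF \<psi>]] by simp
  finally show ?thesis .
qed

subsection \<open>Surfaces with an orthonormal framing\<close>

lemma tangent_vectors_open:
  assumes "open D" "x \<in> D"
  shows "v \<in> tangent_vectors D x"
proof -
  have d: "((\<lambda>t. x + t *\<^sub>R v) has_vector_derivative v) (at 0)"
    by (auto intro!: derivative_eq_intros)
  show ?thesis
    unfolding tangent_vectors_def
    using curve_eventually_in[OF d assms(1)] assms(2) d
    by (intro CollectI exI[of _ "\<lambda>t. x + t *\<^sub>R v"]) simp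
qed

text \<open>A chart read in coordinates: metric, frame bundle and connection form live over the
  chart image \<open>C\<close>, the framing over a possibly smaller open set \<open>D\<close>. The
  curvature \<open>kap\<close> enters only through the structure equations.\<close>

locale surface_patch =
  fixes C D :: "(real^2) set" and h :: "real^2 \<Rightarrow> real^2 \<Rightarrow> real^2 \<Rightarrow> real"
    and e1 e2 :: "real^2 \<Rightarrow> real^2" and om :: "frame2 \<Rightarrow> frame2 \<Rightarrow> real" and kap :: "real^2 \<Rightarrow> real"
  assumes C: "open C" and D: "open D" and DC: "D \<subseteq> C"
    and h_smooth: "\<And>u v. smooth_on C (\<lambda>x. h x u v)"
    and h_bilinear: "\<And>x. x \<in> C \<Longrightarrow> bilinear (h x)"
    and h_sym: "\<And>x u v. x \<in> C \<Longrightarrow> h x u v = h x v u"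
    and e1_smooth: "smooth_on D e1" and e2_smooth: "smooth_on D e2"
    and h11: "\<And>x. x \<in> D \<Longrightarrow> h x (e1 x) (e1 x) = 1"
    and h22: "\<And>x. x \<in> D \<Longrightarrow> h x (e2 x) (e2 x) = -1"
    and h12: "\<And>x. x \<in> D \<Longrightarrow> h x (e1 x) (e2 x) = 0"
    and om_form: "smooth_form {y. fst y \<in> C} om"
    and struct_eqs: "\<And>y X Y. y \<in> frame_bundle C h \<Longrightarrow> X \<in> tangent_vectors (frame_bundle C h) y \<Longrightarrow>
        Y \<in> tangent_vectors (frame_bundle C h) y \<Longrightarrow>
          ext_deriv (eta1 h) y X Y = - wedge (om y) (eta2 h y) X Y \<and>
          ext_deriv (eta2 h) y X Y = - wedge (om y) (eta1 h y) X Y \<and>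
          ext_deriv om y X Y = - kap (fst y) * wedge (eta1 h y) (eta2 h y) X Y"
begin

lemma h21: "x \<in> D \<Longrightarrow> h x (e2 x) (e1 x) = 0"
  using h12 h_sym DC by (metis subsetD)

lemma h_lin: "x \<in> D \<Longrightarrow> linear (h x u)" "x \<in> D \<Longrightarrow> linear (\<lambda>v. h x v u)"
  using h_bilinear DC unfolding bilinear_def by blast+

lemma frame_expansion:
  assumes "x \<in> D" shows "v = h x v (e1 x) *\<^sub>R e1 x - h x v (e2 x) *\<^sub>R e2 x"
  using assms h_bilinear DC h11 h22 h12 h21 by (intro surface_frame_expansion) auto

definition d1 :: "(real^2 \<Rightarrow> 'b::real_normed_vector) \<Rightarrow> real^2 \<Rightarrow> 'b" where
  "d1 f x = FD f x (e1 x)"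

definition d2 :: "(real^2 \<Rightarrow> 'b::real_normed_vector) \<Rightarrow> real^2 \<Rightarrow> 'b" where
  "d2 f x = FD f x (e2 x)"

lemma d_cong:
  assumes x: "x \<in> D" and f: "f differentiable (at x)" and eq: "\<And>y. y \<in> D \<Longrightarrow> f y = g y"
  shows "d1 g x = d1 f x" "d2 g x = d2 f x"
proof -
  have "(g has_derivative FD f x) (at x)"
    by (rule has_derivative_transform_within_open[OF has_frechet_derivative[OF f] D x eq])
  from frechet_derivative_eqI[OF this] show "d1 g x = d1 f x" "d2 g x = d2 f x"
    by (simp_all add: d1_def d2_def)
qed

lemma smooth_d1: "smooth_on D f \<Longrightarrow> smooth_on D (d1 f)"
  unfolding d1_def[abs_def]
  by (rule smooth_on_linear_apply[OF D _ _ e1_smooth])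
    (auto intro: linear_frechet_derivative smooth_on_differentiable[OF _ D] smooth_on_frechet_derivative)

lemma smooth_d2: "smooth_on D f \<Longrightarrow> smooth_on D (d2 f)"
  unfolding d2_def[abs_def]
  by (rule smooth_on_linear_apply[OF D _ _ e2_smooth])
    (auto intro: linear_frechet_derivative smooth_on_differentiable[OF _ D] smooth_on_frechet_derivative)

lemma frechet_derivative_frame:
  assumes "x \<in> D" "f differentiable (at x)"
  shows "FD f x v = h x v (e1 x) *\<^sub>R d1 f x - h x v (e2 x) *\<^sub>R d2 f x"
proof -
  note l = linear_frechet_derivative[OF assms(2)]
  show ?thesis
    by (subst frame_expansion[OF assms(1), of v]) (simp add: linear_diff[OF l] linear_cmul[OF l] d1_def d2_def)
qed

section \<open>Structure equations pulled back by the framing\<close>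

definition sec :: "real^2 \<Rightarrow> frame2" where "sec x = (x, e1 x, e2 x)"

abbreviation dsec :: "real^2 \<Rightarrow> real^2 \<Rightarrow> frame2" where
  "dsec x \<equiv> FD sec x"

definition G1 :: "real^2 \<Rightarrow> real" where "G1 x = om (sec x) (dsec x (e1 x))"
definition G2 :: "real^2 \<Rightarrow> real" where "G2 x = om (sec x) (dsec x (e2 x))"

lemma sec_smooth: "smooth_on D sec"
  unfolding sec_def[abs_def] by (intro smooth_on_Pair smooth_on_ident D e1_smooth e2_smooth)

lemma dsec:
  assumes "x \<in> D"
  shows "dsec x v = (v, FD e1 x v, FD e2 x v)"
proof -
  have "(sec has_derivative (\<lambda>v. (v, FD e1 x v, FD e2 x v))) (at x)"
    unfolding sec_def[abs_def]
    by (intro has_derivative_Pair has_derivative_ident smooth_on_has_derivative[OF _ D assms] e1_smooth e2_smooth)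
  from frechet_derivative_eqI[OF this] show ?thesis by simp
qed

lemma sec_bundle: "x \<in> D \<Longrightarrow> sec x \<in> frame_bundle C h"
  using h11 h22 h12 DC by (auto simp: sec_def frame_bundle_def)

lemma sec_tangent: "x \<in> D \<Longrightarrow> dsec x v \<in> tangent_vectors (frame_bundle C h) (sec x)"
  by (rule tangent_vectors_image[OF tangent_vectors_open[OF D] smooth_on_has_derivative[OF sec_smooth D] D])
    (auto intro: sec_bundle)

lemma om_linear: "fst y \<in> C \<Longrightarrow> linear (om y)"
  using om_form unfolding smooth_form_def by blast

lemma open_fstC: "open {y :: frame2. fst y \<in> C}"
  using open_vimage_fst[OF C] by (simp add: vimage_def)

lemma sec_C: "x \<in> D \<Longrightarrow> sec x \<in> {y. fst y \<in> C}"
  using DC by (auto simp: sec_def)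

lemma om_differentiable: "fst y \<in> C \<Longrightarrow> (\<lambda>y. om y v) differentiable (at y)"
  using om_form smooth_on_differentiable[OF _ open_fstC] unfolding smooth_form_def by blast

lemma dsec_smooth: "smooth_on D w \<Longrightarrow> smooth_on D (\<lambda>x. dsec x (w x))"
  by (rule smooth_on_linear_apply[OF D])
    (auto intro: linear_frechet_derivative smooth_on_differentiable[OF sec_smooth D]
      smooth_on_frechet_derivative sec_smooth)

lemma om_sec_smooth:
  assumes "smooth_on D w"
  shows "smooth_on D (\<lambda>x. om (sec x) (w x))"
proof (rule smooth_on_linear_apply[OF D _ _ assms])
  show "linear (om (sec x))" if "x \<in> D" for x using om_linear sec_C[OF that] by simp
  show "smooth_on D (\<lambda>x. om (sec x) v)" for v
    by (rule smooth_on_compose[OF D open_fstC sec_smooth _ sec_C])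
      (use om_form in \<open>simp add: smooth_form_def del: split_paired_All\<close>)
qed

lemma G1_smooth: "smooth_on D G1"
  unfolding G1_def[abs_def] by (intro om_sec_smooth dsec_smooth e1_smooth)

lemma G2_smooth: "smooth_on D G2"
  unfolding G2_def[abs_def] by (intro om_sec_smooth dsec_smooth e2_smooth)

lemma eta_eq: "eta1 h y X = h (fst y) (fst X) (fst (snd y))" "eta2 h y X = - h (fst y) (fst X) (snd (snd y))"
  by (cases y; cases X; simp)+

lemma h_apply_differentiable:
  fixes w :: "frame2 \<Rightarrow> real^2"
  assumes "fst y \<in> C" "(w has_derivative dw) (at y)"
  shows "(\<lambda>y. h (fst y) u (w y)) differentiable (at y)"
proof -
  have "(\<lambda>y. h (fst y) u v) differentiable (at y)" for v
  proof -
    have "(\<lambda>x. h x u v) differentiable (at (fst y))"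
      by (rule smooth_on_differentiable[OF h_smooth C assms(1)])
    then have "((\<lambda>x. h x u v) \<circ> fst) differentiable (at y)"
      by (rule differentiable_chain_at[OF bounded_linear_imp_differentiable[OF bounded_linear_fst]])
    then show ?thesis by (simp add: o_def)
  qed
  moreover have "linear (h (fst y) u)" if "fst y \<in> C" for y :: frame2
    using h_bilinear[OF that] by (simp add: bilinear_def)
  ultimately show ?thesis
    using has_derivative_linear_apply[OF open_fstC _ _ _ assms(2), of "\<lambda>y. h (fst y) u"] assms(1)
    unfolding differentiable_def by blast
qed

lemma eta_differentiable:
  assumes "fst y \<in> C"
  shows "(\<lambda>y. eta1 h y X) differentiable (at y)" "(\<lambda>y. eta2 h y X) differentiable (at y)"
proof -
  have "((\<lambda>y::frame2. fst (snd y)) has_derivative (\<lambda>y. fst (snd y))) (at y)"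
    "((\<lambda>y::frame2. snd (snd y)) has_derivative (\<lambda>y. snd (snd y))) (at y)"
    by (auto intro!: derivative_eq_intros)
  then show "(\<lambda>y. eta1 h y X) differentiable (at y)" "(\<lambda>y. eta2 h y X) differentiable (at y)"
    unfolding eta_eq by (auto intro: differentiable_minus h_apply_differentiable[OF assms])
qed

lemma eta_linear:
  assumes "fst y \<in> C" shows "linear (eta1 h y)" "linear (eta2 h y)"
proof -
  have l: "linear (\<lambda>v. h (fst y) v w)" for w using h_bilinear[OF assms] by (simp add: bilinear_def)
  show "linear (eta1 h y)" "linear (eta2 h y)"
    by (auto intro!: linearI simp: eta_eq linear_add[OF l] linear_cmul[OF l])
qed

lemma has_derivative_e:
  "x \<in> D \<Longrightarrow> (e1 has_derivative FD e1 x) (at x)"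
  "x \<in> D \<Longrightarrow> (e2 has_derivative FD e2 x) (at x)"
  by (auto intro: smooth_on_has_derivative[OF _ D] e1_smooth e2_smooth)

lemma frechet_derivative_const_on:
  assumes "x \<in> D" "\<And>y. y \<in> D \<Longrightarrow> f y = c"
  shows "FD f x v = 0"
proof -
  have "(f has_derivative (\<lambda>v. 0)) (at x)"
    by (rule has_derivative_transform_within_open[OF has_derivative_const D assms(1)])
      (simp add: assms(2))
  from frechet_derivative_eqI[OF this] show ?thesis by simp
qed

text \<open>Pulled back by \<open>sec\<close>, the canonical forms become the dual coframe, so their
  values on e1 and e2 are constant. Cartan's formula then turns the first two structure equations
  into the two components of the bracket [e1, e2].\<close>

lemma frame_commutator:
  assumes x: "x \<in> D"
  shows "FD e2 x (e1 x) - FD e1 x (e2 x)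
    = G1 x *\<^sub>R e1 x - G2 x *\<^sub>R e2 x" (is "?b = _")
proof -
  note fC = sec_C[OF x]
  have eta_sec: "eta1 h (sec y) (dsec y v) = h y v (e1 y)" "eta2 h (sec y) (dsec y v) = - h y v (e2 y)"
    if "y \<in> D" for y v
    using that by (simp_all add: dsec sec_def)
  have 1: "- wedge (om (sec x)) (eta2 h (sec x)) (dsec x (e1 x)) (dsec x (e2 x)) + eta1 h (sec x) (dsec x ?b) = 0"
  proof -
    note ext_deriv_along_map(2)[OF open_fstC fC eta_linear(1) eta_differentiable(1) D x sec_smooth
        has_derivative_e(1)[OF x] has_derivative_e(2)[OF x]]
    moreover have "FD (\<lambda>y. eta1 h (sec y) (dsec y (e2 y))) x (e1 x) = 0"
      by (rule frechet_derivative_const_on[OF x, of _ 0]) (simp add: eta_sec h21)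
    moreover have "FD (\<lambda>y. eta1 h (sec y) (dsec y (e1 y))) x (e2 x) = 0"
      by (rule frechet_derivative_const_on[OF x, of _ 1]) (simp add: eta_sec h11)
    ultimately show ?thesis
      using struct_eqs[OF sec_bundle[OF x] sec_tangent[OF x] sec_tangent[OF x]] fC by simp
  qed
  have 2: "- wedge (om (sec x)) (eta1 h (sec x)) (dsec x (e1 x)) (dsec x (e2 x)) + eta2 h (sec x) (dsec x ?b) = 0"
  proof -
    note ext_deriv_along_map(2)[OF open_fstC fC eta_linear(2) eta_differentiable(2) D x sec_smooth
        has_derivative_e(1)[OF x] has_derivative_e(2)[OF x]]
    moreover have "FD (\<lambda>y. eta2 h (sec y) (dsec y (e2 y))) x (e1 x) = 0"
      by (rule frechet_derivative_const_on[OF x, of _ 1]) (simp add: eta_sec h22)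
    moreover have "FD (\<lambda>y. eta2 h (sec y) (dsec y (e1 y))) x (e2 x) = 0"
      by (rule frechet_derivative_const_on[OF x, of _ 0]) (simp add: eta_sec h12)
    ultimately show ?thesis
      using struct_eqs[OF sec_bundle[OF x] sec_tangent[OF x] sec_tangent[OF x]] fC by simp
  qed
  have "h x ?b (e1 x) = G1 x" "h x ?b (e2 x) = G2 x"
    using 1 2 by (simp_all add: wedge_def eta_sec[OF x] h11[OF x] h12[OF x] h21[OF x] h22[OF x] G1_def G2_def)
  then show ?thesis using frame_expansion[OF x, of ?b] by simp
qed

text \<open>The third structure equation pulled back by \<open>sec\<close>. The squares come from
  evaluating the connection form on [e1, e2].\<close>

lemma gauss_equation:
  assumes x: "x \<in> D"
  shows "d1 G2 x - d2 G1 x - (G1 x)\<^sup>2 + (G2 x)\<^sup>2 = - kap x"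
proof -
  note fC = sec_C[OF x]
  have l: "linear (\<lambda>v. om (sec x) (dsec x v))"
    using linear_compose[OF linear_frechet_derivative[OF smooth_on_differentiable[OF sec_smooth D x]] om_linear]
      fC by (simp add: o_def)
  have "om (sec x) (dsec x (G1 x *\<^sub>R e1 x - G2 x *\<^sub>R e2 x)) = (G1 x)\<^sup>2 - (G2 x)\<^sup>2"
    using linear_diff[OF l] linear_cmul[OF l] by (simp add: G1_def G2_def power2_eq_square)
  moreover have "wedge (eta1 h (sec x)) (eta2 h (sec x)) (dsec x (e1 x)) (dsec x (e2 x)) = 1"
    using x by (simp add: wedge_def dsec sec_def h11 h12 h21 h22)
  ultimately show ?thesis
    using ext_deriv_along_map(2)[OF open_fstC fC om_linear om_differentiable D x sec_smooth
        has_derivative_e(1)[OF x] has_derivative_e(2)[OF x]] fC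
      struct_eqs[OF sec_bundle[OF x] sec_tangent[OF x] sec_tangent[OF x]]
    by (simp add: frame_commutator[OF x] d1_def d2_def G1_def[abs_def] G2_def[abs_def]) (simp add: sec_def)
qed

lemma derivative_commutator:
  fixes f :: "real^2 \<Rightarrow> 'b::euclidean_space"
  assumes x: "x \<in> D" and f: "smooth_on D f"
  shows "d1 (d2 f) x - d2 (d1 f) x = G1 x *\<^sub>R d1 f x - G2 x *\<^sub>R d2 f x"
proof -
  have D': "((\<lambda>y. FD f y (w y)) has_derivative
    (\<lambda>u. FD (\<lambda>y. FD f y (w x)) x u
      + FD f x (dw u))) (at x)" if "(w has_derivative dw) (at x)" for w dw
  proof (rule has_derivative_linear_apply[OF D x _ _ that])
    show "linear (FD f y)" if "y \<in> D" for y
      by (rule linear_frechet_derivative[OF smooth_on_differentiable[OF f D that]])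
    show "(\<lambda>y. FD f y v) differentiable (at x)" for v
      by (rule smooth_on_differentiable[OF smooth_on_frechet_derivative[OF f] D x])
  qed
  note l = linear_frechet_derivative[OF smooth_on_differentiable[OF f D x]]
  have "d1 (d2 f) x - d2 (d1 f) x
      = FD f x (FD e2 x (e1 x) - FD e1 x (e2 x))"
    unfolding d1_def[abs_def] d2_def[abs_def] frechet_derivative_eqI[OF D'[OF has_derivative_e(1)[OF x]]]
      frechet_derivative_eqI[OF D'[OF has_derivative_e(2)[OF x]]]
      second_derivative_symmetric[OF D f x, of "e2 x" "e1 x"] linear_diff[OF l] by simp
  then show ?thesis
    unfolding frame_commutator[OF x] linear_diff[OF l] linear_cmul[OF l] by (simp add: d1_def d2_def)
qed

text \<open>The components of $\nabla^2 q = c\,\mathbf{g}$ in the framing; \<open>G1\<close> and \<open>G2\<close> are the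
  coefficients of the connection form pulled back by the framing.\<close>

definition hess_eq :: "(real^2 \<Rightarrow> real) \<Rightarrow> real \<Rightarrow> real^2 \<Rightarrow> bool" where
  "hess_eq q c x \<longleftrightarrow> d1 (d1 q) x = G1 x * d2 q x + c \<and> d2 (d1 q) x = G2 x * d2 q x \<and>
    d1 (d2 q) x = G1 x * d1 q x \<and> d2 (d2 q) x = G2 x * d1 q x - c"

text \<open>The Gauss equation expresses the curvature through derivatives of the connection
  coefficients, which are smooth because the connection form is.\<close>

lemma kap_smooth: "smooth_on D kap"
proof -
  have "smooth_on D (\<lambda>x. - (d1 G2 x - d2 G1 x - G1 x * G1 x + G2 x * G2 x))"
    by (intro smooth_on_minus smooth_on_add smooth_on_diff smooth_on_mult smooth_d1 smooth_d2
        G1_smooth G2_smooth D)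
  then show ?thesis
    by (rule smooth_on_cong[OF D, THEN iffD1, rotated]) (use gauss_equation in \<open>force simp: power2_eq_square\<close>)
qed

end

subsection \<open>The dual frame on the frame bundle of Minkowski space\<close>

text \<open>\<open>H1\<close> and \<open>H2\<close> are the directions of the surface framing, on which \<open>frame_gen\<close> is 0.\<close>

datatype idx = H1 | H2 | R1 | R2 | R3 | S12 | S31 | S32

lemma UNIV_idx: "UNIV = {H1, H2, R1, R2, R3, S12, S31, S32}"
  using idx.exhaust by auto

instance idx :: finite
  by standard (simp add: UNIV_idx)

lemma sum_idx: "(\<Sum>i\<in>UNIV. f i) = f H1 + f H2 + f R1 + f R2 + f R3 + f S12 + f S31 + f S32"
  by (simp add: UNIV_idx add.assoc)

text \<open>The vector fields on the frame bundle of Minkowski space that are dual to the forms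
  \<open>omega_1\<close>, \<open>omega_2\<close>, \<open>omega_3\<close>, \<open>omega_12\<close>, \<open>omega_31\<close>, \<open>omega_32\<close>.\<close>

primrec frame_gen :: "idx \<Rightarrow> frame3 \<Rightarrow> frame3" where
  "frame_gen H1 f = 0"
| "frame_gen H2 f = 0"
| "frame_gen R1 f = (fst (snd f), 0, 0, 0)"
| "frame_gen R2 f = (fst (snd (snd f)), 0, 0, 0)"
| "frame_gen R3 f = (snd (snd (snd f)), 0, 0, 0)"
| "frame_gen S12 f = (0, fst (snd (snd f)), fst (snd f), 0)"
| "frame_gen S31 f = (0, snd (snd (snd f)), 0, fst (snd f))"
| "frame_gen S32 f = (0, 0, snd (snd (snd f)), - fst (snd (snd f)))"

lemma linear_frame_gen: "linear (frame_gen i)"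
  by (cases i) (auto intro!: linearI simp: zero_prod_def)

lemma mink_linear:
  "mink (u + v) w = mink u w + mink v w" "mink w (u + v) = mink w u + mink w v"
  "mink (u - v) w = mink u w - mink v w" "mink w (u - v) = mink w u - mink w v"
  "mink (a *\<^sub>R u) w = a * mink u w" "mink w (a *\<^sub>R u) = a * mink w u"
  "mink 0 w = 0" "mink w 0 = 0" "mink (- u) w = - mink u w" "mink w (- u) = - mink w u"
  by (simp_all add: mink_def algebra_simps)

lemma mink_commute: "mink u v = mink v u"
  by (simp add: mink_def mult.commute)

text \<open>Velocities of explicit curves of frames: translations of the base point, hyperbolic
  rotations in the planes e1 e2 and e1 e3 of mixed signature, and an ordinary rotation in the
  definite plane e2 e3.\<close>

lemma frame_gen_tangent:
  assumes f: "f \<in> mink_frame_bundle"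
  shows "frame_gen i f \<in> tangent_vectors mink_frame_bundle f"
proof -
  obtain p a b c where fe: "f = (p, a, b, c)" by (cases f) auto
  have o: "mink a a = 1" "mink b b = -1" "mink c c = -1" "mink a b = 0" "mink a c = 0" "mink b c = 0"
    "mink b a = 0" "mink c a = 0" "mink c b = 0"
    using f by (auto simp: fe mink_frame_bundle_def mink_frame_def mink_commute)
  have I: "v \<in> tangent_vectors mink_frame_bundle f"
    if "\<gamma> 0 = f" "\<And>t. \<gamma> t \<in> mink_frame_bundle" "(\<gamma> has_vector_derivative v) (at 0)" for \<gamma> v
    using that unfolding tangent_vectors_def by (intro CollectI exI[of _ \<gamma>]) simp
  have ch: "cosh t * cosh t = 1 + sinh t * sinh t" for t :: real
    using cosh_square_eq[of t] by (simp add: power2_eq_square)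
  have cs: "cos t * cos t = 1 - sin t * sin t" for t :: real
    using sin_cos_squared_add[of t] by (simp add: power2_eq_square)
  have T: "(v, 0, 0, 0) \<in> tangent_vectors mink_frame_bundle f" for v
  proof (rule I)
    show "(p + t *\<^sub>R v, a, b, c) \<in> mink_frame_bundle" for t
      using f by (simp add: fe mink_frame_bundle_def)
    show "((\<lambda>t. (p + t *\<^sub>R v, a, b, c)) has_vector_derivative (v, 0, 0, 0)) (at 0)"
      unfolding has_vector_derivative_def by (auto intro!: derivative_eq_intros has_derivative_Pair simp: zero_prod_def fun_eq_iff)
  qed (simp add: fe)
  have "frame_gen S12 f \<in> tangent_vectors mink_frame_bundle f"
  proof (rule I)
    let ?\<gamma> = "\<lambda>t. (p, cosh t *\<^sub>R a + sinh t *\<^sub>R b, sinh t *\<^sub>R a + cosh t *\<^sub>R b, c)"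
    show "?\<gamma> t \<in> mink_frame_bundle" for t
      by (simp add: mink_frame_bundle_def mink_frame_def mink_linear o algebra_simps ch)
    show "(?\<gamma> has_vector_derivative frame_gen S12 f) (at 0)"
      unfolding has_vector_derivative_def
      by (auto intro!: derivative_eq_intros has_derivative_Pair simp: fe zero_prod_def fun_eq_iff)
  qed (simp add: fe)
  moreover have "frame_gen S31 f \<in> tangent_vectors mink_frame_bundle f"
  proof (rule I)
    let ?\<gamma> = "\<lambda>t. (p, cosh t *\<^sub>R a + sinh t *\<^sub>R c, b, sinh t *\<^sub>R a + cosh t *\<^sub>R c)"
    show "?\<gamma> t \<in> mink_frame_bundle" for t
      by (simp add: mink_frame_bundle_def mink_frame_def mink_linear o algebra_simps ch)
    show "(?\<gamma> has_vector_derivative frame_gen S31 f) (at 0)"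
      unfolding has_vector_derivative_def
      by (auto intro!: derivative_eq_intros has_derivative_Pair simp: fe zero_prod_def fun_eq_iff)
  qed (simp add: fe)
  moreover have "frame_gen S32 f \<in> tangent_vectors mink_frame_bundle f"
  proof (rule I)
    let ?\<gamma> = "\<lambda>t. (p, a, cos t *\<^sub>R b + sin t *\<^sub>R c, cos t *\<^sub>R c - sin t *\<^sub>R b)"
    show "?\<gamma> t \<in> mink_frame_bundle" for t
      by (simp add: mink_frame_bundle_def mink_frame_def mink_linear o algebra_simps cs)
    show "(?\<gamma> has_vector_derivative frame_gen S32 f) (at 0)"
      unfolding has_vector_derivative_def
      by (auto intro!: derivative_eq_intros has_derivative_Pair simp: fe zero_prod_def fun_eq_iff)
  qed (simp add: fe)
  moreover have "frame_gen H1 f = (0, 0, 0, 0)" by (simp add: zero_prod_def)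
  ultimately show ?thesis using T[of 0] T[of a] T[of b] T[of c] by (cases i) (simp_all add: fe zero_prod_def)
qed

text \<open>The bracket table of the Lie algebra of isometries of Minkowski space: a triple (i, j,
  l) records [i, j] = l. The antisymmetric partners are supplied by
  \<open>struct_const\<close>.\<close>

definition frame_brackets :: "(idx \<times> idx \<times> idx) set" where
  "frame_brackets = {(S12, R2, R1), (S31, R3, R1), (S12, R1, R2), (R3, S32, R2), (S31, R1, R3), (S32, R2, R3),
    (S31, S32, S12), (S32, S12, S31), (S31, S12, S32)}"

definition struct_const :: "idx \<Rightarrow> idx \<Rightarrow> idx \<Rightarrow> real" where
  "struct_const i j l = (if (i, j, l) \<in> frame_brackets then 1 else if (j, i, l) \<in> frame_brackets then -1 else 0)"

text \<open>The fields are linear in the frame, so each is its own derivative, and the left side is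
  the Lie bracket of the fields \<open>i\<close> and \<open>j\<close>.\<close>

lemma frame_gen_bracket: "frame_gen j (frame_gen i f) - frame_gen i (frame_gen j f) = (\<Sum>l\<in>UNIV. struct_const i j l *\<^sub>R frame_gen l f)"
  unfolding sum_idx struct_const_def frame_brackets_def by (cases i; cases j; simp add: zero_prod_def)

lemma struct_const_sum:
  fixes a b :: "idx \<Rightarrow> 'k::real_normed_field"
  defines "w \<equiv> \<lambda>i j. a i * b j - a j * b i"
  shows "(\<Sum>i\<in>UNIV. \<Sum>j\<in>UNIV. a i * b j * of_real (struct_const i j l)) = (case l of
      H1 \<Rightarrow> 0 | H2 \<Rightarrow> 0
    | R1 \<Rightarrow> w S12 R2 + w S31 R3 | R2 \<Rightarrow> w S12 R1 + w R3 S32 | R3 \<Rightarrow> w S31 R1 + w S32 R2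
    | S12 \<Rightarrow> w S31 S32 | S31 \<Rightarrow> w S32 S12 | S32 \<Rightarrow> w S31 S12)"
  unfolding sum_idx struct_const_def frame_brackets_def w_def by (cases l; simp add: algebra_simps)

subsection \<open>The distribution annihilated by a Frobenius subbundle of a singular system\<close>

text \<open>Transverse Frobenius data for one singular system: a neighbourhood \<open>B\<close> and
  a frame \<open>F\<close> of the subbundle. Leaving the scalar field and \<open>lam\<close>
  abstract lets the real and the complex system share one proof.\<close>

locale darboux_patch = surface_patch +
  fixes B :: "(frame2 \<times> frame3) set"
    and F :: "(frame2 \<times> frame3 \<Rightarrow> frame2 \<times> frame3 \<Rightarrow> 'k::real_normed_field) list"
    and lam :: 'k and k :: "real^2 \<Rightarrow> real"
  assumes B: "open B"
    and frob: "frobenius_frame (frame_bundle C h \<times> mink_frame_bundle) B F"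
    and F_sub: "\<And>y. y \<in> (frame_bundle C h \<times> mink_frame_bundle) \<inter> B \<Longrightarrow>
      covector_span (tangent_vectors (frame_bundle C h \<times> mink_frame_bundle) y) (forms_at F y)
      \<subseteq> covector_span (tangent_vectors (frame_bundle C h \<times> mink_frame_bundle) y)
          (forms_at (singular_system h om k lam) y)"
    and F_transverse: "\<And>y a X. y \<in> (frame_bundle C h \<times> mink_frame_bundle) \<inter> B \<Longrightarrow>
      a \<in> covector_span (tangent_vectors (frame_bundle C h \<times> mink_frame_bundle) y) (forms_at F y) \<Longrightarrow>
      a \<in> covector_span (tangent_vectors (frame_bundle C h \<times> mink_frame_bundle) y)
          (forms_at (map scalar_ext (theta_forms h om)) y) \<Longrightarrow>
      X \<in> tangent_vectors (frame_bundle C h \<times> mink_frame_bundle) y \<Longrightarrow> a X = 0"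
    and F_rank: "2 \<le> length F"
begin

definition Phi :: "(real^2) \<times> frame3 \<Rightarrow> frame2 \<times> frame3" where
  "Phi z = (sec (fst z), snd z)"

definition U :: "((real^2) \<times> frame3) set" where
  "U = (D \<times> UNIV) \<inter> Phi -` B"

definition E :: "idx \<Rightarrow> (real^2) \<times> frame3 \<Rightarrow> (real^2) \<times> frame3" where
  "E i z = (case i of H1 \<Rightarrow> e1 (fst z) | H2 \<Rightarrow> e2 (fst z) | _ \<Rightarrow> 0, frame_gen i (snd z))"

definition p where
  "p \<psi> i z = \<psi> (Phi z) (FD Phi z (E i z))"

text \<open>The field with coefficients \<open>y\<close> in the frame \<open>E\<close> is annihilated by \<open>F\<close>. The coefficients may be
  complex; they depend on the surface point only.\<close>

definition killed :: "(idx \<Rightarrow> real^2 \<Rightarrow> 'k) \<Rightarrow> bool" where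
  "killed y \<longleftrightarrow> (\<forall>\<psi>\<in>set F. \<forall>z\<in>D \<times> mink_frame_bundle. z \<in> U \<longrightarrow> (\<Sum>i\<in>UNIV. y i (fst z) * p \<psi> i z) = 0)"

lemma Phi_smooth: "smooth_on (D \<times> UNIV) Phi"
  unfolding Phi_def[abs_def]
  using D by (intro smooth_on_Pair smooth_on_compose[OF _ D _ sec_smooth, of "D \<times> UNIV"]
      smooth_on_bounded_linear[OF smooth_on_ident _ bounded_linear_fst]
      smooth_on_bounded_linear[OF smooth_on_ident _ bounded_linear_snd])
    (auto intro: open_Times)

lemma U_open: "open U"
  unfolding U_def
  by (rule continuous_open_preimage[OF smooth_on_continuous_on[OF Phi_smooth] _ B])
    (auto intro: open_Times D)

lemma U_D: "z \<in> U \<Longrightarrow> fst z \<in> D"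
  by (auto simp: U_def)

lemma frechet_Phi:
  assumes "fst z \<in> D"
  shows "FD Phi z v = (dsec (fst z) (fst v), snd v)"
proof -
  have "(Phi has_derivative (\<lambda>v. (dsec (fst z) (fst v), snd v))) (at z)"
    unfolding Phi_def[abs_def]
    by (intro has_derivative_Pair has_derivative_snd has_derivative_ident
        has_derivative_compose[OF has_derivative_fst[OF has_derivative_ident]]
        smooth_on_has_derivative[OF sec_smooth D] assms)
  from frechet_derivative_eqI[OF this] show ?thesis by simp
qed

lemma Phi_bundle: "z \<in> D \<times> mink_frame_bundle \<Longrightarrow> Phi z \<in> frame_bundle C h \<times> mink_frame_bundle"
  using sec_bundle by (auto simp: Phi_def)

lemma E_tangent:
  assumes "z \<in> D \<times> mink_frame_bundle"
  shows "E i z \<in> tangent_vectors (D \<times> mink_frame_bundle) z"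
proof -
  obtain x f where z: "z = (x, f)" "x \<in> D" "f \<in> mink_frame_bundle" using assms by auto
  have H: "(v, 0) \<in> tangent_vectors (D \<times> mink_frame_bundle) z" for v
    unfolding z(1)
    by (rule tangent_vectors_image[OF tangent_vectors_open[OF D z(2)] _ D z(2),
          where \<sigma> = "\<lambda>x. (x, f)" and d\<sigma> = "\<lambda>v. (v, 0)"])
      (auto intro!: derivative_eq_intros has_derivative_Pair z)
  have V: "(0, frame_gen i f) \<in> tangent_vectors (D \<times> mink_frame_bundle) z"
    unfolding z(1)
    by (rule tangent_vectors_image[OF frame_gen_tangent[OF z(3)] _ open_UNIV UNIV_I,
          where \<sigma> = "\<lambda>f. (x, f)" and d\<sigma> = "\<lambda>v. (0, v)"])
      (auto intro!: derivative_eq_intros has_derivative_Pair z)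
  show ?thesis using H V by (cases i) (auto simp: E_def z(1))
qed

lemma PhiE_tangent:
  assumes "z \<in> D \<times> mink_frame_bundle" "z \<in> U"
  shows "FD Phi z (E i z) \<in> tangent_vectors (frame_bundle C h \<times> mink_frame_bundle) (Phi z)"
proof (rule tangent_vectors_image[OF E_tangent[OF assms(1)] smooth_on_has_derivative[OF Phi_smooth]])
  show "open (D \<times> (UNIV :: frame3 set))" by (rule open_Times[OF D open_UNIV])
  then show "open (D \<times> (UNIV :: frame3 set))" .
  show "z \<in> D \<times> UNIV" using assms(1) by auto
  then show "z \<in> D \<times> UNIV" .
qed (rule Phi_bundle)

definition dE :: "idx \<Rightarrow> (real^2) \<times> frame3 \<Rightarrow> (real^2) \<times> frame3 \<Rightarrow> (real^2) \<times> frame3" where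
  "dE i z v = (case i of H1 \<Rightarrow> FD e1 (fst z) (fst v)
     | H2 \<Rightarrow> FD e2 (fst z) (fst v) | _ \<Rightarrow> 0, frame_gen i (snd v))"

lemma has_derivative_E:
  assumes "fst z \<in> D"
  shows "(E i has_derivative dE i z) (at z)"
proof -
  have g: "((\<lambda>z. frame_gen i (snd z)) has_derivative (\<lambda>v. frame_gen i (snd v))) (at z)"
    by (rule bounded_linear.has_derivative[OF linear_frame_gen[unfolded linear_conv_bounded_linear]
        has_derivative_snd[OF has_derivative_ident]])
  have e: "((\<lambda>z. e1 (fst z)) has_derivative (\<lambda>v. FD e1 (fst z) (fst v))) (at z)"
    "((\<lambda>z. e2 (fst z)) has_derivative (\<lambda>v. FD e2 (fst z) (fst v))) (at z)"
    by (rule has_derivative_compose[OF has_derivative_fst[OF has_derivative_ident]] has_derivative_e[OF assms])+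
  show ?thesis
    unfolding E_def[abs_def] dE_def[abs_def]
    by (rule has_derivative_Pair[OF _ g]) (cases i; simp add: e)
qed

text \<open>Structure functions of the surface framing as given by \<open>frame_commutator\<close>.
  Mixed brackets of surface and Minkowski fields vanish.\<close>

definition hc :: "idx \<Rightarrow> idx \<Rightarrow> idx \<Rightarrow> real^2 \<Rightarrow> real" where
  "hc i j l x = (if (i, j, l) = (H1, H2, H1) then G1 x else if (i, j, l) = (H1, H2, H2) then - G2 x
     else if (i, j, l) = (H2, H1, H1) then - G1 x else if (i, j, l) = (H2, H1, H2) then G2 x else 0)"

lemma E_bracket:
  assumes z: "fst z \<in> D"
  shows "dE j z (E i z) - dE i z (E j z) = (\<Sum>l\<in>UNIV. (struct_const i j l + hc i j l (fst z)) *\<^sub>R E l z)"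
proof -
  note l = linear_frechet_derivative[OF smooth_on_differentiable[OF e1_smooth D z]]
    linear_frechet_derivative[OF smooth_on_differentiable[OF e2_smooth D z]]
  have "snd (dE j z (E i z) - dE i z (E j z)) = frame_gen j (frame_gen i (snd z)) - frame_gen i (frame_gen j (snd z))"
    by (simp add: dE_def E_def)
  also have "\<dots> = snd (\<Sum>l\<in>UNIV. (struct_const i j l + hc i j l (fst z)) *\<^sub>R E l z)"
    unfolding frame_gen_bracket by (simp add: snd_sum E_def scaleR_add_left sum.distrib) (simp add: sum_idx hc_def zero_prod_def)
  finally have 1: "snd (dE j z (E i z) - dE i z (E j z)) = snd (\<Sum>l\<in>UNIV. (struct_const i j l + hc i j l (fst z)) *\<^sub>R E l z)" .
  have "fst (dE j z (E i z) - dE i z (E j z)) = fst (\<Sum>l\<in>UNIV. (struct_const i j l + hc i j l (fst z)) *\<^sub>R E l z)"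
    using frame_commutator[OF z]
    by (cases i; cases j) (simp_all add: sum_idx dE_def E_def hc_def struct_const_def frame_brackets_def
        linear_0[OF l(1)] linear_0[OF l(2)], simp_all add: algebra_simps)
  with 1 show ?thesis by (simp add: prod_eq_iff)
qed

text \<open>The coefficients of the Lie bracket of the fields with coefficients \<open>y\<close> and \<open>y'\<close>.\<close>

definition brk :: "(idx \<Rightarrow> real^2 \<Rightarrow> 'k) \<Rightarrow> (idx \<Rightarrow> real^2 \<Rightarrow> 'k) \<Rightarrow> idx \<Rightarrow> real^2 \<Rightarrow> 'k" where
  "brk y y' l x =
    (let w = (\<lambda>i j. y i x * y' j x - y j x * y' i x) in
     y H1 x * d1 (y' l) x + y H2 x * d2 (y' l) x - y' H1 x * d1 (y l) x - y' H2 x * d2 (y l) x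
     + (case l of H1 \<Rightarrow> of_real (G1 x) * w H1 H2 | H2 \<Rightarrow> - of_real (G2 x) * w H1 H2
    | R1 \<Rightarrow> w S12 R2 + w S31 R3 | R2 \<Rightarrow> w S12 R1 + w R3 S32 | R3 \<Rightarrow> w S31 R1 + w S32 R2
    | S12 \<Rightarrow> w S31 S32 | S31 \<Rightarrow> w S32 S12 | S32 \<Rightarrow> w S31 S12))"

text \<open>This is \<open>frobenius_bracket\<close> for the frame \<open>E\<close>. The
  coefficients are constant along the Minkowski fields, so only the derivatives along e1 and e2
  survive.\<close>

lemma killed_brk:
  assumes y: "\<And>i x. x \<in> D \<Longrightarrow> y i differentiable (at x)" and y': "\<And>i x. x \<in> D \<Longrightarrow> y' i differentiable (at x)"
    and k: "killed y" "killed y'"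
  shows "killed (brk y y')"
  unfolding killed_def
proof (intro ballI impI)
  fix \<psi> z assume \<psi>: "\<psi> \<in> set F" and z: "z \<in> D \<times> mink_frame_bundle" "z \<in> U"
  define dy where "dy y i z v = FD (y i) (fst z) (fst v)"
    for y :: "idx \<Rightarrow> real^2 \<Rightarrow> 'k" and i and z v :: "(real^2) \<times> frame3"
  have dy: "((\<lambda>z. y i (fst z)) has_derivative dy y i z) (at z)"
    if "\<And>i x. x \<in> D \<Longrightarrow> y i differentiable (at x)" "z \<in> U" for y :: "idx \<Rightarrow> real^2 \<Rightarrow> 'k" and i z
    unfolding dy_def[abs_def]
    by (intro has_derivative_compose[OF has_derivative_fst[OF has_derivative_ident]]
        has_frechet_derivative that(1) U_D that(2))
  have S: "smooth_on U Phi" by (rule smooth_on_subset[OF Phi_smooth]) (auto simp: U_def)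
  have "(\<Sum>l\<in>UNIV. ((\<Sum>i\<in>UNIV. y i (fst z) * dy y' l z (E i z) - y' i (fst z) * dy y l z (E i z))
      + (\<Sum>i\<in>UNIV. \<Sum>j\<in>UNIV. y i (fst z) * y' j (fst z) * of_real (struct_const i j l + hc i j l (fst z)))) * p \<psi> l z) = 0"
    unfolding p_def
  proof (rule frobenius_bracket[where Y = "\<lambda>i z. y i (fst z)" and Y' = "\<lambda>i z. y' i (fst z)"
        and M = "D \<times> mink_frame_bundle" and dY = "dy y" and dY' = "dy y'" and E = E and dE = dE
        and c = "\<lambda>i j l z. struct_const i j l + hc i j l (fst z)", OF B frob U_open S])
    show "Phi z \<in> B" if "z \<in> U" for z using that by (simp add: U_def)
    show "(\<Sum>i\<in>UNIV. y i (fst z) * \<psi> (Phi z) (FD Phi z (E i z))) = 0"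
      "(\<Sum>i\<in>UNIV. y' i (fst z) * \<psi> (Phi z) (FD Phi z (E i z))) = 0"
      if "\<psi> \<in> set F" "z \<in> D \<times> mink_frame_bundle" "z \<in> U" for \<psi> z
      using k that unfolding killed_def p_def by blast+
    show "Phi z \<in> frame_bundle C h \<times> mink_frame_bundle" if "z \<in> D \<times> mink_frame_bundle" for z
      using that by (rule Phi_bundle)
    show "E i z \<in> tangent_vectors (D \<times> mink_frame_bundle) z" if "z \<in> D \<times> mink_frame_bundle" for i z
      using that by (rule E_tangent)
    show "(E i has_derivative dE i z) (at z)"
      and "dE j z (E i z) - dE i z (E j z) = (\<Sum>l\<in>UNIV. (struct_const i j l + hc i j l (fst z)) *\<^sub>R E l z)"
      and "((\<lambda>z. y i (fst z)) has_derivative dy y i z) (at z)"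
      and "((\<lambda>z. y' i (fst z)) has_derivative dy y' i z) (at z)" if "z \<in> U" for i j z
      using that y y' by (auto intro: has_derivative_E E_bracket dy U_D)
  qed (fact \<psi> z)+
  moreover have "(\<Sum>i\<in>UNIV. y i (fst z) * dy y' l z (E i z) - y' i (fst z) * dy y l z (E i z))
      + (\<Sum>i\<in>UNIV. \<Sum>j\<in>UNIV. y i (fst z) * y' j (fst z) * of_real (struct_const i j l + hc i j l (fst z)))
      = brk y y' l (fst z)" for l
  proof -
    have l0: "FD (y i) (fst z) 0 = 0" "FD (y' i) (fst z) 0 = 0" for i
      using y[OF U_D[OF z(2)]] y'[OF U_D[OF z(2)]] by (auto intro: linear_0 linear_frechet_derivative)
    have "(\<Sum>i\<in>UNIV. \<Sum>j\<in>UNIV. y i (fst z) * y' j (fst z) * of_real (hc i j l (fst z)))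
      = (y H1 (fst z) * y' H2 (fst z) - y H2 (fst z) * y' H1 (fst z)) *
        (case l of H1 \<Rightarrow> of_real (G1 (fst z)) | H2 \<Rightarrow> - of_real (G2 (fst z)) | _ \<Rightarrow> 0)"
      unfolding sum_idx hc_def by (cases l) (simp_all add: algebra_simps)
    then show ?thesis
      unfolding of_real_add distrib_left sum.distrib struct_const_sum
      by (cases l) (simp_all add: sum_idx brk_def dy_def E_def l0 d1_def d2_def)
  qed
  ultimately show "(\<Sum>i\<in>UNIV. brk y y' i (fst z) * p \<psi> i z) = 0" by simp
qed

lemma killed_cong: "(\<And>i x. x \<in> D \<Longrightarrow> y i x = y' i x) \<Longrightarrow> killed y \<Longrightarrow> killed y'"
  unfolding killed_def using U_D by (metis (no_types, lifting) sum.cong)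

lemma killed_add: "killed y \<Longrightarrow> killed y' \<Longrightarrow> killed (\<lambda>i x. y i x + y' i x)"
  unfolding killed_def by (simp add: distrib_right sum.distrib)

lemma killed_mult: "killed y \<Longrightarrow> killed (\<lambda>i x. a x * y i x)"
  unfolding killed_def by (simp add: mult.assoc sum_distrib_left[symmetric])

end

subsection \<open>The Hessian determined by Darboux integrability\<close>

lemma two_mult_cancel: "2 * (x :: 'k::field_char_0) = 0 \<Longrightarrow> x = 0"
  by simp

text \<open>Here \<open>a\<close> and \<open>b\<close> are the coefficients of \<open>omega_12\<close> in the two generators of the Frobenius subbundle.
  The branch \<open>t \<noteq> 0\<close> of the proof would determine both by \<open>a * mu = - M1\<close>, \<open>b * mu = - M2\<close>; it is
  excluded by the last two equations.\<close>

lemma hessian_algebra: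
  fixes mu :: "'k::field_char_0"
  assumes mu: "mu \<noteq> 0"
    and A: "P1 + a * M2 = 0" and A': "P1 + b * M1 = 0"
    and BB: "P2 * Q1 - P1 * P1 + mu * (P2 + Q1) + M1 * M1 - M2 * M2 + 2 * mu * a * M1 = 0"
    and CC: "mu * (P2 + Q1) + M2 * M2 - M1 * M1 - P2 * Q1 + P1 * P1 + 2 * mu * b * M2 = 0"
    and EE: "2 * P1 * M2 - 2 * P2 * M1 + a * (P2 * Q1 - P1 * P1 + mu * (Q1 - P2) + M2 * M2 - M1 * M1) = 0"
    and FF: "2 * Q1 * M2 - 2 * P1 * M1 + b * (P2 * Q1 - P1 * P1 + mu * (Q1 - P2) + M2 * M2 - M1 * M1) = 0"
    and I: "b * (P2 + mu) - a * P1 = - M2" and I': "a * (mu - Q1) + b * P1 = - M1"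
  shows "mu * P1 = M1 * M2 \<and> mu * P2 = M1 * M1 \<and> mu * Q1 = M2 * M2"
proof -
  have P1: "P1 = - a * M2" "P1 = - b * M1" using A A' by (simp_all add: eq_neg_iff_add_eq_0)
  then have ab: "a * M2 = b * M1" by simp
  \<comment> \<open>\<open>t\<close> measures how far the symmetric matrix with entries P2, P1, Q1
    is from minus the product of the column (a, b) and the row (M1, M2). Its off-diagonal entries
    have that form by \<open>A\<close> and \<open>A'\<close>.\<close>
  define t where "t = P2 + a * M1"
  \<comment> \<open>The sum of \<open>BB\<close> and \<open>CC\<close> is free of the determinant P2
    Q1 - P1 P1; their difference, used for \<open>D\<close>, isolates it.\<close>
  have "2 * mu * (P2 + Q1 + a * M1 + b * M2) = 0" using BB CC by algebra
  then have tr: "P2 + Q1 + a * M1 + b * M2 = 0" using mu by simp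
  have P2: "P2 = t - a * M1" and Q1: "Q1 = - t - b * M2" using tr by (auto simp: t_def algebra_simps eq_neg_iff_add_eq_0)
  have D: "P2 * Q1 - P1 * P1 + M1 * M1 - M2 * M2 + mu * (a * M1 - b * M2) = 0"
  proof -
    have "2 * (P2 * Q1 - P1 * P1 + M1 * M1 - M2 * M2 + mu * (a * M1 - b * M2)) = 0"
      using BB CC by algebra
    then show ?thesis by (rule two_mult_cancel)
  qed
  have pp: "P1 * P1 = a * M1 * (b * M2)" using P1 by algebra
  have D': "t * (a * M1 - b * M2 - t) + M1 * M1 - M2 * M2 + mu * (a * M1 - b * M2) = 0"
    using D pp P2 Q1 by algebra
  have E': "t * (M1 + a * mu) = 0"
  proof -
    have "2 * (t * (M1 + a * mu)) = 0" using EE D P1 P2 Q1 by algebra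
    then show ?thesis by (rule two_mult_cancel)
  qed
  have F': "t * (M2 + b * mu) = 0"
  proof -
    have "2 * (t * (M2 + b * mu)) = 0" using FF D P1 P2 Q1 by algebra
    then show ?thesis by (rule two_mult_cancel)
  qed
  have t0: "t = 0"
  proof (rule ccontr)
    assume t: "t \<noteq> 0"
    then have am: "M1 = - (a * mu)" and bm: "M2 = - (b * mu)" using E' F' by (auto simp: eq_neg_iff_add_eq_0)
    have "t * (a * M1 - b * M2 - t) = 0" using D' am bm by algebra
    \<comment> \<open>In this branch the diagonal entries are exchanged: P2 = - b M2 and Q1 = - a
      M1. Inserting them into \<open>I\<close> and \<open>I'\<close> forces t back to 0.\<close>
    then have tt: "t = a * M1 - b * M2" using t by simp
    have "mu * (b * (a * a - b * b)) = 0" using I P1 P2 tt am bm by algebra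
    moreover have "mu * (a * (a * a - b * b)) = 0" using I' P1 Q1 tt am bm by algebra
    ultimately have "b * (a * a - b * b) = 0" "a * (a * a - b * b) = 0" using mu by simp_all
    then have "a * a - b * b = 0 \<or> a = 0 \<and> b = 0" by auto
    then have "t = 0" using tt am bm by algebra
    then show False using t by simp
  qed
  \<comment> \<open>With t = 0 the matrix has rank at most one, the products in \<open>I\<close> and
    \<open>I'\<close> cancel, and a and b are determined.\<close>
  have bm: "b * mu = - M2" using I P1 P2 t0 by algebra
  have am: "a * mu = - M1" using I' P1 Q1 t0 by algebra
  show ?thesis using am bm P1 P2 Q1 t0 by algebra
qed

text \<open>The elliptic case is \<open>lam = \<i>\<close>, the hyperbolic case \<open>lam = 1\<close>; in both, the square of
  \<open>mu\<close> below is \<open>-kap\<close>, and no further case distinction is needed.\<close>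

locale darboux_system = darboux_patch +
  assumes k_pos: "\<And>x. x \<in> D \<Longrightarrow> k x > 0" and k_smooth: "smooth_on D k"
    and lam_sq: "\<And>x. x \<in> D \<Longrightarrow> lam * lam * of_real (k x * k x) = - of_real (kap x)"
    and lam_nz: "lam \<noteq> 0"
begin

definition m1 where "m1 = d1 (\<lambda>x. ln (k x) / 2)"
definition m2 where "m2 = d2 (\<lambda>x. ln (k x) / 2)"
definition mu :: "real^2 \<Rightarrow> 'a" where "mu x = lam * of_real (k x)"

lemma u_smooth: "smooth_on D (\<lambda>x. ln (k x) / 2)"
  by (intro smooth_on_divide smooth_on_ln k_smooth k_pos smooth_on_const D) auto

lemma m_smooth: "smooth_on D m1" "smooth_on D m2"
  unfolding m1_def m2_def by (intro smooth_d1 smooth_d2 u_smooth)+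

lemma mu_nz: "x \<in> D \<Longrightarrow> mu x \<noteq> 0"
  using k_pos lam_nz by (fastforce simp: mu_def)

lemma mu_sq: "x \<in> D \<Longrightarrow> mu x * mu x = - of_real (kap x)"
  using lam_sq[of x] by (simp add: mu_def ac_simps)

lemma smooth_of_real: "smooth_on D f \<Longrightarrow> smooth_on D (\<lambda>x. of_real (f x) :: 'a)"
  by (rule smooth_on_bounded_linear[OF _ D bounded_linear_of_real])

lemma mu_smooth: "smooth_on D mu"
  unfolding mu_def[abs_def] by (intro smooth_on_mult D smooth_on_const smooth_of_real k_smooth)

lemma d_const: "d1 (\<lambda>x. c) x = 0" "d2 (\<lambda>x. c) x = 0"
  by (simp_all add: d1_def d2_def)

lemma d_minus:
  assumes "x \<in> D" "smooth_on D f"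
  shows "d1 (\<lambda>x. - f x) x = - d1 f x" "d2 (\<lambda>x. - f x) x = - d2 f x"
  using frechet_derivative_eqI[OF has_derivative_minus[OF smooth_on_has_derivative[OF assms(2) D assms(1)]]]
  by (simp_all add: d1_def d2_def)

lemma d_of_real:
  assumes "x \<in> D" "smooth_on D f"
  shows "d1 (\<lambda>x. of_real (f x) :: 'a) x = of_real (d1 f x)" "d2 (\<lambda>x. of_real (f x) :: 'a) x = of_real (d2 f x)"
  using frechet_derivative_eqI[OF bounded_linear.has_derivative[OF bounded_linear_of_real[where 'a = 'a]
      smooth_on_has_derivative[OF assms(2) D assms(1)]]]
  by (simp_all add: d1_def d2_def)

lemma d_k:
  assumes x: "x \<in> D"
  shows "d1 k x = 2 * m1 x * k x" "d2 k x = 2 * m2 x * k x"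
proof -
  have "((\<lambda>x. ln (k x) / 2) has_derivative (\<lambda>v. FD k x v * inverse (k x) / 2)) (at x)"
    using has_derivative_ln[OF k_pos[OF x] smooth_on_has_derivative[OF k_smooth D x]]
    by (intro bounded_linear.has_derivative[OF bounded_linear_divide]) simp
  from frechet_derivative_eqI[OF this] show "d1 k x = 2 * m1 x * k x" "d2 k x = 2 * m2 x * k x"
    using k_pos[OF x] by (simp_all add: m1_def m2_def d1_def d2_def)
qed

lemma d_mu:
  assumes x: "x \<in> D"
  shows "d1 mu x = 2 * of_real (m1 x) * mu x" "d2 mu x = 2 * of_real (m2 x) * mu x"
proof -
  have "(mu has_derivative (\<lambda>v. lam * of_real (FD k x v))) (at x)"
    unfolding mu_def[abs_def]
    by (intro has_derivative_mult_right bounded_linear.has_derivative[OF bounded_linear_of_real]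
        smooth_on_has_derivative[OF k_smooth D x])
  from frechet_derivative_eqI[OF this] show "d1 mu x = 2 * of_real (m1 x) * mu x" "d2 mu x = 2 * of_real (m2 x) * mu x"
    using d_k[OF x] by (simp_all add: d1_def d2_def mu_def)
qed

text \<open>\<open>P2\<close>, \<open>P1\<close>, \<open>Q1\<close> are the components 11, 12, 22 of
  (m_ij - m_i m_j - mu^2 g_ij) / (2 mu), with m_ij the covariant Hessian of (ln k) / 2. They are the
  rotation coefficients of [X1, Z0] and [X2, Z0], after removal of the multiple of
  \<open>Z0\<close>; dividing by 2 mu makes the translation coefficients equal to 1.\<close>

definition P2 :: "real^2 \<Rightarrow> 'a" where
  "P2 x = (of_real (d1 m1 x - G1 x * m2 x - m1 x * m1 x) - mu x * mu x) / (2 * mu x)"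
definition P1 :: "real^2 \<Rightarrow> 'a" where
  "P1 x = of_real (d2 m1 x - G2 x * m2 x - m1 x * m2 x) / (2 * mu x)"
definition Q1 :: "real^2 \<Rightarrow> 'a" where
  "Q1 x = (of_real (d2 m2 x - G2 x * m1 x - m2 x * m2 x) + mu x * mu x) / (2 * mu x)"

lemma PQ_smooth: "smooth_on D P1" "smooth_on D P2" "smooth_on D Q1"
  unfolding P1_def[abs_def] P2_def[abs_def] Q1_def[abs_def]
  by (intro smooth_on_divide smooth_of_real smooth_on_add smooth_on_diff smooth_on_mult smooth_on_const D
      smooth_d1 smooth_d2 m_smooth mu_smooth G1_smooth G2_smooth; simp add: mu_nz)+

lemma d_m:
  assumes x: "x \<in> D"
  shows "of_real (d1 m1 x) = 2 * mu x * P2 x + of_real (m1 x) * of_real (m1 x) + mu x * mu x + of_real (G1 x) * of_real (m2 x)"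
    "of_real (d2 m1 x) = 2 * mu x * P1 x + of_real (m1 x) * of_real (m2 x) + of_real (G2 x) * of_real (m2 x)"
    "of_real (d1 m2 x) = 2 * mu x * P1 x + of_real (m1 x) * of_real (m2 x) + of_real (G1 x) * of_real (m1 x)"
    "of_real (d2 m2 x) = 2 * mu x * Q1 x + of_real (m2 x) * of_real (m2 x) - mu x * mu x + of_real (G2 x) * of_real (m1 x)"
proof -
  have "d1 m2 x = d2 m1 x + G1 x * m1 x - G2 x * m2 x"
    using derivative_commutator[OF x u_smooth] by (simp add: m1_def m2_def)
  then show "of_real (d1 m2 x) = 2 * mu x * P1 x + of_real (m1 x) * of_real (m2 x) + of_real (G1 x) * of_real (m1 x)"
    using mu_nz[OF x] by (simp add: P1_def)
qed (use mu_nz[OF x] in \<open>simp_all add: P1_def P2_def Q1_def\<close>)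

lemma gauss_mu:
  assumes x: "x \<in> D"
  shows "of_real (d1 G2 x) = of_real (d2 G1 x) + of_real (G1 x) * of_real (G1 x)
    - of_real (G2 x) * of_real (G2 x) + mu x * mu x"
proof -
  have "d1 G2 x = d2 G1 x + G1 x * G1 x - G2 x * G2 x - kap x"
    using gauss_equation[OF x] by (simp add: power2_eq_square)
  then show ?thesis using mu_sq[OF x] by simp
qed

text \<open>\<open>X1\<close> and \<open>X2\<close> are the lifts of the framing that the singular system annihilates; modulo the
  fields before them, \<open>Z0\<close>, \<open>Z1\<close>, \<open>Z2\<close> are multiples of $[X_1,X_2]$, $[X_2,Z_0]$, $[X_1,Z_0]$.\<close>

primrec X1 :: "idx \<Rightarrow> real^2 \<Rightarrow> 'a" where
  "X1 H1 = (\<lambda>x. 1)" | "X1 H2 = (\<lambda>x. 0)" | "X1 R1 = (\<lambda>x. 1)" | "X1 R2 = (\<lambda>x. 0)" | "X1 R3 = (\<lambda>x. 0)"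
| "X1 S12 = (\<lambda>x. of_real (G1 x))" | "X1 S31 = (\<lambda>x. 0)" | "X1 S32 = (\<lambda>x. - mu x)"

primrec X2 :: "idx \<Rightarrow> real^2 \<Rightarrow> 'a" where
  "X2 H1 = (\<lambda>x. 0)" | "X2 H2 = (\<lambda>x. 1)" | "X2 R1 = (\<lambda>x. 0)" | "X2 R2 = (\<lambda>x. 1)" | "X2 R3 = (\<lambda>x. 0)"
| "X2 S12 = (\<lambda>x. of_real (G2 x))" | "X2 S31 = mu" | "X2 S32 = (\<lambda>x. 0)"

primrec Z0 :: "idx \<Rightarrow> real^2 \<Rightarrow> 'a" where
  "Z0 H1 = (\<lambda>x. 0)" | "Z0 H2 = (\<lambda>x. 0)" | "Z0 R1 = (\<lambda>x. 0)" | "Z0 R2 = (\<lambda>x. 0)" | "Z0 R3 = (\<lambda>x. 1)"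
| "Z0 S12 = (\<lambda>x. - mu x)" | "Z0 S31 = (\<lambda>x. - of_real (m1 x))" | "Z0 S32 = (\<lambda>x. - of_real (m2 x))"

primrec Z1 :: "idx \<Rightarrow> real^2 \<Rightarrow> 'a" where
  "Z1 H1 = (\<lambda>x. 0)" | "Z1 H2 = (\<lambda>x. 0)" | "Z1 R1 = (\<lambda>x. 1)" | "Z1 R2 = (\<lambda>x. 0)" | "Z1 R3 = (\<lambda>x. 0)"
| "Z1 S12 = (\<lambda>x. - of_real (m2 x))" | "Z1 S31 = (\<lambda>x. - P1 x)" | "Z1 S32 = (\<lambda>x. - Q1 x)"

primrec Z2 :: "idx \<Rightarrow> real^2 \<Rightarrow> 'a" where
  "Z2 H1 = (\<lambda>x. 0)" | "Z2 H2 = (\<lambda>x. 0)" | "Z2 R1 = (\<lambda>x. 0)" | "Z2 R2 = (\<lambda>x. 1)" | "Z2 R3 = (\<lambda>x. 0)"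
| "Z2 S12 = (\<lambda>x. - of_real (m1 x))" | "Z2 S31 = (\<lambda>x. - P2 x)" | "Z2 S32 = (\<lambda>x. - P1 x)"

lemma XZ_differentiable:
  assumes "x \<in> D"
  shows "X1 i differentiable (at x)" "X2 i differentiable (at x)" "Z0 i differentiable (at x)"
    "Z1 i differentiable (at x)" "Z2 i differentiable (at x)"
  by (cases i; simp; intro differentiable_minus smooth_on_differentiable[OF _ D assms] smooth_of_real
      m_smooth mu_smooth G1_smooth G2_smooth PQ_smooth differentiable_const)+

lemmas d_simps = d_const d_minus d_of_real d_mu smooth_of_real m_smooth mu_smooth G1_smooth G2_smooth PQ_smooth

text \<open>In the \<open>S12\<close> component the curvature, through the Gauss equation, and the
  bracket of the two rotations each contribute mu^2. The derivatives of \<open>mu\<close> produce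
  the entries m1 and m2 of \<open>Z0\<close>.\<close>

lemma brk_X1_X2:
  assumes x: "x \<in> D"
  shows "brk X1 X2 l x = of_real (G1 x) * X1 l x - of_real (G2 x) * X2 l x - 2 * mu x * Z0 l x"
  by (cases l) (simp_all add: brk_def Let_def d_simps x gauss_mu algebra_simps)

lemma brk_X1_Z0:
  assumes x: "x \<in> D"
  shows "brk X1 Z0 l x = of_real (m1 x) * Z0 l x + 2 * mu x * Z2 l x"
  by (cases l) (simp_all add: brk_def Let_def d_simps x d_m algebra_simps)

lemma brk_X2_Z0:
  assumes x: "x \<in> D"
  shows "brk X2 Z0 l x = of_real (m2 x) * Z0 l x + 2 * mu x * Z1 l x"
  by (cases l) (simp_all add: brk_def Let_def d_simps x d_m algebra_simps)

section \<open>Values of the singular forms and normalisation by transversality\<close>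

definition singular_comb :: "(nat \<Rightarrow> 'a) \<Rightarrow> frame2 \<times> frame3 \<Rightarrow> frame2 \<times> frame3 \<Rightarrow> 'a" where
  "singular_comb c y X = c 0 * of_real (omega_3 (snd y) (snd X))
      + c 1 * of_real (omega_1 (snd y) (snd X) - eta1 h (fst y) (fst X))
      + c 2 * of_real (omega_2 (snd y) (snd X) - eta2 h (fst y) (fst X))
      + c 3 * of_real (omega_12 (snd y) (snd X) - om (fst y) (fst X))
      + c 4 * (of_real (omega_31 (snd y) (snd X)) - lam * of_real (k (fst (fst y)) * eta2 h (fst y) (fst X)))
      + c 5 * (of_real (omega_32 (snd y) (snd X)) + lam * of_real (k (fst (fst y)) * eta1 h (fst y) (fst X)))"

lemma singular_span:
  assumes "a \<in> covector_span T (forms_at (singular_system h om k lam) y)"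
  obtains c where "\<And>X. X \<in> T \<Longrightarrow> a X = singular_comb c y X"
  using assms unfolding covector_span_def singular_system_def theta_forms_def singular_comb_def
  by (auto simp: eval_nat_numeral scalar_ext_def)

lemma theta_spanI:
  assumes "\<And>X. X \<in> T \<Longrightarrow> a X = c 0 * of_real (omega_3 (snd y) (snd X))
      + c 1 * of_real (omega_1 (snd y) (snd X) - eta1 h (fst y) (fst X))
      + c 2 * of_real (omega_2 (snd y) (snd X) - eta2 h (fst y) (fst X))
      + c (3::nat) * of_real (omega_12 (snd y) (snd X) - om (fst y) (fst X))"
  shows "a \<in> covector_span T (forms_at (map scalar_ext (theta_forms h om)) y)"
  unfolding covector_span_def theta_forms_def
  by (intro CollectI exI[of _ c]) (use assms in \<open>simp add: eval_nat_numeral scalar_ext_def\<close>)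

abbreviation "N \<equiv> frame_bundle C h \<times> mink_frame_bundle"

lemma F_member:
  assumes y: "y \<in> N \<inter> B" and \<psi>: "\<psi> \<in> set F"
  shows "\<psi> y \<in> covector_span (tangent_vectors N y) (forms_at F y)"
proof -
  obtain n where n: "n < length F" "\<psi> = F ! n" using \<psi> by (metis in_set_conv_nth)
  have "(\<Sum>i<length (forms_at F y). (if i = n then 1 else 0) * (forms_at F y ! i) X) = \<psi> y X" for X
    using n by (simp add: if_distrib[of "\<lambda>c. c * _"] cong: if_cong)
  then show ?thesis unfolding covector_span_def by (intro CollectI exI) (auto simp: eq_commute)
qed

text \<open>The Minkowski fields of the frame are dual to the omega forms, so the values on them
  return the coefficients \<open>c\<close>. On the surface fields the eta forms and the connection
  coefficients enter.\<close>

lemma form_values: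
  assumes z: "z \<in> D \<times> mink_frame_bundle" "z \<in> U"
    and a: "\<And>X. X \<in> tangent_vectors N (Phi z) \<Longrightarrow> a X = singular_comb c (Phi z) X"
  shows "a (FD Phi z (E i z)) = (case i of
      H1 \<Rightarrow> - c 1 - of_real (G1 (fst z)) * c 3 + mu (fst z) * c 5
    | H2 \<Rightarrow> - c 2 - of_real (G2 (fst z)) * c 3 - mu (fst z) * c 4
    | R1 \<Rightarrow> c 1 | R2 \<Rightarrow> c 2 | R3 \<Rightarrow> c 0 | S12 \<Rightarrow> c 3 | S31 \<Rightarrow> c 4 | S32 \<Rightarrow> c 5)"
proof -
  obtain x q e1' e2' e3' where ze: "z = (x, q, e1', e2', e3')" by (cases z) auto
  have x: "x \<in> D" using z ze by simp
  have o: "mink e1' e1' = 1" "mink e2' e2' = -1" "mink e3' e3' = -1" "mink e1' e2' = 0" "mink e1' e3' = 0"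
    "mink e2' e3' = 0" "mink e2' e1' = 0" "mink e3' e1' = 0" "mink e3' e2' = 0"
    using z by (auto simp: ze mink_frame_bundle_def mink_frame_def mink_commute)
  have hz: "h x 0 v = 0" for v using h_lin(2)[OF x, of v] by (rule linear_0)
  have omz: "om (sec x) 0 = 0" using om_linear[of "sec x"] sec_C[OF x] by (auto intro: linear_0)
  have dz: "FD e1 x 0 = 0" "FD e2 x 0 = 0" "dsec x 0 = 0"
    by (auto intro!: linear_0 linear_frechet_derivative smooth_on_differentiable[OF _ D x] e1_smooth e2_smooth sec_smooth)
  have G: "om (sec x) (dsec x (e1 x)) = G1 x" "om (sec x) (dsec x (e2 x)) = G2 x"
    by (simp_all add: G1_def G2_def)
  have et: "eta1 h (sec x) (dsec x v) = h x v (e1 x)" "eta2 h (sec x) (dsec x v) = - h x v (e2 x)" for v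
    using x by (simp_all add: dsec sec_def)
  have fs: "fst (sec x) = x" by (simp add: sec_def)
  have Pz: "Phi (x, q, e1', e2', e3') = (sec x, q, e1', e2', e3')" by (simp add: Phi_def)
  have z0: "omega_1 (q, e1', e2', e3') 0 = 0" "omega_2 (q, e1', e2', e3') 0 = 0" "omega_3 (q, e1', e2', e3') 0 = 0"
    "omega_12 (q, e1', e2', e3') 0 = 0" "omega_31 (q, e1', e2', e3') 0 = 0" "omega_32 (q, e1', e2', e3') 0 = 0"
    "eta1 h (sec x) 0 = 0" "eta2 h (sec x) 0 = 0"
    by (simp_all add: zero_prod_def mink_linear) (simp_all add: eta_eq hz sec_def)
  show ?thesis
    unfolding a[OF PhiE_tangent[OF z]] singular_comb_def
    using x by (cases i) (simp_all add: Pz ze frechet_Phi E_def et G fs omz dz z0 o mink_linear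
       h11 h12 h21 h22 mu_def algebra_simps)
qed

text \<open>Whatever the coefficients \<open>c\<close> in \<open>form_values\<close>, they cancel in
  these two contractions.\<close>

lemma killed_X:
  shows "killed X1" "killed X2"
proof -
  have "(\<Sum>i\<in>UNIV. X1 i (fst z) * p \<psi> i z) = 0 \<and> (\<Sum>i\<in>UNIV. X2 i (fst z) * p \<psi> i z) = 0"
    if \<psi>: "\<psi> \<in> set F" and z: "z \<in> D \<times> mink_frame_bundle" "z \<in> U" for \<psi> z
  proof -
    have y: "Phi z \<in> N \<inter> B" using z Phi_bundle by (auto simp: U_def)
    obtain c where "\<And>X. X \<in> tangent_vectors N (Phi z) \<Longrightarrow> \<psi> (Phi z) X = singular_comb c (Phi z) X"
      using singular_span[OF subsetD[OF F_sub[OF y] F_member[OF y \<psi>]]] by metis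
    from form_values[where a = "\<psi> (Phi z)" and c = c, OF z this]
    show ?thesis unfolding p_def by (simp add: sum_idx algebra_simps)
  qed
  then show "killed X1" "killed X2" unfolding killed_def by blast+
qed

lemma killed_Z0: "killed Z0"
proof -
  have "killed (\<lambda>i x. inverse (2 * mu x) * ((of_real (G1 x) * X1 i x + (- of_real (G2 x)) * X2 i x) + (- 1) * brk X1 X2 i x))"
    by (intro killed_mult killed_add killed_X killed_brk XZ_differentiable)
  then show ?thesis
    by (rule killed_cong[rotated]) (simp add: brk_X1_X2 mu_nz field_simps)
qed

lemma killed_Z2: "killed Z2"
proof -
  have "killed (\<lambda>i x. inverse (2 * mu x) * (brk X1 Z0 i x + (- of_real (m1 x)) * Z0 i x))"
    by (intro killed_mult killed_add killed_X killed_Z0 killed_brk XZ_differentiable)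
  then show ?thesis
    by (rule killed_cong[rotated]) (simp add: brk_X1_Z0 mu_nz field_simps)
qed

lemma killed_Z1: "killed Z1"
proof -
  have "killed (\<lambda>i x. inverse (2 * mu x) * (brk X2 Z0 i x + (- of_real (m2 x)) * Z0 i x))"
    by (intro killed_mult killed_add killed_X killed_Z0 killed_brk XZ_differentiable)
  then show ?thesis
    by (rule killed_cong[rotated]) (simp add: brk_X2_Z0 mu_nz field_simps)
qed

lemma form_coefficients:
  assumes \<psi>: "\<psi> \<in> set F" and z: "z \<in> D \<times> mink_frame_bundle" "z \<in> U"
  obtains c where "\<And>X. X \<in> tangent_vectors N (Phi z) \<Longrightarrow> \<psi> (Phi z) X = singular_comb c (Phi z) X"
    "c 4 = p \<psi> S31 z" "c 5 = p \<psi> S32 z"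
proof -
  have y: "Phi z \<in> N \<inter> B" using z Phi_bundle by (auto simp: U_def)
  obtain c where c: "\<And>X. X \<in> tangent_vectors N (Phi z) \<Longrightarrow> \<psi> (Phi z) X = singular_comb c (Phi z) X"
    using singular_span[OF subsetD[OF F_sub[OF y] F_member[OF y \<psi>]]] by metis
  show thesis
    by (rule that[OF c]) (simp_all add: form_values[where a = "\<psi> (Phi z)" and c = c, OF z c] p_def)
qed

lemma degenerate_2x2:
  fixes a b c d :: "'x::field"
  assumes "a * d - b * c = 0"
  obtains u v where "u * a + v * c = 0" "u * b + v * d = 0" "u \<noteq> 0 \<or> v \<noteq> 0"
proof (cases "d = 0 \<and> b = 0")
  case True
  then show ?thesis using that[of c "-a"] that[of 1 0] by (cases "a = 0 \<and> c = 0") (auto simp: mult.commute)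
next
  case False
  then show ?thesis using that[of d "-b"] assms by (auto simp: algebra_simps)
qed

text \<open>A null vector of the matrix of \<open>omega_31\<close> and \<open>omega_32\<close>
  coefficients of two forms of \<open>F\<close> would give a combination in the span of the theta
  forms. Transversality makes that combination vanish and independence makes the null vector zero,
  so the matrix is invertible and can be normalised to the identity.\<close>

lemma dual_covectors:
  assumes z: "z \<in> D \<times> mink_frame_bundle" "z \<in> U"
  obtains pa pb :: "idx \<Rightarrow> 'a" where "pa S31 = 1" "pa S32 = 0" "pb S31 = 0" "pb S32 = 1"
    "\<forall>y. killed y \<longrightarrow> (\<Sum>i\<in>UNIV. y i (fst z) * pa i) = 0"
    "\<forall>y. killed y \<longrightarrow> (\<Sum>i\<in>UNIV. y i (fst z) * pb i) = 0"
proof -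
  let ?T = "tangent_vectors N (Phi z)"
  have y: "Phi z \<in> N \<inter> B" using z Phi_bundle by (auto simp: U_def)
  obtain f0 f1 Fs where F: "F = f0 # f1 # Fs"
    using F_rank by (metis One_nat_def Suc_1 Suc_le_length_iff)
  then have f01: "f0 \<in> set F" "f1 \<in> set F" by auto
  define det where "det = p f0 S31 z * p f1 S32 z - p f0 S32 z * p f1 S31 z"
  have "det \<noteq> 0"
  proof
    assume "det = 0"
    then obtain u v where uv: "u * p f0 S31 z + v * p f1 S31 z = 0" "u * p f0 S32 z + v * p f1 S32 z = 0"
      and uv0: "u \<noteq> 0 \<or> v \<noteq> 0" unfolding det_def by (rule degenerate_2x2)
    define a where "a X = u * f0 (Phi z) X + v * f1 (Phi z) X" for X
    define w :: "nat \<Rightarrow> 'a" where "w i = (if i = 0 then u else if i = 1 then v else 0)" for i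
    have aw: "a X = (\<Sum>i<length (forms_at F (Phi z)). w i * (forms_at F (Phi z) ! i) X)" for X
      unfolding F by (simp add: a_def w_def sum.lessThan_Suc_shift del: sum.lessThan_Suc)
    obtain c0 where c0: "\<And>X. X \<in> ?T \<Longrightarrow> f0 (Phi z) X = singular_comb c0 (Phi z) X"
      "c0 4 = p f0 S31 z" "c0 5 = p f0 S32 z"
      using form_coefficients[OF f01(1) z] by metis
    obtain c1 where c1: "\<And>X. X \<in> ?T \<Longrightarrow> f1 (Phi z) X = singular_comb c1 (Phi z) X"
      "c1 4 = p f1 S31 z" "c1 5 = p f1 S32 z"
      using form_coefficients[OF f01(2) z] by metis
    have cv: "v * p f1 S31 z = - (u * p f0 S31 z)" "v * p f1 S32 z = - (u * p f0 S32 z)"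
      using uv by (simp_all add: eq_neg_iff_add_eq_0 add.commute)
    have red: "u * (A + p f0 S31 z * Y + p f0 S32 z * Z) + v * (A' + p f1 S31 z * Y + p f1 S32 z * Z)
        = u * A + v * A'" for A A' Y Z
    proof -
      have "u * (A + p f0 S31 z * Y + p f0 S32 z * Z) + v * (A' + p f1 S31 z * Y + p f1 S32 z * Z)
        = u * A + v * A' + (u * p f0 S31 z + v * p f1 S31 z) * Y + (u * p f0 S32 z + v * p f1 S32 z) * Z"
        by (simp add: algebra_simps)
      then show ?thesis by (simp add: uv)
    qed
    have "a \<in> covector_span ?T (forms_at F (Phi z))"
      unfolding covector_span_def using aw by blast
    moreover have "a \<in> covector_span ?T (forms_at (map scalar_ext (theta_forms h om)) (Phi z))"
    proof (rule theta_spanI[where c = "\<lambda>i. u * c0 i + v * c1 i"])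
      fix X assume X: "X \<in> ?T"
      show "a X = (u * c0 0 + v * c1 0) * of_real (omega_3 (snd (Phi z)) (snd X))
      + (u * c0 1 + v * c1 1) * of_real (omega_1 (snd (Phi z)) (snd X) - eta1 h (fst (Phi z)) (fst X))
      + (u * c0 2 + v * c1 2) * of_real (omega_2 (snd (Phi z)) (snd X) - eta2 h (fst (Phi z)) (fst X))
      + (u * c0 3 + v * c1 3) * of_real (omega_12 (snd (Phi z)) (snd X) - om (fst (Phi z)) (fst X))"
        unfolding a_def c0(1)[OF X] c1(1)[OF X] singular_comb_def c0(2,3) c1(2,3) red by (simp add: distrib_left distrib_right mult.assoc)
    qed
    ultimately have "\<forall>X\<in>?T. a X = 0" using F_transverse[OF y] by blast
    then have "\<forall>X\<in>?T. (\<Sum>i<length (forms_at F (Phi z)). w i * (forms_at F (Phi z) ! i) X) = 0"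
      using aw by simp
    moreover have "covector_indep ?T (forms_at F (Phi z))"
      by (rule frob[unfolded frobenius_frame_def, THEN conjunct2, rule_format, OF y, THEN conjunct1])
    ultimately have "\<forall>i<length (forms_at F (Phi z)). w i = 0" unfolding covector_indep_def by blast
    then have "w 0 = 0" "w 1 = 0" by (auto simp: F)
    then show False using uv0 by (simp add: w_def)
  qed
  \<comment> \<open>Cramer's rule for the inverse of the coefficient matrix.\<close>
  define pa where "pa i = (p f1 S32 z * p f0 i z - p f0 S32 z * p f1 i z) / det" for i
  define pb where "pb i = (p f0 S31 z * p f1 i z - p f1 S31 z * p f0 i z) / det" for i
  have k: "(\<Sum>i\<in>UNIV. y i (fst z) * p f0 i z) = 0 \<and> (\<Sum>i\<in>UNIV. y i (fst z) * p f1 i z) = 0" if "killed y" for y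
    using that z f01 unfolding killed_def by blast
  show thesis
  proof (rule that[of pa pb]; (intro allI impI)?)
    fix y assume "killed y"
    note ky = k[OF this]
    have "(\<Sum>i\<in>UNIV. y i (fst z) * pa i) = (p f1 S32 z / det) * (\<Sum>i\<in>UNIV. y i (fst z) * p f0 i z)
        - (p f0 S32 z / det) * (\<Sum>i\<in>UNIV. y i (fst z) * p f1 i z)"
      by (simp add: pa_def sum_distrib_left sum_subtractf[symmetric] diff_divide_distrib algebra_simps)
    then show "(\<Sum>i\<in>UNIV. y i (fst z) * pa i) = 0" using ky by simp
    have "(\<Sum>i\<in>UNIV. y i (fst z) * pb i) = (p f0 S31 z / det) * (\<Sum>i\<in>UNIV. y i (fst z) * p f1 i z)
        - (p f1 S31 z / det) * (\<Sum>i\<in>UNIV. y i (fst z) * p f0 i z)"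
      by (simp add: pb_def sum_distrib_left sum_subtractf[symmetric] diff_divide_distrib algebra_simps)
    then show "(\<Sum>i\<in>UNIV. y i (fst z) * pb i) = 0" using ky by simp
  next
    have "p f1 S32 z * p f0 S31 z - p f0 S32 z * p f1 S31 z = det"
      "p f0 S31 z * p f1 S32 z - p f1 S31 z * p f0 S32 z = det"
      by (simp_all add: det_def mult.commute)
    then show "pa S31 = 1" "pb S32 = 1" using \<open>det \<noteq> 0\<close> by (simp_all add: pa_def pb_def)
    show "pa S32 = 0" "pb S31 = 0" by (simp_all add: pa_def pb_def mult.commute)
  qed
qed

lemma PQ_values:
  assumes z: "z \<in> D \<times> mink_frame_bundle" "z \<in> U" and xz: "x = fst z"
  shows "mu x * P1 x = of_real (m1 x) * of_real (m2 x) \<and> mu x * P2 x = of_real (m1 x) * of_real (m1 x)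
    \<and> mu x * Q1 x = of_real (m2 x) * of_real (m2 x)"
proof -
  have x: "x \<in> D" using z xz by auto
  obtain pa pb :: "idx \<Rightarrow> 'a" where pab: "pa S31 = 1" "pa S32 = 0" "pb S31 = 0" "pb S32 = 1"
    and ka': "\<forall>y. killed y \<longrightarrow> (\<Sum>i\<in>UNIV. y i x * pa i) = 0"
    and kb': "\<forall>y. killed y \<longrightarrow> (\<Sum>i\<in>UNIV. y i x * pb i) = 0"
    by (rule dual_covectors[OF z, folded xz]) (rule that)
  note ka = ka'[rule_format] and kb = kb'[rule_format]
  \<comment> \<open>The translation parts of \<open>Z0\<close>, \<open>Z1\<close>, \<open>Z2\<close>
    are unit vectors, so annihilation of these fields solves for \<open>pa\<close> on
    \<open>R1\<close>, \<open>R2\<close>, \<open>R3\<close>. The value on \<open>S12\<close> stays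
    free.\<close>
  have va: "pa R3 = mu x * pa S12 + of_real (m1 x)" "pa R1 = of_real (m2 x) * pa S12 + P1 x"
    "pa R2 = of_real (m1 x) * pa S12 + P2 x"
    using ka[OF killed_Z0] ka[OF killed_Z1] ka[OF killed_Z2]
    by (simp_all add: sum_idx pab algebra_simps)
  have vb: "pb R3 = mu x * pb S12 + of_real (m2 x)" "pb R1 = of_real (m2 x) * pb S12 + Q1 x"
    "pb R2 = of_real (m1 x) * pb S12 + P1 x"
    using kb[OF killed_Z0] kb[OF killed_Z1] kb[OF killed_Z2]
    by (simp_all add: sum_idx pab algebra_simps)
  note kX = killed_brk[OF XZ_differentiable(1) XZ_differentiable(4) killed_X(1) killed_Z1]
    killed_brk[OF XZ_differentiable(1) XZ_differentiable(5) killed_X(1) killed_Z2]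
    killed_brk[OF XZ_differentiable(2) XZ_differentiable(4) killed_X(2) killed_Z1]
    killed_brk[OF XZ_differentiable(2) XZ_differentiable(5) killed_X(2) killed_Z2]
  note kZ = killed_brk[OF XZ_differentiable(3) XZ_differentiable(4) killed_Z0 killed_Z1]
    killed_brk[OF XZ_differentiable(3) XZ_differentiable(5) killed_Z0 killed_Z2]
    killed_brk[OF XZ_differentiable(4) XZ_differentiable(5) killed_Z1 killed_Z2]
  define M1 M2 a b where defs: "M1 = (of_real (m1 x) :: 'a)" "M2 = (of_real (m2 x) :: 'a)" "a = pa S12" "b = pb S12"
  note ev = sum_idx brk_def Let_def d_simps x d_m pab va vb defs[symmetric]
  have two: "2 * mu x \<noteq> 0" using mu_nz[OF x] by simp
  \<comment> \<open>Brackets among \<open>Z0\<close>, \<open>Z1\<close>, \<open>Z2\<close> have no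
    surface components, so equations 1 to 6 are algebraic at the point \<open>x\<close>.\<close>
  have 1: "P1 x + a * M2 = 0"
  proof -
    have "2 * mu x * (P1 x + a * M2) = 0" using ka[OF kZ(2)] by (simp add: ev) algebra
    then show ?thesis using two by simp
  qed
  have 2: "P1 x + b * M1 = 0"
  proof -
    have "2 * mu x * (P1 x + b * M1) = 0" using kb[OF kZ(1)] by (simp add: ev) algebra
    then show ?thesis using two by simp
  qed
  have 3: "P2 x * Q1 x - P1 x * P1 x + mu x * (P2 x + Q1 x) + M1 * M1 - M2 * M2 + 2 * mu x * a * M1 = 0"
    using ka[OF kZ(1)] by (simp add: ev) algebra
  have 4: "mu x * (P2 x + Q1 x) + M2 * M2 - M1 * M1 - P2 x * Q1 x + P1 x * P1 x + 2 * mu x * b * M2 = 0"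
    using kb[OF kZ(2)] by (simp add: ev) algebra
  have 5: "2 * P1 x * M2 - 2 * P2 x * M1 + a * (P2 x * Q1 x - P1 x * P1 x + mu x * (Q1 x - P2 x) + M2 * M2 - M1 * M1) = 0"
    using ka[OF kZ(3)] by (simp add: ev) algebra
  have 6: "2 * Q1 x * M2 - 2 * P1 x * M1 + b * (P2 x * Q1 x - P1 x * P1 x + mu x * (Q1 x - P2 x) + M2 * M2 - M1 * M1) = 0"
    using kb[OF kZ(3)] by (simp add: ev) algebra
  \<comment> \<open>Both evaluations contain the derivative of \<open>P1\<close> along e1:
    \<open>pa\<close> meets it in the \<open>S31\<close> coefficient of [X1, Z1], \<open>pb\<close>
    in the \<open>S32\<close> coefficient of [X1, Z2]. Their difference is free of third
    derivatives.\<close>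
  have 7: "b * (P2 x + mu x) - a * P1 x = - M2"
  proof -
    have "2 * mu x * (b * (P2 x + mu x) - a * P1 x + M2) = 0"
      using ka[OF kX(1)] kb[OF kX(2)] by (simp add: ev) algebra
    then show ?thesis using two by (simp add: eq_neg_iff_add_eq_0)
  qed
  \<comment> \<open>The same elimination for the derivative of \<open>P1\<close> along e2, from the
    brackets with \<open>X2\<close>.\<close>
  have 8: "a * (mu x - Q1 x) + b * P1 x = - M1"
  proof -
    have "2 * mu x * (a * (mu x - Q1 x) + b * P1 x + M1) = 0"
      using ka[OF kX(3)] kb[OF kX(4)] by (simp add: ev) algebra
    then show ?thesis using two by (simp add: eq_neg_iff_add_eq_0)
  qed
  show ?thesis using hessian_algebra[OF mu_nz[OF x] 1 2 3 4 5 6 7 8] by (simp add: defs)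
qed

lemma d_m_values:
  assumes z: "z \<in> D \<times> mink_frame_bundle" "z \<in> U" and xz: "x = fst z"
  shows "d1 m1 x = 3 * m1 x * m1 x - kap x + G1 x * m2 x" "d2 m1 x = 3 * m1 x * m2 x + G2 x * m2 x"
    "d1 m2 x = 3 * m1 x * m2 x + G1 x * m1 x" "d2 m2 x = 3 * m2 x * m2 x + kap x + G2 x * m1 x"
proof -
  have x: "x \<in> D" using z xz by auto
  note v = PQ_values[OF z xz] mu_sq[OF x] d_m[OF x]
  have "of_real (d1 m1 x) = (of_real (3 * m1 x * m1 x - kap x + G1 x * m2 x) :: 'a)"
    using v by (simp add: mult.assoc)
  then show "d1 m1 x = 3 * m1 x * m1 x - kap x + G1 x * m2 x" by (simp only: of_real_eq_iff)
  have "of_real (d2 m1 x) = (of_real (3 * m1 x * m2 x + G2 x * m2 x) :: 'a)"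
    using v by (simp add: mult.assoc)
  then show "d2 m1 x = 3 * m1 x * m2 x + G2 x * m2 x" by (simp only: of_real_eq_iff)
  have "of_real (d1 m2 x) = (of_real (3 * m1 x * m2 x + G1 x * m1 x) :: 'a)"
    using v by (simp add: mult.assoc)
  then show "d1 m2 x = 3 * m1 x * m2 x + G1 x * m1 x" by (simp only: of_real_eq_iff)
  have "of_real (d2 m2 x) = (of_real (3 * m2 x * m2 x + kap x + G2 x * m1 x) :: 'a)"
    using v by (simp add: mult.assoc)
  then show "d2 m2 x = 3 * m2 x * m2 x + kap x + G2 x * m1 x" by (simp only: of_real_eq_iff)
qed

section \<open>From the logarithmic derivatives of k to the Hessian of q\<close>

lemma d_power:
  assumes x: "x \<in> D"
  shows "d1 (\<lambda>x. k x powr (-3/2)) x = -3 * m1 x * (k x powr (-3/2))"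
    "d2 (\<lambda>x. k x powr (-3/2)) x = -3 * m2 x * (k x powr (-3/2))"
proof -
  have "((\<lambda>x. k x powr (-3/2)) has_derivative
      (\<lambda>v. k x powr (-3/2) * (FD k x v * (-3/2) / k x))) (at x)"
    using has_derivative_powr[OF smooth_on_has_derivative[OF k_smooth D x] has_derivative_const[of "-3/2"] k_pos[OF x]]
    by simp
  from frechet_derivative_eqI[OF this]
  show "d1 (\<lambda>x. k x powr (-3/2)) x = -3 * m1 x * (k x powr (-3/2))"
    "d2 (\<lambda>x. k x powr (-3/2)) x = -3 * m2 x * (k x powr (-3/2))"
    using k_pos[OF x] d_k[OF x] by (simp_all add: d1_def d2_def)
qed

lemma hessian_power:
  assumes z: "z \<in> D \<times> mink_frame_bundle" "z \<in> U" and xz: "x = fst z"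
  defines "q \<equiv> \<lambda>x. k x powr (-3/2)"
  shows "hess_eq q (3 * q x * kap x) x"
proof -
  have x: "x \<in> D" using z xz by auto
  have qs: "smooth_on D q" unfolding q_def by (intro smooth_on_powr D k_smooth k_pos)
  have q1: "d1 q y = -3 * m1 y * q y" and q2: "d2 q y = -3 * m2 y * q y" if "y \<in> D" for y
    using d_power[OF that] by (simp_all add: q_def)
  have prod: "((\<lambda>y. -3 * m y * q y) has_derivative
      (\<lambda>v. -3 * m x * FD q x v + -3 * FD m x v * q x)) (at x)"
    if m: "smooth_on D m" for m
    by (intro has_derivative_mult has_derivative_mult_right smooth_on_has_derivative[OF _ D x] m qs)
  have pd: "d1 (\<lambda>y. -3 * m y * q y) x = -3 * m x * d1 q x - 3 * d1 m x * q x"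
     "d2 (\<lambda>y. -3 * m y * q y) x = -3 * m x * d2 q x - 3 * d2 m x * q x"
    if m: "smooth_on D m" for m
    using frechet_derivative_eqI[OF prod[OF m]] by (simp_all add: d1_def d2_def)
  have df: "(\<lambda>y. -3 * m y * q y) differentiable (at x)" if m: "smooth_on D m" for m
    using prod[OF m] unfolding differentiable_def by blast
  have dd: "d1 (d1 q) x = d1 (\<lambda>y. -3 * m1 y * q y) x" "d2 (d1 q) x = d2 (\<lambda>y. -3 * m1 y * q y) x"
    "d1 (d2 q) x = d1 (\<lambda>y. -3 * m2 y * q y) x" "d2 (d2 q) x = d2 (\<lambda>y. -3 * m2 y * q y) x"
    by (rule d_cong[OF x df[OF m_smooth(1)]] d_cong[OF x df[OF m_smooth(2)]]; simp add: q1 q2)+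
  show "hess_eq q (3 * q x * kap x) x"
    unfolding hess_eq_def dd pd[OF m_smooth(1)] pd[OF m_smooth(2)] d_m_values[OF z xz] q1[OF x] q2[OF x]
    by (simp add: algebra_simps)
qed

end

lemma standard_mink_frame: "(0, axis 1 1, axis 2 1, axis 3 1) \<in> mink_frame_bundle"
  by (simp add: mink_frame_bundle_def mink_frame_def mink_def axis_def)

context surface_patch
begin

text \<open>Both signs of the curvature are treated together: \<open>lam\<close> is a scalar with
  square - eps, and |kap| = eps kap makes k smooth. The exponent -3/4 of |K| is the exponent -3/2 of
  k.\<close>

lemma hessian_q:
  fixes lam :: "'k::real_normed_field" and eps :: real
  assumes x: "x \<in> D" and eps: "eps = 1 \<or> eps = -1" and lam: "lam * lam = - of_real eps"
    and kap: "\<And>x. x \<in> D \<Longrightarrow> sgn (kap x) = eps"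
    and darboux: "\<And>f. f \<in> mink_frame_bundle \<Longrightarrow>
       has_transverse_frobenius (frame_bundle C h \<times> mink_frame_bundle)
         (map scalar_ext (theta_forms h om)) (singular_system h om (\<lambda>x. sqrt \<bar>kap x\<bar>) lam) (sec x, f)"
  defines "q \<equiv> \<lambda>x. \<bar>kap x\<bar> powr (-3/4)"
  shows "hess_eq q (3 * q x * kap x) x"
proof -
  let ?k = "\<lambda>x. sqrt \<bar>kap x\<bar>" and ?N = "frame_bundle C h \<times> mink_frame_bundle"
  have "has_transverse_frobenius ?N (map scalar_ext (theta_forms h om)) (singular_system h om ?k lam)
      (sec x, (0, axis 1 1, axis 2 1, axis 3 1))"
    \<comment> \<open>A Minkowski frame is needed as second component of the base point; the
      equations at \<open>x\<close> are read off there.\<close>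
    by (rule darboux[OF standard_mink_frame])
  then obtain B F where BF: "open B" "(sec x, (0, axis 1 1, axis 2 1, axis 3 1)) \<in> B" "2 \<le> length F"
    "frobenius_frame ?N B F"
    and BF': "\<forall>y\<in>?N \<inter> B. covector_span (tangent_vectors ?N y) (forms_at F y)
        \<subseteq> covector_span (tangent_vectors ?N y) (forms_at (singular_system h om ?k lam) y) \<and>
      (\<forall>a\<in>covector_span (tangent_vectors ?N y) (forms_at F y) \<inter>
        covector_span (tangent_vectors ?N y) (forms_at (map scalar_ext (theta_forms h om)) y).
      \<forall>X\<in>tangent_vectors ?N y. a X = 0)"
    unfolding has_transverse_frobenius_def Let_def by (elim exE conjE) (rule that)
  have abs: "\<bar>kap x\<bar> = eps * kap x" "kap x \<noteq> 0" if "x \<in> D" for x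
    using kap[OF that] eps by (auto simp: sgn_if abs_if split: if_splits)
  have kpos: "?k x > 0" if "x \<in> D" for x using abs(2)[OF that] by simp
  have ks: "smooth_on D ?k"
  proof -
    have "smooth_on D (\<lambda>x. (eps * kap x) powr (1/2))"
      using abs by (intro smooth_on_powr smooth_on_mult smooth_on_const kap_smooth D) force
    then show ?thesis
      by (rule smooth_on_cong[OF D, THEN iffD1, rotated]) (simp add: abs(1)[symmetric] powr_half_sqrt)
  qed
  interpret S: darboux_system C D h e1 e2 om kap B F lam ?k
  proof unfold_locales
    show "lam * lam * of_real (?k x * ?k x) = - of_real (kap x)" if "x \<in> D" for x
      using abs[OF that] eps unfolding lam by (auto simp flip: of_real_mult)
    show "lam \<noteq> 0" using lam eps by auto
    show "covector_span (tangent_vectors ?N y) (forms_at F y)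
        \<subseteq> covector_span (tangent_vectors ?N y) (forms_at (singular_system h om ?k lam) y)" if "y \<in> ?N \<inter> B" for y
      using bspec[OF BF' that] by (rule conjunct1)
    show "a X = 0" if "y \<in> ?N \<inter> B" "a \<in> covector_span (tangent_vectors ?N y) (forms_at F y)"
      "a \<in> covector_span (tangent_vectors ?N y) (forms_at (map scalar_ext (theta_forms h om)) y)"
      "X \<in> tangent_vectors ?N y" for y a X
      using bspec[OF bspec[OF BF' that(1), THEN conjunct2] IntI[OF that(2,3)]] that(4) by (rule bspec)
  qed (fact BF kpos ks)+
  have q: "q = (\<lambda>x. ?k x powr (-3/2))"
    by (rule ext) (simp add: q_def powr_half_sqrt[symmetric] powr_powr)
  have "(x, (0, axis 1 1, axis 2 1, axis 3 1)) \<in> S.U" using x BF(2) by (simp add: S.U_def S.Phi_def)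
  then show "hess_eq q (3 * q x * kap x) x"
    unfolding q using S.hessian_power[of "(x, (0, axis 1 1, axis 2 1, axis 3 1))" x] x standard_mink_frame by auto
qed

section \<open>The rotated gradient and the Killing equation\<close>

lemma linear_frechet_derivative_family:
  fixes \<alpha> :: "real^2 \<Rightarrow> 'v::real_vector \<Rightarrow> 'b::real_normed_vector"
  assumes x: "x \<in> D" and lin: "\<And>y. y \<in> D \<Longrightarrow> linear (\<alpha> y)" and diff: "\<And>v. (\<lambda>y. \<alpha> y v) differentiable (at x)"
  shows "linear (\<lambda>v. FD (\<lambda>y. \<alpha> y v) x w)"
proof (rule linearI)
  note d = has_frechet_derivative[OF diff]
  fix u v and c :: real
  have "((\<lambda>y. \<alpha> y (u + v)) has_derivative (\<lambda>w. FD (\<lambda>y. \<alpha> y u) x w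
      + FD (\<lambda>y. \<alpha> y v) x w)) (at x)"
    by (rule has_derivative_transform_within_open[OF has_derivative_add[OF d d] D x]) (simp add: linear_add[OF lin])
  from frechet_derivative_eqI[OF this]
  show "FD (\<lambda>y. \<alpha> y (u + v)) x w = FD (\<lambda>y. \<alpha> y u) x w
      + FD (\<lambda>y. \<alpha> y v) x w" by (rule fun_cong)
  have "((\<lambda>y. \<alpha> y (c *\<^sub>R v)) has_derivative (\<lambda>w. c *\<^sub>R FD (\<lambda>y. \<alpha> y v) x w)) (at x)"
    by (rule has_derivative_transform_within_open[OF has_derivative_scaleR_right[OF d] D x])
      (simp add: linear_cmul[OF lin])
  from frechet_derivative_eqI[OF this]
  show "FD (\<lambda>y. \<alpha> y (c *\<^sub>R v)) x w = c *\<^sub>R FD (\<lambda>y. \<alpha> y v) x w"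
    by (rule fun_cong)
qed

lemma h_differentiable: "x \<in> D \<Longrightarrow> (\<lambda>y. h y u v) differentiable (at x)"
  using smooth_on_differentiable[OF h_smooth C] DC by blast

lemma has_derivative_metric:
  assumes x: "x \<in> D" and a: "(a has_derivative da) (at x)" and b: "(b has_derivative db) (at x)"
  shows "((\<lambda>y. h y (a y) (b y)) has_derivative
    (\<lambda>w. FD (\<lambda>y. h y (a x) (b x)) x w + h x (a x) (db w) + h x (da w) (b x))) (at x)"
proof -
  have 1: "((\<lambda>y. h y u (b y)) has_derivative
    (\<lambda>w. FD (\<lambda>y. h y u (b x)) x w + h x u (db w))) (at x)" for u
    by (rule has_derivative_linear_apply[OF D x h_lin(1) h_differentiable[OF x] b])
  have "((\<lambda>y. h y (a y) (b y)) has_derivative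
    (\<lambda>w. FD (\<lambda>y. h y (a x) (b y)) x w + h x (da w) (b x))) (at x)"
  proof (rule has_derivative_linear_apply[OF D x _ _ a])
    show "linear (\<lambda>u. h y u (b y))" if "y \<in> D" for y using h_lin(2)[OF that] .
    show "(\<lambda>y. h y u (b y)) differentiable (at x)" for u using 1 unfolding differentiable_def by blast
  qed
  then show ?thesis by (simp only: frechet_derivative_eqI[OF 1])
qed

definition lie :: "(real^2 \<Rightarrow> real^2) \<Rightarrow> real^2 \<Rightarrow> real^2 \<Rightarrow> real^2 \<Rightarrow> real" where
  "lie V x u v = FD (\<lambda>y. h y u v) x (V x)
     + h x (FD V x u) v + h x u (FD V x v)"

text \<open>For fixed V the expression is a symmetric bilinear form in u and v, including its
  derivative term, in which u and v are frozen. Its three frame components therefore decide.\<close>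

lemma lie_frame_zero:
  assumes x: "x \<in> D" and V: "V differentiable (at x)"
    and z: "lie V x (e1 x) (e1 x) = 0" "lie V x (e2 x) (e2 x) = 0" "lie V x (e1 x) (e2 x) = 0"
  shows "lie V x u v = 0"
proof -
  note lV = linear_frechet_derivative[OF V]
  have sym: "lie V x u v = lie V x v u" for u v
  proof -
    have "((\<lambda>y. h y v u) has_derivative FD (\<lambda>y. h y u v) x) (at x)"
      by (rule has_derivative_transform_within_open[OF has_frechet_derivative[OF h_differentiable[OF x]] D x])
        (use h_sym DC in auto)
    from frechet_derivative_eqI[OF this] show ?thesis
      using x DC h_sym[of x] by (simp add: lie_def subset_iff)
  qed
  have lin: "linear (lie V x u)" for u
    unfolding lie_def[abs_def]
    by (intro linear_compose_add linear_frechet_derivative_family[OF x h_lin(1) h_differentiable[OF x]]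
        h_lin(1)[OF x] linear_compose[OF lV h_lin(1)[OF x], unfolded o_def])
  have ex: "lie V x u v = h x v (e1 x) * lie V x u (e1 x) - h x v (e2 x) * lie V x u (e2 x)" for u v
    by (subst frame_expansion[OF x, of v]) (simp add: linear_diff[OF lin] linear_cmul[OF lin])
  have "lie V x (e2 x) (e1 x) = 0" using sym[of "e2 x" "e1 x"] z by simp
  then have "lie V x u (e1 x) = 0" "lie V x u (e2 x) = 0"
    using sym[of u "e1 x"] ex[of "e1 x" u] sym[of u "e2 x"] ex[of "e2 x" u] z by simp_all
  then show ?thesis using ex[of u v] by simp
qed

text \<open>The brackets [e1, V] and [e2, V] are the same multiple of e2 and of e1, respectively.
  Thus V moves the framing by an infinitesimal boost, which preserves the metric.\<close>

lemma lie_skew_gradient: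
  fixes q :: "real^2 \<Rightarrow> real"
  assumes x: "x \<in> D" and q: "smooth_on D q"
    and hess: "hess_eq q c x"
  shows "lie (\<lambda>y. d1 q y *\<^sub>R e2 y - d2 q y *\<^sub>R e1 y) x u v = 0"
proof -
  have q11: "d1 (d1 q) x = G1 x * d2 q x + c" and q12: "d2 (d1 q) x = G2 x * d2 q x"
    and q21: "d1 (d2 q) x = G1 x * d1 q x" and q22: "d2 (d2 q) x = G2 x * d1 q x - c"
    using hess by (simp_all add: hess_eq_def)
  define V where "V = (\<lambda>y. d1 q y *\<^sub>R e2 y - d2 q y *\<^sub>R e1 y)"
  let ?D1 = "FD e1 x" and ?D2 = "FD e2 x"
  have dV: "(V has_derivative (\<lambda>w. (d1 q x *\<^sub>R ?D2 w + FD (d1 q) x w *\<^sub>R e2 x)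
      - (d2 q x *\<^sub>R ?D1 w + FD (d2 q) x w *\<^sub>R e1 x))) (at x)"
    unfolding V_def
    by (intro has_derivative_diff has_derivative_scaleR has_derivative_e[OF x]
        smooth_on_has_derivative[OF smooth_d1[OF q] D x] smooth_on_has_derivative[OF smooth_d2[OF q] D x])
  let ?V = "FD V x"
  note V' = frechet_derivative_eqI[OF dV]
  have l1: "linear ?D1" "linear ?D2"
    using has_derivative_e[OF x] by (auto intro: has_derivative_linear)
  note comm = frame_commutator[OF x]
  have Vx: "V x = d1 q x *\<^sub>R e2 x - d2 q x *\<^sub>R e1 x" by (simp add: V_def)
  have c1: "?V (e1 x) - ?D1 (V x) = (G1 x * d2 q x + c - d1 q x * G2 x) *\<^sub>R e2 x"
  proof -
    have "?V (e1 x) - ?D1 (V x) = d1 (d1 q) x *\<^sub>R e2 x - d1 (d2 q) x *\<^sub>R e1 x + d1 q x *\<^sub>R (?D2 (e1 x) - ?D1 (e2 x))"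
      unfolding V' Vx linear_diff[OF l1(1)] linear_cmul[OF l1(1)] d1_def[of "d1 q"] d1_def[of "d2 q"]
      by (simp add: algebra_simps)
    then show ?thesis unfolding comm q11 q21 by (simp add: algebra_simps)
  qed
  have c2: "?V (e2 x) - ?D2 (V x) = (c - G2 x * d1 q x + d2 q x * G1 x) *\<^sub>R e1 x"
  proof -
    have "?V (e2 x) - ?D2 (V x) = d2 (d1 q) x *\<^sub>R e2 x - d2 (d2 q) x *\<^sub>R e1 x + d2 q x *\<^sub>R (?D2 (e1 x) - ?D1 (e2 x))"
      unfolding V' Vx linear_diff[OF l1(2)] linear_cmul[OF l1(2)] d2_def[of "d1 q"] d2_def[of "d2 q"]
      by (simp add: algebra_simps)
    then show ?thesis unfolding comm q12 q22 by (simp add: algebra_simps)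
  qed
  have fr: "FD (\<lambda>y. h y (a x) (b x)) x (V x) = - h x (a x) (db (V x)) - h x (da (V x)) (b x)"
    if "(a has_derivative da) (at x)" "(b has_derivative db) (at x)" "\<And>y. y \<in> D \<Longrightarrow> h y (a y) (b y) = r" for a b da db r
  proof -
    have "FD (\<lambda>y. h y (a y) (b y)) x (V x) = 0"
      by (rule frechet_derivative_const_on[OF x that(3)])
    then have "FD (\<lambda>y. h y (a x) (b x)) x (V x) + h x (a x) (db (V x)) + h x (da (V x)) (b x) = 0"
      using fun_cong[OF frechet_derivative_eqI[OF has_derivative_metric[OF x that(1,2)]], of "V x"] by simp
    then show ?thesis by linarith
  qed
  have hd: "h x (a - b) w = h x a w - h x b w" "h x w (a - b) = h x w a - h x w b"
     "h x (r *\<^sub>R a) w = r * h x a w" "h x w (r *\<^sub>R a) = r * h x w a" for a b w r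
    using linear_diff[OF h_lin(1)[OF x]] linear_diff[OF h_lin(2)[OF x]]
      linear_cmul[OF h_lin(1)[OF x]] linear_cmul[OF h_lin(2)[OF x]] by simp_all
  \<comment> \<open>When the product of \<open>a\<close> and \<open>b\<close> is constant, the
    derivative of the metric along V is minus the terms with derivatives of \<open>a\<close> and
    \<open>b\<close>. Only their brackets with V remain.\<close>
  have L: "lie V x (a x) (b x) = h x (?V (a x) - da (V x)) (b x) + h x (a x) (?V (b x) - db (V x))"
    if "(a has_derivative da) (at x)" "(b has_derivative db) (at x)" "\<And>y. y \<in> D \<Longrightarrow> h y (a y) (b y) = r" for a b da db r
    using fr[OF that] by (simp add: lie_def hd)
  have z: "lie V x (e1 x) (e1 x) = 0" "lie V x (e2 x) (e2 x) = 0" "lie V x (e1 x) (e2 x) = 0"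
    using L[OF has_derivative_e(1)[OF x] has_derivative_e(1)[OF x], of 1]
      L[OF has_derivative_e(2)[OF x] has_derivative_e(2)[OF x], of "-1"]
      L[OF has_derivative_e(1)[OF x] has_derivative_e(2)[OF x], of 0]
    unfolding c1 c2 hd by (simp_all add: h11 h22 h12 h21 x)
  have "V differentiable (at x)" using dV unfolding differentiable_def by blast
  from lie_frame_zero[OF x this z] show ?thesis by (simp add: V_def)
qed

end

subsection \<open>Adapted coordinates\<close>

lemma smooth_on_from_derivative:
  assumes S: "open S" and f: "\<And>x. x \<in> S \<Longrightarrow> (f has_derivative f' x) (at x)"
    and f': "\<And>v. smooth_on S (\<lambda>x. f' x v)"
  shows "smooth_on S f"
  unfolding smooth_on_def
proof
  fix k
  have "Ck_on (Suc k) S f" by (rule Ck_on_SucI[OF S f]) (use f' in \<open>auto simp: smooth_on_def\<close>)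
  then show "Ck_on k S f" by (rule Ck_on_Suc_imp)
qed

text \<open>The potential is the integral of the form along the segment from the centre of the ball;
  closedness turns its differential under the integral sign into a total derivative.\<close>

lemma closed_form_potential:
  fixes \<omega> :: "'a::euclidean_space \<Rightarrow> 'a \<Rightarrow> real"
  assumes form: "smooth_form (ball x0 r) \<omega>"
    and closed: "\<And>x u v. x \<in> ball x0 r \<Longrightarrow>
      FD (\<lambda>y. \<omega> y v) x u = FD (\<lambda>y. \<omega> y u) x v"
  obtains f where "\<And>x. x \<in> ball x0 r \<Longrightarrow> (f has_derivative \<omega> x) (at x)"
proof -
  let ?S = "ball x0 r"
  have lin: "linear (\<omega> x)" if "x \<in> ?S" for x using form that by (simp add: smooth_form_def)
  have sm: "smooth_on ?S (\<lambda>x. \<omega> x v)" for v using form by (simp add: smooth_form_def)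
  have diff: "(\<lambda>y. \<omega> y v) differentiable (at x)" if "x \<in> ?S" for x v
    by (rule smooth_on_differentiable[OF sm open_ball that])
  define \<gamma> where "\<gamma> x t = x0 + t *\<^sub>R (x - x0)" for x :: 'a and t :: real
  have \<gamma>S: "\<gamma> x t \<in> ?S" if x: "x \<in> ?S" and t: "t \<in> {0..1}" for x t
  proof -
    have "\<bar>t\<bar> * norm (x - x0) \<le> 1 * norm (x - x0)" using t by (intro mult_right_mono) auto
    then show ?thesis using x by (simp add: \<gamma>_def dist_norm norm_minus_commute)
  qed
  define Df where "Df v x u = FD (\<lambda>y. \<omega> y v) x u" for v x u
  define fx where "fx x t v = t * Df (x - x0) (\<gamma> x t) v + \<omega> (\<gamma> x t) v" for x t v
  have d1: "((\<lambda>x. \<omega> (\<gamma> x t) (x - x0)) has_derivative fx x t) (at x)" if x: "x \<in> ?S" and t: "t \<in> {0..1}" for x t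
  proof -
    have "((\<lambda>x. \<omega> (\<gamma> x t) (x - x0)) has_derivative
      (\<lambda>u. FD (\<lambda>y. \<omega> y (x - x0)) (\<gamma> x t) (t *\<^sub>R u) + \<omega> (\<gamma> x t) u)) (at x)"
    proof (rule has_derivative_form_along[where \<alpha> = \<omega> and \<sigma> = "\<lambda>x. \<gamma> x t" and B = ?S,
          OF open_ball \<gamma>S[OF x t] lin diff[OF \<gamma>S[OF x t]] open_UNIV UNIV_I])
      show "continuous_on UNIV (\<lambda>x. \<gamma> x t)" unfolding \<gamma>_def by (intro continuous_intros)
      show "((\<lambda>x. \<gamma> x t) has_derivative (*\<^sub>R) t) (at x)" unfolding \<gamma>_def
        by (auto intro!: derivative_eq_intros)
      show "((\<lambda>x. x - x0) has_derivative (\<lambda>u. u)) (at x)" by (auto intro!: derivative_eq_intros)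
    qed
    then show ?thesis
      unfolding fx_def Df_def linear_cmul[OF linear_frechet_derivative[OF diff[OF \<gamma>S[OF x t]]]]
      by simp
  qed
  \<comment> \<open>In \<open>fx\<close> the vector \<open>x - x0\<close> varies together with the
    point, so joint continuity is proved on the expansion in \<open>Basis\<close>.\<close>
  have DfB: "Df w x u = (\<Sum>b\<in>Basis. (w \<bullet> b) *\<^sub>R Df b x u)" if "x \<in> ?S" for w x u
  proof -
    have "((\<lambda>y. \<Sum>b\<in>Basis. (w \<bullet> b) *\<^sub>R \<omega> y b) has_derivative (\<lambda>u. \<Sum>b\<in>Basis. (w \<bullet> b) *\<^sub>R Df b x u)) (at x)"
      unfolding Df_def by (intro has_derivative_sum has_derivative_scaleR_right has_frechet_derivative diff that)
    then have "((\<lambda>y. \<omega> y w) has_derivative (\<lambda>u. \<Sum>b\<in>Basis. (w \<bullet> b) *\<^sub>R Df b x u)) (at x)"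
      by (rule has_derivative_transform_within_open[OF _ open_ball that])
        (use linear_sum_Basis[OF lin] in auto)
    from frechet_derivative_eqI[OF this] show ?thesis unfolding Df_def by (rule fun_cong)
  qed
  have c\<gamma>: "continuous_on (?S \<times> {0..1}) (\<lambda>z. \<gamma> (fst z) (snd z))"
    unfolding \<gamma>_def by (intro continuous_intros)
  have cfx: "continuous_on (?S \<times> {0..1}) (\<lambda>z. fx (fst z) (snd z) v)" for v
  proof -
    have cD: "continuous_on (?S \<times> {0..1}) (\<lambda>z. Df b (\<gamma> (fst z) (snd z)) v)" for b
      by (rule continuous_on_compose2[OF smooth_on_continuous_on[OF smooth_on_frechet_derivative[OF sm]] c\<gamma>,
            of b v, folded Df_def]) (use \<gamma>S in auto)
    have "continuous_on (?S \<times> {0..1}) (\<lambda>z. snd z * (\<Sum>b\<in>Basis. ((fst z - x0) \<bullet> b) *\<^sub>R Df b (\<gamma> (fst z) (snd z)) v)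
        + \<omega> (\<gamma> (fst z) (snd z)) v)"
      by (intro continuous_intros cD continuous_on_compose2[OF smooth_on_continuous_on[OF sm] c\<gamma>])
        (use \<gamma>S in auto)
    then show ?thesis
      by (rule continuous_on_eq) (use \<gamma>S DfB in \<open>auto simp: fx_def\<close>)
  qed
  have bl: "bounded_linear (fx x t)" if "x \<in> ?S" "t \<in> {0..1}" for x t
    using d1[OF that] by (rule has_derivative_bounded_linear)
  define f where "f x = integral (cbox 0 1) (\<lambda>t. \<omega> (\<gamma> x t) (x - x0))" for x
  have "(f has_derivative \<omega> x) (at x)" if x: "x \<in> ?S" for x
  proof -
    have "((\<lambda>x. integral (cbox 0 1) (\<lambda>t. \<omega> (\<gamma> x t) (x - x0))) has_derivative
        integral (cbox 0 1) (\<lambda>t. Blinfun (fx x t))) (at x within ?S)"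
    proof (rule leibniz_rule[where fx = "\<lambda>x t. Blinfun (fx x t)", OF _ _ _ x convex_ball])
      show "((\<lambda>x. \<omega> (\<gamma> x t) (x - x0)) has_derivative blinfun_apply (Blinfun (fx x t))) (at x within ?S)"
        if "x \<in> ?S" "t \<in> cbox 0 1" for x and t :: real
        using d1[of x t] bl[of x t] that
        by (simp add: bounded_linear_Blinfun_apply has_derivative_at_withinI)
      show "(\<lambda>t. \<omega> (\<gamma> x t) (x - x0)) integrable_on cbox 0 1" if "x \<in> ?S" for x
      proof (rule integrable_continuous)
        have "continuous_on {0..1} (\<gamma> x)" unfolding \<gamma>_def by (intro continuous_intros)
        then show "continuous_on (cbox 0 1) (\<lambda>t. \<omega> (\<gamma> x t) (x - x0))"
          by (intro continuous_on_compose2[OF smooth_on_continuous_on[OF sm]]) (use \<gamma>S that in auto)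
      qed
      show "continuous_on (?S \<times> cbox 0 1) (\<lambda>(x, t). Blinfun (fx x t))"
        unfolding case_prod_beta
      proof (rule continuous_on_blinfun_componentwise)
        fix i :: 'a
        show "continuous_on (?S \<times> cbox 0 1) (\<lambda>z. blinfun_apply (Blinfun (fx (fst z) (snd z))) i)"
          by (rule continuous_on_eq[OF cfx[of i, folded cbox_interval]])
            (use bl in \<open>auto simp: bounded_linear_Blinfun_apply\<close>)
      qed
    qed
    then have 1: "(f has_derivative integral (cbox 0 1) (\<lambda>t. Blinfun (fx x t))) (at x)"
      unfolding f_def[abs_def] using at_within_open[OF x open_ball] by simp
    have "blinfun_apply (integral (cbox 0 1) (\<lambda>t. Blinfun (fx x t))) v = \<omega> x v" for v
    proof -
      have int: "(\<lambda>t. Blinfun (fx x t)) integrable_on cbox 0 1"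
      proof (rule integrable_continuous, rule continuous_on_blinfun_componentwise)
        fix i :: 'a
        have P: "continuous_on {0..1::real} (\<lambda>t. (x, t))" by (intro continuous_intros)
        have "continuous_on {0..1} (\<lambda>t. fx x t i)"
          using continuous_on_compose2[OF cfx[of i] P] x by force
        then show "continuous_on (cbox 0 1) (\<lambda>t. blinfun_apply (Blinfun (fx x t)) i)"
          unfolding cbox_interval by (rule continuous_on_eq)
            (use bl x in \<open>auto simp: bounded_linear_Blinfun_apply\<close>)
      qed
      have "blinfun_apply (integral (cbox 0 1) (\<lambda>t. Blinfun (fx x t))) v
          = integral (cbox 0 1) (\<lambda>t. blinfun_apply (Blinfun (fx x t)) v)"
        using integral_linear[OF int blinfun.bounded_linear_left[of v]] by (simp add: o_def)
      also have "\<dots> = integral {0..1} (\<lambda>t. fx x t v)"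
        unfolding cbox_interval by (rule integral_cong) (use bl x in \<open>auto simp: bounded_linear_Blinfun_apply\<close>)
      \<comment> \<open>The primitive is t times the value of the form at parameter t; the factor t
        removes the contribution of the centre.\<close>
      also have "\<dots> = 1 * \<omega> (\<gamma> x 1) v - 0 * \<omega> (\<gamma> x 0) v"
      proof (rule integral_unique, rule fundamental_theorem_of_calculus)
        fix t :: real assume t: "t \<in> {0..1}"
        have "((\<lambda>t. \<omega> (\<gamma> x t) v) has_derivative (\<lambda>s. Df v (\<gamma> x t) (s *\<^sub>R (x - x0)))) (at t)"
        proof -
          have g: "(\<gamma> x has_derivative (\<lambda>s. s *\<^sub>R (x - x0))) (at t)"
            unfolding \<gamma>_def by (auto intro!: derivative_eq_intros)
          show ?thesis
            using diff_chain_at[OF g has_frechet_derivative[OF diff[OF \<gamma>S[OF x t]]], of v]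
            by (simp add: o_def Df_def)
        qed
        then have "((\<lambda>t. t * \<omega> (\<gamma> x t) v) has_derivative
          (\<lambda>s. t * Df v (\<gamma> x t) (s *\<^sub>R (x - x0)) + s * \<omega> (\<gamma> x t) v)) (at t)"
          by (intro has_derivative_mult has_derivative_ident)
        moreover have "Df v (\<gamma> x t) (s *\<^sub>R (x - x0)) = s * Df (x - x0) (\<gamma> x t) v" for s
          unfolding Df_def linear_cmul[OF linear_frechet_derivative[OF diff[OF \<gamma>S[OF x t]]]]
            closed[OF \<gamma>S[OF x t], of v "x - x0"] by simp
        ultimately have "((\<lambda>t. t * \<omega> (\<gamma> x t) v) has_derivative (\<lambda>s. s *\<^sub>R fx x t v)) (at t)"
          by (simp add: fx_def algebra_simps)
        then show "((\<lambda>t. t * \<omega> (\<gamma> x t) v) has_vector_derivative fx x t v) (at t within {0..1})"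
          unfolding has_vector_derivative_def by (rule has_derivative_at_withinI)
      qed simp
      finally show ?thesis by (simp add: \<gamma>_def)
    qed
    then have "blinfun_apply (integral (cbox 0 1) (\<lambda>t. Blinfun (fx x t))) = \<omega> x" by (rule ext)
    then show ?thesis using 1 by simp
  qed
  then show thesis by (rule that)
qed

context surface_patch
begin

lemma h_expand: "x \<in> D \<Longrightarrow> h x (G1 x *\<^sub>R e1 x - G2 x *\<^sub>R e2 x) (e1 x) = G1 x"
  "x \<in> D \<Longrightarrow> h x (G1 x *\<^sub>R e1 x - G2 x *\<^sub>R e2 x) (e2 x) = G2 x"
  by (simp_all add: linear_diff[OF h_lin(2)] linear_cmul[OF h_lin(2)] h11 h12 h21 h22)

text \<open>The hypothesis says that the exterior derivative of a eta^1 + b eta^2 vanishes on (e1,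
  e2), with [e1, e2] expanded by \<open>frame_commutator\<close>. In dimension two this is
  closedness, because an alternating bilinear form is determined by its value on one frame.\<close>

lemma frame_form_potential:
  fixes a b :: "real^2 \<Rightarrow> real"
  assumes S: "ball x0 r \<subseteq> D" and a: "smooth_on (ball x0 r) a" and b: "smooth_on (ball x0 r) b"
    and closed: "\<And>x. x \<in> ball x0 r \<Longrightarrow> d1 b x - d2 a x = G1 x * a x - G2 x * b x"
  obtains f where "\<And>x. x \<in> ball x0 r \<Longrightarrow>
    (f has_derivative (\<lambda>v. h x v (e1 x) * a x - h x v (e2 x) * b x)) (at x)"
proof -
  let ?S = "ball x0 r"
  define \<omega> where "\<omega> x v = h x v (e1 x) * a x - h x v (e2 x) * b x" for x v
  have xD: "x \<in> D" if "x \<in> ?S" for x using S that by blast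
  have lin: "linear (\<omega> x)" if "x \<in> ?S" for x
    unfolding \<omega>_def
    by (intro linearI) (simp_all add: linear_add[OF h_lin(2)[OF xD[OF that]]] linear_cmul[OF h_lin(2)[OF xD[OF that]]] algebra_simps)
  have hs: "smooth_on ?S (\<lambda>x. h x v (w x))" if "smooth_on D w" for v w
    by (rule smooth_on_linear_apply[OF open_ball])
      (use S DC that in \<open>auto intro: h_lin(1) smooth_on_subset[OF h_smooth] smooth_on_subset[of D w]\<close>)
  have sm: "smooth_on ?S (\<lambda>x. \<omega> x v)" for v
    unfolding \<omega>_def by (intro smooth_on_diff smooth_on_mult hs e1_smooth e2_smooth a b open_ball)
  have diff: "(\<lambda>y. \<omega> y v) differentiable (at x)" if "x \<in> ?S" for x v
    by (rule smooth_on_differentiable[OF sm open_ball that])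
  have fam: "linear (\<lambda>v. FD (\<lambda>y. \<omega> y v) x w)" if x: "x \<in> ?S" for x w
  proof -
    interpret I: surface_patch C ?S h e1 e2 om kap
      by unfold_locales (use S DC C h_smooth h_bilinear h_sym e1_smooth e2_smooth h11 h22 h12 om_form struct_eqs
        in \<open>auto intro: smooth_on_subset\<close>)
    show ?thesis by (rule I.linear_frechet_derivative_family[OF x lin diff[OF x]])
  qed
  have ext: "ext_deriv \<omega> x (e1 x) (e2 x) = 0" if x: "x \<in> ?S" for x
  proof -
    have id: "FD (\<lambda>x. x) y = (\<lambda>v. v)" for y :: "real^2" by simp
    have cd: "FD f x = FD g x"
      if "\<And>y. y \<in> ?S \<Longrightarrow> f y = g y" "g differentiable (at x)" for f g :: "real^2 \<Rightarrow> real"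
      by (rule frechet_derivative_eqI,
          rule has_derivative_transform_within_open[OF has_frechet_derivative[OF that(2)] open_ball x])
        (simp add: that(1))
    have "FD (\<lambda>y. \<omega> y (e2 y)) x = FD b x"
      "FD (\<lambda>y. \<omega> y (e1 y)) x = FD a x"
      by (rule cd; use xD in \<open>auto simp: \<omega>_def h11 h12 h21 h22 intro: smooth_on_differentiable[OF _ open_ball x] a b\<close>)+
    moreover have "FD (\<lambda>y. \<omega> y (e2 y)) x (e1 x) - FD (\<lambda>y. \<omega> y (e1 y)) x (e2 x)
      = ext_deriv \<omega> x (e1 x) (e2 x) + \<omega> x (FD e2 x (e1 x) - FD e1 x (e2 x))"
      using ext_deriv_along_map(2)[where \<sigma> = "\<lambda>x. x" and \<alpha> = \<omega>, OF open_ball x lin diff[OF x] open_ball x smooth_on_ident[OF open_ball]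
          has_derivative_e(1)[OF xD[OF x]] has_derivative_e(2)[OF xD[OF x]]]
      by (simp only: id)
    moreover have "\<omega> x (G1 x *\<^sub>R e1 x - G2 x *\<^sub>R e2 x) = G1 x * a x - G2 x * b x"
      by (simp only: \<omega>_def h_expand[OF xD[OF x]])
    ultimately show ?thesis using closed[OF x] by (simp add: frame_commutator[OF xD[OF x]] d1_def d2_def)
  qed
  obtain f where "\<And>x. x \<in> ?S \<Longrightarrow> (f has_derivative \<omega> x) (at x)"
  proof (rule closed_form_potential[of x0 r \<omega>])
    show "smooth_form ?S \<omega>" using lin sm by (simp add: smooth_form_def)
    fix x u v assume x: "x \<in> ?S"
    let ?T = "\<lambda>u v. FD (\<lambda>y. \<omega> y v) x u - FD (\<lambda>y. \<omega> y u) x v"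
    have T12: "?T (e1 x) (e2 x) = 0" using ext[OF x] by (simp add: ext_deriv_def)
    note l = linear_frechet_derivative[OF diff[OF x]]
    have lT: "linear (?T u)" for u by (intro linear_compose_sub fam[OF x] l)
    have Tl: "?T w z = h x z (e1 x) * ?T w (e1 x) - h x z (e2 x) * ?T w (e2 x)" for w z
    proof -
      have "?T w z = ?T w (h x z (e1 x) *\<^sub>R e1 x - h x z (e2 x) *\<^sub>R e2 x)"
        by (rule arg_cong[OF frame_expansion[OF xD[OF x]]])
      also have "\<dots> = h x z (e1 x) * ?T w (e1 x) - h x z (e2 x) * ?T w (e2 x)"
        unfolding linear_diff[OF lT] linear_cmul[OF lT] real_scaleR_def by (rule refl)
      finally show ?thesis .
    qed
    have "?T u (e1 x) = 0" "?T u (e2 x) = 0" for u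
      using Tl[of u "e1 x"] Tl[of u "e2 x"] T12 by simp_all
    then show "FD (\<lambda>y. \<omega> y v) x u = FD (\<lambda>y. \<omega> y u) x v"
      using Tl[of v u] by simp
  qed blast
  then show thesis by (intro that) (simp add: \<omega>_def[abs_def])
qed

end

lemma vec2_expand: "(y::real^2) = y$1 *\<^sub>R axis 1 1 + y$2 *\<^sub>R axis 2 1"
  by (simp add: vec_eq_iff forall_2 axis_def)

section \<open>Gradient geometry when the Hessian is a multiple of the metric\<close>

locale hessian_patch = surface_patch +
  fixes q c :: "real^2 \<Rightarrow> real" and sg :: real
  assumes q_smooth: "smooth_on D q" and sg: "sg * sg = 1"
    and hess: "\<And>x. x \<in> D \<Longrightarrow> hess_eq q (c x) x"
    and pos: "\<And>x. x \<in> D \<Longrightarrow> sg * (d1 q x * d1 q x - d2 q x * d2 q x) > 0"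
begin

abbreviation "q1 \<equiv> d1 q"
abbreviation "q2 \<equiv> d2 q"

lemma q11: "x \<in> D \<Longrightarrow> d1 q1 x = G1 x * q2 x + c x" and q12: "x \<in> D \<Longrightarrow> d2 q1 x = G2 x * q2 x"
  and q21: "x \<in> D \<Longrightarrow> d1 q2 x = G1 x * q1 x" and q22: "x \<in> D \<Longrightarrow> d2 q2 x = G2 x * q1 x - c x"
  using hess by (simp_all add: hess_eq_def)

text \<open>The gradient of q is q1 e1 - q2 e2. Its square is \<open>P\<close>, its length is
  \<open>R\<close>, and \<open>Uf\<close> is the unit field along it, signed so that q increases;
  \<open>sg\<close> is the square of \<open>Uf\<close>.\<close>

definition P where "P x = q1 x * q1 x - q2 x * q2 x"
definition R where "R x = sqrt (sg * P x)"
definition Uf where "Uf x = (sg / R x) *\<^sub>R (q1 x *\<^sub>R e1 x - q2 x *\<^sub>R e2 x)"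
definition Vf where "Vf x = q1 x *\<^sub>R e2 x - q2 x *\<^sub>R e1 x"

lemma d_mult:
  fixes f g :: "real^2 \<Rightarrow> real"
  assumes x: "x \<in> D" and "smooth_on D f" "smooth_on D g"
  shows "d1 (\<lambda>x. f x * g x) x = f x * d1 g x + d1 f x * g x" "d2 (\<lambda>x. f x * g x) x = f x * d2 g x + d2 f x * g x"
  using frechet_derivative_eqI[OF has_derivative_mult[OF smooth_on_has_derivative[OF assms(2) D x]
      smooth_on_has_derivative[OF assms(3) D x]]]
  by (simp_all add: d1_def d2_def)

lemma d_diff:
  fixes f g :: "real^2 \<Rightarrow> real"
  assumes x: "x \<in> D" and "smooth_on D f" "smooth_on D g"
  shows "d1 (\<lambda>x. f x - g x) x = d1 f x - d1 g x" "d2 (\<lambda>x. f x - g x) x = d2 f x - d2 g x"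
  using frechet_derivative_eqI[OF has_derivative_diff[OF smooth_on_has_derivative[OF assms(2) D x]
      smooth_on_has_derivative[OF assms(3) D x]]]
  by (simp_all add: d1_def d2_def)

lemma d_divide:
  fixes f g :: "real^2 \<Rightarrow> real"
  assumes x: "x \<in> D" and f: "smooth_on D f" and g: "smooth_on D g" and nz: "\<And>x. x \<in> D \<Longrightarrow> g x \<noteq> 0"
  shows "d1 (\<lambda>x. f x / g x) x = (d1 f x - f x / g x * d1 g x) / g x" "d2 (\<lambda>x. f x / g x) x = (d2 f x - f x / g x * d2 g x) / g x"
proof -
  have fg: "smooth_on D (\<lambda>x. f x / g x)" by (rule smooth_on_divide[OF D f g nz])
  have m: "smooth_on D (\<lambda>x. f x / g x * g x)" by (rule smooth_on_mult[OF D fg g])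
  have "d1 f x = f x / g x * d1 g x + d1 (\<lambda>x. f x / g x) x * g x"
    "d2 f x = f x / g x * d2 g x + d2 (\<lambda>x. f x / g x) x * g x"
    using d_cong[OF x smooth_on_differentiable[OF m D x], of f] d_mult[OF x fg g] nz by simp_all
  then show "d1 (\<lambda>x. f x / g x) x = (d1 f x - f x / g x * d1 g x) / g x" "d2 (\<lambda>x. f x / g x) x = (d2 f x - f x / g x * d2 g x) / g x"
    using nz[OF x] by (simp_all add: field_simps)
qed

lemma q12_smooth: "smooth_on D q1" "smooth_on D q2"
  by (intro smooth_d1 smooth_d2 q_smooth)+

lemma P_smooth: "smooth_on D P"
  unfolding P_def[abs_def] by (intro smooth_on_diff smooth_on_mult q12_smooth D)

lemma sgP: "x \<in> D \<Longrightarrow> sg * P x > 0" using pos by (simp add: P_def)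

lemma P_nz: "x \<in> D \<Longrightarrow> P x \<noteq> 0" using sgP by force

lemma R_pos: "x \<in> D \<Longrightarrow> R x > 0" using sgP by (simp add: R_def)

lemma R_sq: "x \<in> D \<Longrightarrow> R x * R x = sg * P x" using sgP[of x] by (simp add: R_def)

lemma R_smooth: "smooth_on D R"
proof -
  have "smooth_on D (\<lambda>x. (sg * P x) powr (1/2))"
    by (intro smooth_on_powr smooth_on_mult smooth_on_const P_smooth D sgP)
  then show ?thesis
    by (rule smooth_on_cong[OF D, THEN iffD1, rotated]) (simp add: R_def powr_half_sqrt less_imp_le sgP)
qed

text \<open>Contracting the Hessian equation with the gradient gives dP = 2 c dq. Hence
  \<open>P\<close> and \<open>R\<close> vary only with q, the fact behind both closed forms
  below.\<close>

lemma d_P: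
  assumes x: "x \<in> D" shows "d1 P x = 2 * c x * q1 x" "d2 P x = 2 * c x * q2 x"
  unfolding P_def[abs_def]
  by (simp_all add: d_diff[OF x smooth_on_mult[OF D q12_smooth(1) q12_smooth(1)] smooth_on_mult[OF D q12_smooth(2) q12_smooth(2)]]
    d_mult[OF x q12_smooth(1) q12_smooth(1)] d_mult[OF x q12_smooth(2) q12_smooth(2)] q11 q12 q21 q22 x algebra_simps)

lemma d_R:
  assumes x: "x \<in> D" shows "d1 R x = sg * c x * q1 x / R x" "d2 R x = sg * c x * q2 x / R x"
proof -
  have s: "smooth_on D (\<lambda>x. sg * P x)" by (intro smooth_on_mult smooth_on_const P_smooth D)
  have "d1 (\<lambda>x. sg * P x) x = sg * d1 P x" "d2 (\<lambda>x. sg * P x) x = sg * d2 P x"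
    using d_mult[OF x smooth_on_const[OF D, of sg] P_smooth] by (simp_all add: d1_def d2_def)
  then have "2 * (R x * d1 R x) = sg * d1 P x" "2 * (R x * d2 R x) = sg * d2 P x"
    using d_cong[OF x smooth_on_differentiable[OF s D x], of "\<lambda>x. R x * R x"] R_sq d_mult[OF x R_smooth R_smooth] by simp_all
  then show "d1 R x = sg * c x * q1 x / R x" "d2 R x = sg * c x * q2 x / R x"
    using R_pos[OF x] by (simp_all add: d_P x field_simps)
qed

text \<open>The form dq / R stays closed because dR is a multiple of dq.\<close>

lemma closed_s:
  assumes x: "x \<in> D"
  shows "d1 (\<lambda>x. q2 x / R x) x - d2 (\<lambda>x. q1 x / R x) x = G1 x * (q1 x / R x) - G2 x * (q2 x / R x)"
proof -
  have nz: "R x \<noteq> 0" if "x \<in> D" for x using R_pos[OF that] by simp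
  show ?thesis
    using d_divide(2)[OF x q12_smooth(1) R_smooth nz] d_divide(1)[OF x q12_smooth(2) R_smooth nz] nz[OF x]
    by (simp add: q12[OF x] q21[OF x] d_R[OF x] diff_divide_distrib ac_simps)
qed

text \<open>The components q2 / P and q1 / P belong to the metric dual of \<open>Vf\<close> divided
  by the square of \<open>Vf\<close>. The divergence 2 c of the gradient cancels against dP = 2 c
  dq.\<close>

lemma closed_t:
  assumes x: "x \<in> D"
  shows "d1 (\<lambda>x. q1 x / P x) x - d2 (\<lambda>x. q2 x / P x) x = G1 x * (q2 x / P x) - G2 x * (q1 x / P x)"
proof -
  have "d1 (\<lambda>x. q1 x / P x) x - d2 (\<lambda>x. q2 x / P x) x
      = (G1 x * q2 x - G2 x * q1 x + 2 * c x - 2 * c x * ((q1 x * q1 x - q2 x * q2 x) / P x)) / P x"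
    using d_divide(1)[OF x q12_smooth(1) P_smooth P_nz] d_divide(2)[OF x q12_smooth(2) P_smooth P_nz] P_nz[OF x]
    by (simp add: q11[OF x] q22[OF x] d_P[OF x] add_divide_distrib diff_divide_distrib ring_distribs ac_simps)
  also have "(q1 x * q1 x - q2 x * q2 x) / P x = 1" using P_nz[OF x] by (simp add: P_def)
  finally show ?thesis by (simp add: diff_divide_distrib)
qed

lemma UV_smooth: "smooth_on D Uf" "smooth_on D Vf"
  unfolding Uf_def[abs_def] Vf_def[abs_def]
  by (intro smooth_on_scaleR smooth_on_diff smooth_on_divide smooth_on_const q12_smooth e1_smooth e2_smooth R_smooth D;
      use R_pos in force)+

lemma h_UV:
  assumes x: "x \<in> D"
  shows "h x (Uf x) (e1 x) = sg * q1 x / R x" "h x (Uf x) (e2 x) = sg * q2 x / R x"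
    "h x (Vf x) (e1 x) = - q2 x" "h x (Vf x) (e2 x) = - q1 x"
  by (simp_all add: Uf_def Vf_def linear_diff[OF h_lin(2)[OF x]] linear_cmul[OF h_lin(2)[OF x]] x h11 h12 h21 h22)

lemma UV_metric:
  assumes x: "x \<in> D"
  shows "h x (Uf x) (Uf x) = sg" "h x (Vf x) (Vf x) = - sg * (R x)\<^sup>2" "h x (Uf x) (Vf x) = 0" "h x (Vf x) (Uf x) = 0"
proof -
  note l = linear_diff[OF h_lin(1)[OF x]] linear_cmul[OF h_lin(1)[OF x]]
  have hU: "h x w (Uf x) = (sg / R x) * (q1 x * h x w (e1 x) - q2 x * h x w (e2 x))" for w
    by (simp add: Uf_def l)
  have hV: "h x w (Vf x) = q1 x * h x w (e2 x) - q2 x * h x w (e1 x)" for w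
    by (simp add: Vf_def l)
  have sR: "sg * (R x * R x) = P x" using R_sq[OF x] sg by (metis mult.assoc mult_1)
  have Rn: "R x \<noteq> 0" using R_pos[OF x] by simp
  have "h x (Uf x) (Uf x) = (sg * sg) * P x / (R x * R x)"
    unfolding hU h_UV[OF x] P_def using Rn by (simp add: field_simps)
  also have "\<dots> = sg" using sR[symmetric] sg Rn by simp
  finally show "h x (Uf x) (Uf x) = sg" .
  show "h x (Vf x) (Vf x) = - sg * (R x)\<^sup>2"
    unfolding hV h_UV[OF x] using sR by (simp add: P_def power2_eq_square)
  show "h x (Uf x) (Vf x) = 0" unfolding hV h_UV[OF x] by simp
  show "h x (Vf x) (Uf x) = 0" unfolding hU h_UV[OF x] by simp
qed

lemma derivative_UV:
  assumes x: "x \<in> D" and f: "f differentiable (at x)"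
  shows "FD f x (Uf x) = (sg / R x) * (q1 x * d1 f x - q2 x * d2 f x)"
    "FD f x (Vf x) = q1 x * d2 f x - q2 x * d1 f x"
  unfolding frechet_derivative_frame[OF x f] h_UV[OF x] by (simp_all add: right_diff_distrib)

text \<open>In the coordinates below these are the s and t derivatives of q and R: q' = R and R' =
  sg c, which together are the ODE.\<close>

lemma q_UV:
  assumes x: "x \<in> D"
  shows "FD q x (Uf x) = R x" "FD q x (Vf x) = 0"
    "FD R x (Uf x) = sg * c x" "FD R x (Vf x) = 0"
proof -
  note dq = derivative_UV[OF x smooth_on_differentiable[OF q_smooth D x]]
  note dR = derivative_UV[OF x smooth_on_differentiable[OF R_smooth D x]]
  have Rn: "R x \<noteq> 0" using R_pos[OF x] by simp
  have RR: "sg * P x = R x * R x" using R_sq[OF x] by simp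
  have "FD q x (Uf x) = sg * P x / R x" unfolding dq P_def by simp
  then show "FD q x (Uf x) = R x" using Rn RR by simp
  show "FD q x (Vf x) = 0" unfolding dq by simp
  have "FD R x (Uf x) = sg * c x * (sg * P x) / (R x * R x)"
    unfolding dR d_R[OF x] P_def using Rn by (simp add: field_simps)
  then show "FD R x (Uf x) = sg * c x" using Rn RR by simp
  show "FD R x (Vf x) = 0" unfolding dR d_R[OF x] by simp
qed

text \<open>\<open>Uf\<close> and \<open>Vf\<close> are dual to the two closed forms and hence
  become the coordinate fields of their potentials. The inverse function theorem then gives a local
  inverse whose derivative has \<open>Uf\<close> and \<open>Vf\<close> as columns.\<close>

lemma local_coordinates:
  assumes x0: "x0 \<in> D"
  obtains T S :: "(real^2) set" and \<phi> \<psi> :: "real^2 \<Rightarrow> real^2" where "open T" "x0 \<in> T" "T \<subseteq> D" "open S" "homeomorphism T S \<phi> \<psi>"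
    "smooth_on T \<phi>" "\<forall>x\<in>T. FD \<phi> x (Vf x) = axis 2 1"
    "\<forall>y\<in>S. (\<psi> has_derivative (\<lambda>w. w$1 *\<^sub>R Uf (\<psi> y) + w$2 *\<^sub>R Vf (\<psi> y))) (at y)"
proof -
  obtain r where r: "r > 0" "ball x0 r \<subseteq> D" using openE[OF D x0] by blast
  let ?B = "ball x0 r"
  have xD: "x \<in> D" if "x \<in> ?B" for x using r that by blast
  have Rn: "R x \<noteq> 0" if "x \<in> D" for x using R_pos[OF that] by simp
  have as: "smooth_on ?B (\<lambda>x. q1 x / R x)" "smooth_on ?B (\<lambda>x. q2 x / R x)"
    and at: "smooth_on ?B (\<lambda>x. q2 x / P x)" "smooth_on ?B (\<lambda>x. q1 x / P x)"
    by (auto intro!: smooth_on_subset[OF _ r(2)] smooth_on_divide[OF D] q12_smooth R_smooth P_smooth Rn P_nz)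
  obtain s where s: "\<And>x. x \<in> ?B \<Longrightarrow>
      (s has_derivative (\<lambda>v. h x v (e1 x) * (q1 x / R x) - h x v (e2 x) * (q2 x / R x))) (at x)"
    using frame_form_potential[OF r(2) as closed_s[OF xD]] by blast
  obtain t where t: "\<And>x. x \<in> ?B \<Longrightarrow>
      (t has_derivative (\<lambda>v. h x v (e1 x) * (q2 x / P x) - h x v (e2 x) * (q1 x / P x))) (at x)"
    using frame_form_potential[OF r(2) at closed_t[OF xD]] by blast
  define \<phi> :: "real^2 \<Rightarrow> real^2" where "\<phi> x = s x *\<^sub>R axis 1 1 + t x *\<^sub>R axis 2 1" for x
  define d\<phi> :: "real^2 \<Rightarrow> real^2 \<Rightarrow> real^2" where
    "d\<phi> x v = (h x v (e1 x) * (q1 x / R x) - h x v (e2 x) * (q2 x / R x)) *\<^sub>R axis 1 1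
      + (h x v (e1 x) * (q2 x / P x) - h x v (e2 x) * (q1 x / P x)) *\<^sub>R axis 2 1" for x v
  have \<phi>d: "(\<phi> has_derivative d\<phi> x) (at x)" if "x \<in> ?B" for x
    unfolding \<phi>_def[abs_def] d\<phi>_def by (intro has_derivative_add has_derivative_scaleR_left s t that)
  have hs: "smooth_on ?B (\<lambda>x. h x v (w x))" if "smooth_on D w" for v w
    by (rule smooth_on_linear_apply[OF open_ball])
      (use r DC that in \<open>auto intro: h_lin(1) smooth_on_subset[OF h_smooth] smooth_on_subset[of D w]\<close>)
  have d\<phi>_smooth: "smooth_on ?B (\<lambda>x. d\<phi> x v)" for v
    unfolding d\<phi>_def
    by (intro smooth_on_add smooth_on_scaleR smooth_on_diff smooth_on_mult smooth_on_const open_ball as at hs e1_smooth e2_smooth)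
  have \<phi>_smooth: "smooth_on ?B \<phi>" by (rule smooth_on_from_derivative[OF open_ball \<phi>d d\<phi>_smooth])
  define inv\<phi> where "inv\<phi> x w = w$1 *\<^sub>R Uf x + w$2 *\<^sub>R Vf x" for x and w :: "real^2"
  have d\<phi>UV: "d\<phi> x (Uf x) = axis 1 1" "d\<phi> x (Vf x) = axis 2 1" if x: "x \<in> D" for x
  proof -
    have "sg * q1 x / R x * (q1 x / R x) - sg * q2 x / R x * (q2 x / R x) = sg * P x / (R x * R x)"
      by (simp add: P_def diff_divide_distrib right_diff_distrib)
    also have "\<dots> = 1" unfolding R_sq[OF x, symmetric] using Rn[OF x] by simp
    finally have 1: "sg * q1 x / R x * (q1 x / R x) - sg * q2 x / R x * (q2 x / R x) = 1" .
    have "q1 x * (q1 x / P x) - q2 x * (q2 x / P x) = (q1 x * q1 x - q2 x * q2 x) / P x"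
      by (simp add: diff_divide_distrib)
    also have "q1 x * q1 x - q2 x * q2 x = P x" by (simp add: P_def)
    finally have 2: "q1 x * (q1 x / P x) - q2 x * (q2 x / P x) = 1" using P_nz[OF x] by simp
    show "d\<phi> x (Uf x) = axis 1 1" unfolding d\<phi>_def h_UV[OF x] 1 by simp
    show "d\<phi> x (Vf x) = axis 2 1" unfolding d\<phi>_def h_UV[OF x] using 2 by (simp add: mult.commute)
  qed
  have lin1: "linear (d\<phi> x)" if "x \<in> ?B" for x using \<phi>d[OF that] by (rule has_derivative_linear)
  have lin2: "linear (inv\<phi> x)" for x
    by (rule linearI) (simp_all add: inv\<phi>_def algebra_simps)
  have id1: "d\<phi> x \<circ> inv\<phi> x = id" if "x \<in> ?B" for x
    by (rule ext) (simp add: inv\<phi>_def linear_add[OF lin1[OF that]] linear_cmul[OF lin1[OF that]]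
        d\<phi>UV[OF xD[OF that]] vec2_expand[symmetric])
  have id2: "inv\<phi> x \<circ> d\<phi> x = id" if "x \<in> ?B" for x
    using id1[OF that] linear_inverse_left[OF lin1[OF that] lin2] by blast
  have bl: "bounded_linear (d\<phi> x)" if "x \<in> ?B" for x using \<phi>d[OF that] by (rule has_derivative_bounded_linear)
  have bl2: "bounded_linear (inv\<phi> x)" for x using lin2 by (simp add: linear_conv_bounded_linear)
  obtain U' S g g' where I: "open U'" "U' \<subseteq> ?B" "x0 \<in> U'" "open S" "\<phi> x0 \<in> S" "homeomorphism U' S \<phi> g"
    "\<And>y. y \<in> S \<Longrightarrow> (g has_derivative (g' y)) (at y)"
    "\<And>y. y \<in> S \<Longrightarrow> g' y = inv (blinfun_apply (Blinfun (d\<phi> (g y))))"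
  proof (rule inverse_function_theorem[of ?B \<phi> "\<lambda>x. Blinfun (d\<phi> x)" x0 "Blinfun (inv\<phi> x0)"])
    show "(\<phi> has_derivative blinfun_apply (Blinfun (d\<phi> x))) (at x)" if "x \<in> ?B" for x
      using \<phi>d[OF that] bl[OF that] by (simp add: bounded_linear_Blinfun_apply)
    show "continuous_on ?B (\<lambda>x. Blinfun (d\<phi> x))"
    proof (rule continuous_on_blinfun_componentwise)
      fix i :: "real^2"
      show "continuous_on ?B (\<lambda>x. blinfun_apply (Blinfun (d\<phi> x)) i)"
        by (rule continuous_on_eq[OF smooth_on_continuous_on[OF d\<phi>_smooth[of i]]])
          (simp add: bl bounded_linear_Blinfun_apply)
    qed
    show "Blinfun (inv\<phi> x0) o\<^sub>L Blinfun (d\<phi> x0) = id_blinfun"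
      using fun_cong[OF id2, of x0] r(1)
      by (intro blinfun_eqI) (simp add: bl bl2 bounded_linear_Blinfun_apply)
    show "open ?B" "x0 \<in> ?B" using r by auto
  qed blast
  have gU: "g y \<in> U'" if "y \<in> S" for y using I(6) that by (auto simp: homeomorphism_def)
  show thesis
  proof (rule that[of U' S \<phi> g])
    show "smooth_on U' \<phi>" by (rule smooth_on_subset[OF \<phi>_smooth I(2)])
    show "\<forall>x\<in>U'. FD \<phi> x (Vf x) = axis 2 1"
      using frechet_derivative_eqI[OF \<phi>d] d\<phi>UV(2) I(2) xD by (metis subsetD)
    show "\<forall>y\<in>S. (g has_derivative (\<lambda>w. w$1 *\<^sub>R Uf (g y) + w$2 *\<^sub>R Vf (g y))) (at y)"
    proof
      fix y assume that: "y \<in> S"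
      have gB: "g y \<in> ?B" using gU[OF that] I(2) by blast
      have "inv (d\<phi> (g y)) = inv\<phi> (g y)"
        by (rule inv_unique_comp[OF id1[OF gB] id2[OF gB]])
      then have "g' y = inv\<phi> (g y)" using I(8)[OF that] bl[OF gB] by (simp add: bounded_linear_Blinfun_apply)
      then show "(g has_derivative (\<lambda>w. w$1 *\<^sub>R Uf (g y) + w$2 *\<^sub>R Vf (g y))) (at y)"
        using I(7)[OF that] by (simp add: inv\<phi>_def[abs_def])
    qed
  qed (use I r in auto)
qed

lemma adapted_chart:
  fixes F :: "real \<Rightarrow> real"
  assumes x0: "x0 \<in> D" and F: "\<And>x. x \<in> D \<Longrightarrow> c x = F (q x)"
  obtains T S :: "(real^2) set" and \<phi> \<psi> :: "real^2 \<Rightarrow> real^2" and Q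
  where "open T" "x0 \<in> T" "T \<subseteq> D" "open S" "connected S" "homeomorphism T S \<phi> \<psi>"
    "smooth_on T \<phi>" "smooth_on S \<psi>"
    "\<forall>x\<in>T. FD \<phi> x (Vf x) = axis 2 1"
    "\<forall>y\<in>S. \<forall>u v. h (\<psi> y) (FD \<psi> y u) (FD \<psi> y v)
      = sg * (u$1 * v$1 - (deriv Q (y$1))\<^sup>2 * (u$2 * v$2))"
    "\<forall>y\<in>S. q (\<psi> y) = Q (y$1)"
    "strictly_monotone_solution ((\<lambda>x. x$1) ` S) (\<lambda>r. sg * F r) Q"
proof -
  obtain T0 S0 :: "(real^2) set" and \<phi> \<psi> :: "real^2 \<Rightarrow> real^2" where T0: "open T0" "x0 \<in> T0" "T0 \<subseteq> D"
    and S0: "open S0" and hom: "homeomorphism T0 S0 \<phi> \<psi>"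
    and \<phi>s: "smooth_on T0 \<phi>" and \<phi>V: "\<forall>x\<in>T0. FD \<phi> x (Vf x) = axis 2 1"
    and \<psi>d: "\<forall>y\<in>S0. (\<psi> has_derivative (\<lambda>w. w$1 *\<^sub>R Uf (\<psi> y) + w$2 *\<^sub>R Vf (\<psi> y))) (at y)"
    by (rule local_coordinates[OF x0]) (rule that)
  define y0 where "y0 = \<phi> x0"
  have y0: "y0 \<in> S0" using hom T0(2) by (auto simp: y0_def homeomorphism_def)
  \<comment> \<open>In a box the lines of constant s are intervals, so a function with vanishing t
    derivative depends on s alone. A box is also connected.\<close>
  obtain a b where ab: "y0 \<in> box a b" "box a b \<subseteq> S0"
    by (rule open_contains_box[OF S0 y0])
  define S where "S = box a b"
  define T where "T = T0 \<inter> \<phi> -` S"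
  have SS: "S \<subseteq> S0" using ab by (simp add: S_def)
  have Sopen: "open S" by (simp add: S_def open_box)
  have mem: "y \<in> S \<longleftrightarrow> a$1 < y$1 \<and> y$1 < b$1 \<and> a$2 < y$2 \<and> y$2 < b$2" for y
    by (auto simp: S_def mem_box_cart forall_2)
  have Topen: "open T" unfolding T_def
    by (rule continuous_open_preimage[OF smooth_on_continuous_on[OF \<phi>s] T0(1) Sopen])
  have homS: "homeomorphism T S \<phi> \<psi>"
  proof (rule homeomorphism_of_subsets[OF hom])
    show "\<phi> ` T = S"
    proof
      show "S \<subseteq> \<phi> ` T"
      proof
        fix y assume y: "y \<in> S"
        then have "\<psi> y \<in> T0" "\<phi> (\<psi> y) = y" using hom SS by (auto simp: homeomorphism_def)
        then show "y \<in> \<phi> ` T" using y unfolding T_def by (metis IntI image_eqI vimageI)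
      qed
    qed (auto simp: T_def)
  qed (auto simp: T_def SS)
  have \<psi>T: "\<psi> y \<in> T" if "y \<in> S" for y using homS that by (auto simp: homeomorphism_def)
  have TD: "T \<subseteq> D" using T0 by (auto simp: T_def)
  have \<psi>D: "\<psi> y \<in> D" if "y \<in> S" for y using \<psi>T[OF that] TD by blast
  have d\<psi>: "(\<psi> has_derivative (\<lambda>w. w$1 *\<^sub>R Uf (\<psi> y) + w$2 *\<^sub>R Vf (\<psi> y))) (at y)" if "y \<in> S" for y
    using \<psi>d SS that by blast
  \<comment> \<open>Bootstrap: the derivative of the inverse is a smooth expression in the inverse
    itself, so each order of differentiability yields the next.\<close>
  have "Ck_on n S \<psi>" for n
  proof (induction n)
    case 0
    then show ?case using homS by (simp add: homeomorphism_def)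
  next
    case (Suc n)
    have "Ck_on n S (\<lambda>y. w$1 *\<^sub>R Uf (\<psi> y) + w$2 *\<^sub>R Vf (\<psi> y))" for w :: "real^2"
      using UV_smooth unfolding smooth_on_def
      by (intro Ck_on_add Ck_on_bilinear[OF Sopen bounded_bilinear_scaleR] Ck_on_const Sopen
          Ck_on_compose[OF Sopen D Suc _ \<psi>D]) auto
    with d\<psi> show ?case by (intro Ck_on_SucI[OF Sopen]) auto
  qed
  then have \<psi>s: "smooth_on S \<psi>" by (simp add: smooth_on_def)
  have df: "((\<lambda>y. f (\<psi> y)) has_derivative (\<lambda>w. w$1 * FD f (\<psi> y) (Uf (\<psi> y))
      + w$2 * FD f (\<psi> y) (Vf (\<psi> y)))) (at y)"
    if f: "smooth_on D f" and y: "y \<in> S" for f :: "real^2 \<Rightarrow> real" and y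
  proof -
    note l = linear_frechet_derivative[OF smooth_on_differentiable[OF f D \<psi>D[OF y]]]
    show ?thesis
      using diff_chain_at[OF d\<psi>[OF y] smooth_on_has_derivative[OF f D \<psi>D[OF y]]]
      by (simp add: o_def linear_add[OF l] linear_cmul[OF l])
  qed
  define L :: "real \<Rightarrow> real \<Rightarrow> real^2" where "L s t = s *\<^sub>R axis 1 1 + t *\<^sub>R axis 2 1" for s t
  have L12: "L s t $ 1 = s" "L s t $ 2 = t" for s t by (simp_all add: L_def axis_def)
  define J where "J = {a$1<..<b$1}"
  have LS: "L s t \<in> S" if "s \<in> J" "t \<in> {a$2<..<b$2}" for s t
    using that by (simp add: mem L12 J_def)
  have y02: "y0$2 \<in> {a$2<..<b$2}" using ab(1) mem by (simp add: S_def)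
  have J: "(\<lambda>x. x$1) ` S = J"
  proof
    show "(\<lambda>x. x$1) ` S \<subseteq> J" by (auto simp: mem J_def)
    show "J \<subseteq> (\<lambda>x. x$1) ` S"
      using LS[OF _ y02] L12 by (metis (no_types, lifting) image_eqI subsetI)
  qed
  have const: "f (\<psi> y) = f (\<psi> (L (y$1) (y0$2)))"
    if f: "smooth_on D f" and f0: "\<And>x. x \<in> D \<Longrightarrow> FD f x (Vf x) = 0" and y: "y \<in> S"
    for f :: "real^2 \<Rightarrow> real" and y
  proof -
    have yJ: "y$1 \<in> J" "y$2 \<in> {a$2<..<b$2}" using y by (simp_all add: mem J_def)
    have "((\<lambda>t. f (\<psi> (L (y$1) t))) has_real_derivative 0) (at t)"
      if "t \<in> {a$2<..<b$2}" for t
    proof -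
      have "((\<lambda>t. L (y$1) t) has_derivative (\<lambda>h. h *\<^sub>R axis 2 1)) (at t)"
        unfolding L_def by (auto intro!: derivative_eq_intros)
      from diff_chain_at[OF this df[OF f LS[OF yJ(1) that]]]
      show ?thesis
        by (simp add: o_def axis_def has_field_derivative_def lambda_zero f0[OF \<psi>D[OF LS[OF yJ(1) that]]])
    qed
    then have "f (\<psi> (L (y$1) (y$2))) = f (\<psi> (L (y$1) (y0$2)))"
      using yJ(2) by (intro DERIV_isconst3[OF _ yJ(2) y02]) auto
    moreover have "L (y$1) (y$2) = y" by (simp add: L_def vec2_expand[symmetric])
    ultimately show ?thesis by simp
  qed
  \<comment> \<open>Since q has no t derivative, its values on the horizontal segment through the
    base point determine it.\<close>
  define Q where "Q s = q (\<psi> (L s (y0$2)))" for s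
  have dL: "((\<lambda>s. f (\<psi> (L s (y0$2)))) has_real_derivative FD f (\<psi> (L s (y0$2))) (Uf (\<psi> (L s (y0$2))))) (at s)"
    if f: "smooth_on D f" and s: "s \<in> J" for f :: "real^2 \<Rightarrow> real" and s
  proof -
    have "((\<lambda>s. L s (y0$2)) has_derivative (\<lambda>h. h *\<^sub>R axis 1 1)) (at s)"
      unfolding L_def by (auto intro!: derivative_eq_intros)
    from diff_chain_at[OF this df[OF f LS[OF s y02]]]
    show ?thesis by (simp add: o_def axis_def has_field_derivative_def mult_commute_abs)
  qed
  have QD: "(Q has_real_derivative R (\<psi> (L s (y0$2)))) (at s)" if "s \<in> J" for s
    using dL[OF q_smooth that] q_UV(1)[OF \<psi>D[OF LS[OF that y02]]] unfolding Q_def[abs_def] by simp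
  then have dQ: "deriv Q s = R (\<psi> (L s (y0$2)))" if "s \<in> J" for s
    using that DERIV_imp_deriv by blast
  have QDD: "(deriv Q has_real_derivative sg * F (Q s)) (at s)" if s: "s \<in> J" for s
  proof -
    have "((\<lambda>s. R (\<psi> (L s (y0$2)))) has_real_derivative sg * F (Q s)) (at s)"
      using dL[OF R_smooth s] q_UV(3)[OF \<psi>D[OF LS[OF s y02]]] F[OF \<psi>D[OF LS[OF s y02]]]
      by (simp add: Q_def)
    then show ?thesis
      by (rule has_field_derivative_transform_within_open[where S = J]) (use s dQ in \<open>auto simp: J_def\<close>)
  qed
  \<comment> \<open>Q' = R is positive, because \<open>Uf\<close> points in the direction of
    increasing q.\<close>
  have mono: "strict_mono_on J Q"
  proof (rule strict_mono_onI)
    fix r s assume rs: "r \<in> J" "s \<in> J" "r < s"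
    show "Q r < Q s"
    proof (rule DERIV_pos_imp_increasing[OF rs(3)])
      fix x assume "r \<le> x" "x \<le> s"
      then have "x \<in> J" using rs by (auto simp: J_def)
      then show "\<exists>y. (Q has_real_derivative y) (at x) \<and> 0 < y"
        using QD R_pos[OF \<psi>D[OF LS[OF _ y02]]] by blast
    qed
  qed
  show thesis
  proof (rule that[of T S \<phi> \<psi> Q]; (intro ballI allI)?)
    show "x0 \<in> T" using T0 ab by (simp add: T_def S_def y0_def)
    show "connected S" by (simp add: S_def convex_connected convex_box)
    show "smooth_on T \<phi>" by (rule smooth_on_subset[OF \<phi>s]) (auto simp: T_def)
    show "FD \<phi> x (Vf x) = axis 2 1" if "x \<in> T" for x using \<phi>V that by (auto simp: T_def)
    show "q (\<psi> y) = Q (y$1)" if "y \<in> S" for y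
      unfolding Q_def by (rule const[OF q_smooth q_UV(2) that])
    show "strictly_monotone_solution ((\<lambda>x. x$1) ` S) (\<lambda>r. sg * F r) Q"
      unfolding strictly_monotone_solution_def J using mono QD QDD dQ by simp
    fix y u v assume y: "y \<in> S"
    note hl = linear_add[OF h_lin(1)[OF \<psi>D[OF y]]] linear_cmul[OF h_lin(1)[OF \<psi>D[OF y]]]
      linear_add[OF h_lin(2)[OF \<psi>D[OF y]]] linear_cmul[OF h_lin(2)[OF \<psi>D[OF y]]]
    have "deriv Q (y$1) = R (\<psi> y)"
      using dQ const[OF R_smooth q_UV(4) y] y by (simp add: mem J_def)
    then show "h (\<psi> y) (FD \<psi> y u) (FD \<psi> y v)
      = sg * (u$1 * v$1 - (deriv Q (y$1))\<^sup>2 * (u$2 * v$2))"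
      unfolding frechet_derivative_eqI[OF d\<psi>[OF y]]
      by (simp add: hl UV_metric[OF \<psi>D[OF y]] algebra_simps)
  qed (use Topen TD Sopen homS \<psi>s in auto)
qed

end

subsection \<open>Charts of the surface\<close>

lemma chart_homeomorphism: "is_chart c \<Longrightarrow> homeomorphism (chart_dom c) (chart_img c) (coord c) (pt c)"
  by (simp add: is_chart_def)

lemma pt_coord: "is_chart c \<Longrightarrow> m \<in> chart_dom c \<Longrightarrow> pt c (coord c m) = m"
  using chart_homeomorphism by (metis homeomorphism_apply1)

lemma coord_image_eq:
  assumes "is_chart c"
  shows "coord c ` (chart_dom c \<inter> W) = chart_img c \<inter> pt c -` W"
  using pt_coord[OF assms] by auto

lemma open_coord_image:
  assumes c: "is_chart c" and W: "open W"
  shows "open (coord c ` (chart_dom c \<inter> W))"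
  unfolding coord_image_eq[OF c]
  by (rule continuous_open_preimage[OF _ _ W]) (use c in \<open>auto simp: is_chart_def homeomorphism_def\<close>)

text \<open>Maximality of the atlas makes the new coordinates a member of \<open>A\<close> once they
  are smoothly compatible with each of its charts.\<close>

lemma chart_refine:
  fixes c :: "'m::{t2_space, second_countable_topology} chart"
  assumes M: "smooth_surface M A" and cA: "c \<in> A"
    and T: "open T" "T \<subseteq> chart_img c" and S: "open S" and hom: "homeomorphism T S \<phi> \<psi>"
    and \<phi>: "smooth_on T \<phi>" and \<psi>: "smooth_on S \<psi>"
  defines "c' \<equiv> (chart_dom c \<inter> coord c -` T, \<lambda>m. \<phi> (coord c m))"
  shows "c' \<in> A" "chart_img c' = S" "\<And>y. y \<in> S \<Longrightarrow> pt c' y = pt c (\<psi> y)"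
proof -
  have ch: "is_chart d" if "d \<in> A" for d using M that by (simp add: smooth_surface_def)
  note c = ch[OF cA]
  let ?U = "chart_dom c \<inter> coord c -` T"
  have homU: "homeomorphism ?U T (coord c) (pt c)"
    by (rule homeomorphism_of_subsets[OF chart_homeomorphism[OF c]]) (use T in auto)
  have hom': "homeomorphism ?U S (\<phi> \<circ> coord c) (pt c \<circ> \<psi>)"
    by (rule homeomorphism_compose[OF homU hom])
  show img: "chart_img c' = S"
    using homeomorphism_image1[OF hom'] by (simp add: c'_def o_def)
  have inj: "inj_on (\<lambda>m. \<phi> (coord c m)) ?U"
    using homeomorphism_apply1[OF hom'] by (intro inj_on_inverseI[where g = "pt c \<circ> \<psi>"]) simp
  show pt': "pt c' y = pt c (\<psi> y)" if "y \<in> S" for y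
    unfolding c'_def fst_conv snd_conv
  proof (rule inv_into_f_eq[OF inj])
    show "pt c (\<psi> y) \<in> ?U" using homeomorphism_image2[OF hom'] that by (simp add: set_eq_iff image_iff) blast
    show "\<phi> (coord c (pt c (\<psi> y))) = y" using homeomorphism_apply2[OF hom' that] by simp
  qed
  have Uopen: "open ?U"
    by (rule continuous_open_preimage[OF _ _ T(1)]) (use c in \<open>auto simp: is_chart_def homeomorphism_def\<close>)
  have c': "is_chart c'"
    unfolding is_chart_def img
  proof (intro conjI S)
    show "open (chart_dom c')" by (simp add: c'_def Uopen)
    show "homeomorphism (chart_dom c') S (coord c') (pt c')"
      by (rule homeomorphism_cong[OF hom']) (auto simp: c'_def pt'[unfolded c'_def fst_conv snd_conv])
  qed
  have "compatible c' d" if d: "d \<in> A" for d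
  proof -
    note dc = ch[OF d]
    have comp: "smooth_on (coord c ` (chart_dom c \<inter> chart_dom d)) (coord d \<circ> pt c)"
      "smooth_on (coord d ` (chart_dom c \<inter> chart_dom d)) (coord c \<circ> pt d)"
      using M cA d by (simp_all add: smooth_surface_def compatible_def)
    have od: "open (chart_dom d)" using dc by (simp add: is_chart_def)
    have oc: "open (chart_dom c)" using c by (simp add: is_chart_def)
    let ?O1 = "coord c' ` (chart_dom c' \<inter> chart_dom d)" and ?O2 = "coord d ` (chart_dom c' \<inter> chart_dom d)"
    have O1: "open ?O1" by (rule open_coord_image[OF c' od])
    have O1S: "?O1 \<subseteq> S" using img by blast
    have O2: "open ?O2"
      using open_coord_image[OF dc Uopen] by (simp add: c'_def Int_commute)
    have \<psi>\<phi>: "\<psi> (\<phi> x) = x" if "x \<in> T" for x using hom that by (rule homeomorphism_apply1)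
    have "smooth_on ?O1 (\<lambda>y. (coord d \<circ> pt c) (\<psi> y))"
      by (rule smooth_on_compose[OF O1 open_coord_image[OF c od] smooth_on_subset[OF \<psi> O1S] comp(1)])
        (auto simp: c'_def \<psi>\<phi>)
    then have 1: "smooth_on ?O1 (coord d \<circ> pt c')"
      by (rule smooth_on_cong[OF O1, THEN iffD1, rotated]) (use O1S pt' in auto)
    have "smooth_on ?O2 (\<lambda>x. \<phi> ((coord c \<circ> pt d) x))"
      by (rule smooth_on_compose[OF O2 T(1) smooth_on_subset[OF comp(2)] \<phi>]) (auto simp: c'_def pt_coord[OF dc])
    then have 2: "smooth_on ?O2 (coord c' \<circ> pt d)" by (simp add: c'_def o_def)
    show "compatible c' d" using 1 2 by (simp add: compatible_def)
  qed
  moreover have "chart_dom c' \<subseteq> M" using M cA by (auto simp: smooth_surface_def c'_def)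
  ultimately show "c' \<in> A" using M c' unfolding smooth_surface_def by blast
qed

lemma chart_change_has_derivative:
  fixes c d :: "'m::{t2_space, second_countable_topology} chart"
  assumes M: "smooth_surface M A" and cd: "c \<in> A" "d \<in> A" and p: "p \<in> chart_dom c" "p \<in> chart_dom d"
  shows "((coord d \<circ> pt c) has_derivative chart_change c d (coord c p)) (at (coord c p))"
proof -
  have "is_chart c" "open (chart_dom d)" using M cd by (auto simp: smooth_surface_def is_chart_def)
  then have o: "open (coord c ` (chart_dom c \<inter> chart_dom d))" by (rule open_coord_image)
  have "smooth_on (coord c ` (chart_dom c \<inter> chart_dom d)) (coord d \<circ> pt c)"
    using M cd by (simp add: smooth_surface_def compatible_def)
  from smooth_on_has_derivative[OF this o] show ?thesis using p by (auto simp: chart_change_def)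
qed

lemma surface_patch_of_chart:
  fixes c :: "'m::{t2_space, second_countable_topology} chart"
  assumes M: "smooth_surface M A" and g: "lorentzian_metric A g" and K: "structure_equations A g eta12 K"
    and W: "open W" and E: "orthonormal_framing A g W E1 E2" and c: "c \<in> A"
  shows "surface_patch (chart_img c) (coord c ` (chart_dom c \<inter> W)) (g c) (E1 c) (E2 c) (eta12 c) (\<lambda>x. K (pt c x))"
proof
  have ch: "is_chart c" using M c by (simp add: smooth_surface_def)
  show "open (chart_img c)" using ch by (simp add: is_chart_def)
  show "open (coord c ` (chart_dom c \<inter> W))" by (rule open_coord_image[OF ch W])
  show "coord c ` (chart_dom c \<inter> W) \<subseteq> chart_img c" by blast
  show "smooth_on (chart_img c) (\<lambda>x. g c x u v)" for u v using g c by (simp add: lorentzian_metric_def)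
  show "bilinear (g c x)" "g c x u v = g c x v u" if "x \<in> chart_img c" for x u v
    using g c that unfolding lorentzian_metric_def by blast+
  show "smooth_on (coord c ` (chart_dom c \<inter> W)) (E1 c)" "smooth_on (coord c ` (chart_dom c \<inter> W)) (E2 c)"
    using E c by (simp_all add: orthonormal_framing_def vector_field_on_def)
  show "g c x (E1 c x) (E1 c x) = 1" "g c x (E2 c x) (E2 c x) = -1" "g c x (E1 c x) (E2 c x) = 0"
    if "x \<in> coord c ` (chart_dom c \<inter> W)" for x
    using E c that unfolding orthonormal_framing_def by blast+
  show "smooth_form {y. fst y \<in> chart_img c} (eta12 c)"
    using K c unfolding structure_equations_def by blast
  show "ext_deriv (eta1 (g c)) y X Y = - wedge (eta12 c y) (eta2 (g c) y) X Y \<and>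
          ext_deriv (eta2 (g c)) y X Y = - wedge (eta12 c y) (eta1 (g c) y) X Y \<and>
          ext_deriv (eta12 c) y X Y = - K (pt c (fst y)) * wedge (eta1 (g c) y) (eta2 (g c) y) X Y"
    if "y \<in> frame_bundle (chart_img c) (g c)" "X \<in> tangent_vectors (frame_bundle (chart_img c) (g c)) y"
      "Y \<in> tangent_vectors (frame_bundle (chart_img c) (g c)) y" for y X Y
    using K c that unfolding structure_equations_def by blast
qed

lemma darboux_hessian:
  fixes M :: "'m::{t2_space, second_countable_topology} set"
  assumes M: "smooth_surface M A" and g: "lorentzian_metric A g" and K: "structure_equations A g eta12 K"
    and eps: "eps = 1 \<or> eps = -1" and sgnK: "\<forall>p\<in>M. sgn (K p) = eps" and dar: "darboux_integrable A g eta12 K"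
    and q: "q = (\<lambda>p. \<bar>K p\<bar> powr (-3/4))" and W: "open W" "W \<subseteq> M" and E: "orthonormal_framing A g W E1 E2"
    and c: "c \<in> A"
  defines "D \<equiv> coord c ` (chart_dom c \<inter> W)"
  shows "\<And>x. x \<in> D \<Longrightarrow>
      surface_patch.hess_eq (E1 c) (E2 c) (eta12 c) (q \<circ> pt c) (3 * q (pt c x) * K (pt c x)) x"
    "smooth_on D (q \<circ> pt c)"
proof -
  interpret S: surface_patch "chart_img c" D "g c" "E1 c" "E2 c" "eta12 c" "\<lambda>x. K (pt c x)"
    unfolding D_def by (rule surface_patch_of_chart[OF M g K W(1) E c])
  have ch: "is_chart c" using M c by (simp add: smooth_surface_def)
  have sK: "sgn (K (pt c x)) = eps" if "x \<in> D" for x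
    using that sgnK W(2) pt_coord[OF ch] by (auto simp: D_def)
  have qe: "q \<circ> pt c = (\<lambda>x. \<bar>K (pt c x)\<bar> powr (-3/4))" by (simp add: q o_def)
  have y: "(S.sec x, f) \<in> frame_bundle (chart_img c) (g c) \<times> mink_frame_bundle" "fst (fst (S.sec x, f)) = x"
    if "x \<in> D" "f \<in> mink_frame_bundle" for x f
    using S.sec_bundle that by (auto simp: S.sec_def)
  show "S.hess_eq (q \<circ> pt c) (3 * q (pt c x) * K (pt c x)) x"
    if x: "x \<in> D" for x
    using eps
  proof
    assume e: "eps = 1"
    have "K (pt c x) > 0" using sK[OF x] e by (simp add: sgn_if split: if_splits)
    then have "has_transverse_frobenius (frame_bundle (chart_img c) (g c) \<times> mink_frame_bundle)
         (map scalar_ext (theta_forms (g c) (eta12 c)))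
         (singular_system (g c) (eta12 c) (\<lambda>x. sqrt \<bar>K (pt c x)\<bar>) \<i>) (S.sec x, f)"
      if "f \<in> mink_frame_bundle" for f
      using dar c y[OF x that] unfolding darboux_integrable_def singular_system_darboux_def by metis
    from S.hessian_q[OF x eps _ sK this] show ?thesis by (simp add: q e o_def)
  next
    assume e: "eps = -1"
    have "K (pt c x) < 0" using sK[OF x] e by (simp add: sgn_if split: if_splits)
    then have "has_transverse_frobenius (frame_bundle (chart_img c) (g c) \<times> mink_frame_bundle)
         (map scalar_ext (theta_forms (g c) (eta12 c)))
         (singular_system (g c) (eta12 c) (\<lambda>x. sqrt \<bar>K (pt c x)\<bar>) (1::real)) (S.sec x, f)"
      if "f \<in> mink_frame_bundle" for f
      using dar c y[OF x that] unfolding darboux_integrable_def singular_system_darboux_def by metis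
    from S.hessian_q[OF x eps _ sK this] show ?thesis by (simp add: q e o_def)
  qed
  have "smooth_on D (\<lambda>x. (eps * K (pt c x)) powr (-3/4))"
    by (intro smooth_on_powr smooth_on_mult smooth_on_const S.kap_smooth S.D)
      (use sK eps in \<open>force simp: sgn_if split: if_splits\<close>)
  then show "smooth_on D (q \<circ> pt c)"
    by (rule smooth_on_cong[OF S.D, THEN iffD1, rotated])
      (use sK eps in \<open>force simp: q sgn_if split: if_splits\<close>)
qed

text \<open>By the chain rule the coefficients dq(e_i) do not depend on the chart, and the framing
  fields transform as vectors.\<close>

lemma skew_gradient_transform:
  fixes M :: "'m::{t2_space, second_countable_topology} set"
  assumes M: "smooth_surface M A" and E: "orthonormal_framing A g W E1 E2" and cd: "c \<in> A" "d \<in> A"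
    and p: "p \<in> chart_dom c \<inter> chart_dom d \<inter> W" and q: "(q \<circ> pt d) differentiable (at (coord d p))"
  shows "skew_gradient q E1 E2 d (coord d p) = chart_change c d (coord c p) (skew_gradient q E1 E2 c (coord c p))"
proof -
  have ch: "is_chart c" "is_chart d" using M cd by (simp_all add: smooth_surface_def)
  have pcd: "p \<in> chart_dom c" "p \<in> chart_dom d" using p by auto
  note t = chart_change_has_derivative[OF M cd pcd]
  have "open (chart_dom d)" using ch(2) by (simp add: is_chart_def)
  note o = open_coord_image[OF ch(1) this]
  have ptp: "(coord d \<circ> pt c) (coord c p) = coord d p" using pt_coord[OF ch(1) pcd(1)] by simp
  have "((q \<circ> pt d) \<circ> (coord d \<circ> pt c) has_derivative
      FD (q \<circ> pt d) (coord d p) \<circ> chart_change c d (coord c p)) (at (coord c p))"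
    by (rule diff_chain_at[OF t]) (simp only: ptp has_frechet_derivative[OF q])
  then have "((q \<circ> pt c) has_derivative
      FD (q \<circ> pt d) (coord d p) \<circ> chart_change c d (coord c p)) (at (coord c p))"
    by (rule has_derivative_transform_within_open[OF _ o])
      (use p in \<open>auto simp: pt_coord[OF ch(1)] pt_coord[OF ch(2)]\<close>)
  note dq = frechet_derivative_eqI[OF this]
  have E12: "E1 d (coord d p) = chart_change c d (coord c p) (E1 c (coord c p))"
    "E2 d (coord d p) = chart_change c d (coord c p) (E2 c (coord c p))"
    using E cd p unfolding orthonormal_framing_def vector_field_on_def by blast+
  note l = has_derivative_linear[OF t]
  show ?thesis
    by (simp add: skew_gradient_def framed_deriv_def dq E12 linear_diff[OF l] linear_cmul[OF l])
qed

theorem theorem10: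
  fixes M :: "'m::{t2_space, second_countable_topology} set"
    and A :: "'m chart set"
    and g :: "'m metric"
    and eta12 :: "'m connection"
    and K q :: "'m \<Rightarrow> real"
    and eps :: real
    and W :: "'m set"
    and E1 E2 V :: "'m vfield"
  assumes "smooth_surface M A"
    and "lorentzian_metric A g"
    and "structure_equations A g eta12 K"
    and "eps = 1 \<or> eps = -1"
    and "\<forall>p\<in>M. sgn (K p) = eps"
    and "darboux_integrable A g eta12 K"
    and "q = (\<lambda>p. \<bar>K p\<bar> powr (-3/4))"
    and "open W" and "W \<subseteq> M" and "orthonormal_framing A g W E1 E2"
    and "V = skew_gradient q E1 E2"
  shows "killing_field_on A g W V \<and>
    (\<forall>p\<in>W. spacelike_at A g V p \<longrightarrow>
      (\<exists>c\<in>A. p \<in> chart_dom c \<and> chart_dom c \<subseteq> W \<and> connected (chart_dom c) \<and>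
        (\<exists>Q.
          strictly_monotone_solution ((\<lambda>x. x$1) ` chart_img c) (\<lambda>r. 3 * eps * r powr (-1/3)) Q \<and>
          (\<forall>m\<in>chart_dom c. q m = Q (coord c m $ 1)) \<and>
          (\<forall>x\<in>chart_img c. \<forall>u v.
             g c x u v = u$1 * v$1 - (deriv Q (x$1))\<^sup>2 * (u$2 * v$2)) \<and>
          (\<forall>x\<in>chart_img c. V c x = axis 2 1)))) \<and>
    (\<forall>p\<in>W. timelike_at A g V p \<longrightarrow>
      (\<exists>c\<in>A. p \<in> chart_dom c \<and> chart_dom c \<subseteq> W \<and> connected (chart_dom c) \<and>
        (\<exists>Q.
          strictly_monotone_solution ((\<lambda>x. x$1) ` chart_img c) (\<lambda>r. - 3 * eps * r powr (-1/3)) Q \<and>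
          (\<forall>m\<in>chart_dom c. q m = Q (coord c m $ 1)) \<and>
          (\<forall>x\<in>chart_img c. \<forall>u v.
             g c x u v = (deriv Q (x$1))\<^sup>2 * (u$2 * v$2) - u$1 * v$1) \<and>
          (\<forall>x\<in>chart_img c. V c x = axis 2 1))))"
proof -
  note M = assms(1) and g = assms(2) and K = assms(3) and eps = assms(4) and sgnK = assms(5) and dar = assms(6)
    and q = assms(7) and W = assms(8,9) and E = assms(10) and V = assms(11)
  let ?D = "\<lambda>c. coord c ` (chart_dom c \<inter> W)"
  note patch = surface_patch_of_chart[OF M g K W(1) E]
  note hess = darboux_hessian[OF M g K eps sgnK dar q W E]
  have ch: "is_chart c" if "c \<in> A" for c using M that by (simp add: smooth_surface_def)
  have Vtrans: "V d (coord d p) = chart_change c d (coord c p) (V c (coord c p))"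
    if cd: "c \<in> A" "d \<in> A" and p: "p \<in> chart_dom c \<inter> chart_dom d \<inter> W" for c d p
  proof -
    interpret S: surface_patch "chart_img d" "?D d" "g d" "E1 d" "E2 d" "eta12 d" "\<lambda>x. K (pt d x)"
      by (rule patch[OF cd(2)])
    have "(q \<circ> pt d) differentiable (at (coord d p))"
      by (rule smooth_on_differentiable[OF hess(2)[OF cd(2)] S.D]) (use p in auto)
    from skew_gradient_transform[OF M E cd p this] show ?thesis by (simp add: V)
  qed
  have Vsmooth: "smooth_on (?D c) (V c)" and lie: "\<And>x u v. x \<in> ?D c \<Longrightarrow> lie_derivative_metric g V c x u v = 0"
    if c: "c \<in> A" for c
  proof -
    interpret S: surface_patch "chart_img c" "?D c" "g c" "E1 c" "E2 c" "eta12 c" "\<lambda>x. K (pt c x)"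
      by (rule patch[OF c])
    have Vc: "V c = (\<lambda>x. S.d1 (q \<circ> pt c) x *\<^sub>R E2 c x - S.d2 (q \<circ> pt c) x *\<^sub>R E1 c x)"
      by (rule ext) (simp add: V skew_gradient_def framed_deriv_def S.d1_def S.d2_def)
    show "smooth_on (?D c) (V c)" unfolding Vc
      by (intro smooth_on_diff smooth_on_scaleR S.smooth_d1 S.smooth_d2 hess(2)[OF c] S.e1_smooth S.e2_smooth S.D)
    show "lie_derivative_metric g V c x u v = 0" if x: "x \<in> ?D c" for x u v
      using S.lie_skew_gradient[OF x hess(2)[OF c] hess(1)[OF c x]]
      unfolding S.lie_def lie_derivative_metric_def Vc by simp
  qed
  have killing: "killing_field_on A g W V"
    unfolding killing_field_on_def vector_field_on_def using Vsmooth Vtrans lie by blast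
  \<comment> \<open>The square of V is minus that of the gradient, so sg = 1 is the spacelike and sg
    = -1 the timelike case. Factoring out sg unites the two metrics and the two equations.\<close>
  have normal_form: "\<exists>c'\<in>A. p \<in> chart_dom c' \<and> chart_dom c' \<subseteq> W \<and> connected (chart_dom c') \<and>
        (\<exists>Q. strictly_monotone_solution ((\<lambda>x. x$1) ` chart_img c') (\<lambda>r. sg * (3 * eps * r powr (-1/3))) Q \<and>
          (\<forall>m\<in>chart_dom c'. q m = Q (coord c' m $ 1)) \<and>
          (\<forall>x\<in>chart_img c'. \<forall>u v. g c' x u v = sg * (u$1 * v$1 - (deriv Q (x$1))\<^sup>2 * (u$2 * v$2))) \<and>
          (\<forall>x\<in>chart_img c'. V c' x = axis 2 1))"
    if p: "p \<in> W" and c: "c \<in> A" and pc: "p \<in> chart_dom c" and sg: "sg * sg = 1"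
      and pos: "- sg * g c (coord c p) (V c (coord c p)) (V c (coord c p)) > 0" for p c sg
  proof -
    interpret S: surface_patch "chart_img c" "?D c" "g c" "E1 c" "E2 c" "eta12 c" "\<lambda>x. K (pt c x)"
      by (rule patch[OF c])
    define qc where "qc = q \<circ> pt c"
    have Vc: "V c = (\<lambda>x. S.d1 qc x *\<^sub>R E2 c x - S.d2 qc x *\<^sub>R E1 c x)"
      by (rule ext) (simp add: V qc_def skew_gradient_def framed_deriv_def S.d1_def S.d2_def)
    have qcs: "smooth_on (?D c) qc" unfolding qc_def by (rule hess(2)[OF c])
    have gVV: "g c x (V c x) (V c x) = - (S.d1 qc x * S.d1 qc x - S.d2 qc x * S.d2 qc x)" if x: "x \<in> ?D c" for x
    proof -
      note l = linear_diff[OF S.h_lin(1)[OF x]] linear_cmul[OF S.h_lin(1)[OF x]]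
        linear_diff[OF S.h_lin(2)[OF x]] linear_cmul[OF S.h_lin(2)[OF x]]
      show ?thesis
        unfolding Vc l by (simp add: l S.h11[OF x] S.h22[OF x] S.h12[OF x] S.h21[OF x])
    qed
    define P where "P x = sg * (S.d1 qc x * S.d1 qc x - S.d2 qc x * S.d2 qc x)" for x
    \<comment> \<open>Near the point the gradient keeps its causal character; on this open set its
      length is smooth and positive.\<close>
    define D where "D = ?D c \<inter> P -` {0<..}"
    have Ps: "smooth_on (?D c) P" unfolding P_def
      by (intro smooth_on_mult smooth_on_diff smooth_on_const S.smooth_d1 S.smooth_d2 qcs S.D)
    have Dopen: "open D" unfolding D_def
      by (rule continuous_open_preimage[OF smooth_on_continuous_on[OF Ps] S.D open_greaterThan])
    have DD: "D \<subseteq> ?D c" by (auto simp: D_def)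
    have x0: "coord c p \<in> D"
    proof -
      have pD: "coord c p \<in> ?D c" using p pc by blast
      have "P (coord c p) = - sg * g c (coord c p) (V c (coord c p)) (V c (coord c p))"
        unfolding gVV[OF pD] P_def by (simp add: algebra_simps)
      then show ?thesis using pos pD by (simp add: D_def)
    qed
    interpret T: hessian_patch "chart_img c" D "g c" "E1 c" "E2 c" "eta12 c" "\<lambda>x. K (pt c x)" qc
      "\<lambda>x. 3 * q (pt c x) * K (pt c x)" sg
    proof unfold_locales
      show "smooth_on D (E1 c)" "smooth_on D (E2 c)" "smooth_on D qc"
        using smooth_on_subset[OF S.e1_smooth DD] smooth_on_subset[OF S.e2_smooth DD] smooth_on_subset[OF qcs DD] .
      show "sg * (S.d1 qc x * S.d1 qc x - S.d2 qc x * S.d2 qc x) > 0" if "x \<in> D" for x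
        using that by (simp add: D_def P_def)
    qed (use Dopen DD S.C S.DC S.h_smooth S.h_bilinear S.h_sym S.h11 S.h22 S.h12 S.om_form S.struct_eqs sg
        hess(1)[OF c] in \<open>auto simp: qc_def\<close>)
    \<comment> \<open>From q = |K|^(-3/4) it follows that K = eps q^(-4/3), so the Hessian factor 3
      q K is a function of q alone.\<close>
    have F: "3 * q (pt c x) * K (pt c x) = 3 * eps * qc x powr (-1/3)" if x: "x \<in> D" for x
    proof -
      have "x \<in> ?D c" using x DD by blast
      then have "pt c x \<in> M" using W(2) unfolding coord_image_eq[OF ch[OF c]] by auto
      then have s: "sgn (K (pt c x)) = eps" using sgnK by blast
      then have "K (pt c x) = eps * \<bar>K (pt c x)\<bar>" "\<bar>K (pt c x)\<bar> > 0"
        using eps by (auto simp: sgn_if split: if_splits)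
      moreover have "y powr (-3/4) * y = (y powr (-3/4)) powr (-1/3)" if "y > 0" for y :: real
      proof -
        have "y powr (-3/4) * y = y powr (-3/4) * y powr 1" using that by simp
        also have "\<dots> = y powr (1/4)" by (simp only: powr_add[symmetric]) simp
        finally show ?thesis by (simp add: powr_powr)
      qed
      ultimately have "\<bar>K (pt c x)\<bar> powr (-3/4) * \<bar>K (pt c x)\<bar> = qc x powr (-1/3)" by (simp add: qc_def q)
      then show ?thesis using \<open>K (pt c x) = eps * \<bar>K (pt c x)\<bar>\<close>
        by (metis (no_types, lifting) mult.assoc mult.left_commute q)
    qed
    obtain T S :: "(real^2) set" and \<phi> \<psi> :: "real^2 \<Rightarrow> real^2" and Q where T: "open T" "coord c p \<in> T" "T \<subseteq> D" and S: "open S" "connected S"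
      and hom: "homeomorphism T S \<phi> \<psi>" and sm: "smooth_on T \<phi>" "smooth_on S \<psi>"
      and \<phi>V: "\<forall>x\<in>T. FD \<phi> x (T.Vf x) = axis 2 1"
      and met: "\<forall>y\<in>S. \<forall>u v. g c (\<psi> y) (FD \<psi> y u) (FD \<psi> y v)
        = sg * (u$1 * v$1 - (deriv Q (y$1))\<^sup>2 * (u$2 * v$2))"
      and qQ: "\<forall>y\<in>S. qc (\<psi> y) = Q (y$1)"
      and sol: "strictly_monotone_solution ((\<lambda>x. x$1) ` S) (\<lambda>r. sg * (3 * eps * r powr (-1/3))) Q"
      by (rule T.adapted_chart[OF x0, of "\<lambda>r. 3 * eps * r powr (-1/3)", OF F]) (assumption, rule that)
    have Timg: "T \<subseteq> chart_img c" using T(3) DD by blast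
    define c' where "c' = (chart_dom c \<inter> coord c -` T, \<lambda>m. \<phi> (coord c m))"
    note cr = chart_refine[OF M c T(1) Timg S(1) hom sm, folded c'_def]
    have dom: "chart_dom c' \<subseteq> chart_dom c" "chart_dom c' \<subseteq> W"
    proof -
      show "chart_dom c' \<subseteq> chart_dom c" by (auto simp: c'_def)
      show "chart_dom c' \<subseteq> W"
      proof
        fix m assume "m \<in> chart_dom c'"
        then have m: "m \<in> chart_dom c" "coord c m \<in> ?D c" using T(3) DD by (auto simp: c'_def)
        then show "m \<in> W" unfolding coord_image_eq[OF ch[OF c]] by (simp add: pt_coord[OF ch[OF c]])
      qed
    qed
    have point: "\<exists>m. m \<in> chart_dom c' \<and> m \<in> chart_dom c \<and> m \<in> W \<and> coord c' m = y \<and> coord c m = \<psi> y \<and> \<psi> y \<in> T"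
      if y: "y \<in> S" for y
    proof -
      obtain m where m: "m \<in> chart_dom c'" "coord c' m = y" using y cr(2) by auto
      then have "coord c m \<in> T" "\<phi> (coord c m) = y" by (auto simp: c'_def)
      then have "coord c m = \<psi> y" using homeomorphism_apply1[OF hom] by metis
      then show ?thesis using m dom \<open>coord c m \<in> T\<close> by auto
    qed
    show ?thesis
    proof (intro bexI[of _ c'] conjI exI[of _ Q] ballI allI cr(1))
      show "p \<in> chart_dom c'" using pc T(2) by (simp add: c'_def)
      show "chart_dom c' \<subseteq> W" by (rule dom(2))
      have "homeomorphism (chart_dom c') S (coord c') (pt c')"
        using chart_homeomorphism[OF ch[OF cr(1)]] cr(2) by simp
      then have "chart_dom c' = pt c' ` S" "continuous_on S (pt c')" by (auto simp: homeomorphism_def)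
      then show "connected (chart_dom c')" using S(2) connected_continuous_image by metis
      show "strictly_monotone_solution ((\<lambda>x. x$1) ` chart_img c') (\<lambda>r. sg * (3 * eps * r powr (-1/3))) Q"
        unfolding cr(2) by (rule sol)
      show "q m = Q (coord c' m $ 1)" if m: "m \<in> chart_dom c'" for m
      proof -
        have mS: "coord c' m \<in> S" using cr(2) m by blast
        have "\<psi> (coord c' m) = coord c m" using m homeomorphism_apply1[OF hom] by (simp add: c'_def)
        then show ?thesis using qQ mS pt_coord[OF ch[OF c], of m] m dom by (metis comp_apply qc_def subsetD)
      qed
      fix y assume "y \<in> chart_img c'"
      then have y: "y \<in> S" by (simp only: cr(2))
      obtain m where m: "m \<in> chart_dom c'" "m \<in> chart_dom c" "m \<in> W" "coord c' m = y" "coord c m = \<psi> y" "\<psi> y \<in> T"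
        using point[OF y] by blast
      show "V c' y = axis 2 1"
      proof -
        \<comment> \<open>The change from the old to the new chart is the coordinate map on
          \<open>T\<close>, which sends \<open>Vf\<close> to the second axis.\<close>
        have "(\<phi> has_derivative chart_change c c' (coord c m)) (at (coord c m))"
        proof (rule has_derivative_transform_within_open[OF chart_change_has_derivative[OF M c cr(1) m(2,1)] T(1)])
          show "coord c m \<in> T" using m by simp
          show "(coord c' \<circ> pt c) x = \<phi> x" if "x \<in> T" for x
            using that Timg by (auto simp: c'_def pt_coord[OF ch[OF c]])
        qed
        then have "chart_change c c' (coord c m) (T.Vf (coord c m)) = axis 2 1"
          using \<phi>V m frechet_derivative_eqI by metis
        then show ?thesis using Vtrans[OF c cr(1), of m] m by (simp add: T.Vf_def Vc)
      qed
      fix u v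
      have "(\<psi> has_derivative chart_change c' c (coord c' m)) (at (coord c' m))"
      proof (rule has_derivative_transform_within_open[OF chart_change_has_derivative[OF M cr(1) c m(1,2)] S(1)])
        show "coord c' m \<in> S" using m y by simp
        show "(coord c \<circ> pt c') x = \<psi> x" if x: "x \<in> S" for x
          using point[OF x] pt_coord[OF ch[OF cr(1)]] by auto
      qed
      then have "chart_change c' c y = FD \<psi> y" using frechet_derivative_eqI m(4) by metis
      moreover have "g c' (coord c' m) u v = g c (coord c m) (chart_change c' c (coord c' m) u) (chart_change c' c (coord c' m) v)"
        using g cr(1) c m unfolding lorentzian_metric_def by blast
      ultimately show "g c' y u v = sg * (u$1 * v$1 - (deriv Q (y$1))\<^sup>2 * (u$2 * v$2))"
        using met y m by simp
    qed
  qed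
  show ?thesis
  proof (intro conjI ballI impI killing, goal_cases)
    case (1 p)
    then obtain c where "c \<in> A" "p \<in> chart_dom c" "g c (coord c p) (V c (coord c p)) (V c (coord c p)) < 0"
      by (auto simp: spacelike_at_def)
    then show ?case using normal_form[of p c 1] 1 by simp
  next
    case (2 p)
    then obtain c where "c \<in> A" "p \<in> chart_dom c" "g c (coord c p) (V c (coord c p)) (V c (coord c p)) > 0"
      by (auto simp: timelike_at_def)
    then show ?case using normal_form[of p c "-1"] 2 by simp
  qed
qed

end
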